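(* Let $\lambda,\beta,\mu,\alpha>0$ and $\delta\in(1,2)$, let $u$ be the sticky CIR process with zero potential on $[0,\infty)$, and let $T_\alpha\sim\mathrm{Exp}(\alpha)$ be independent of $u$. With the notation of the context, for $x>0$ and every Borel set $A\subseteq[0,\infty)$, $$\mathbb{P}(u_{T_\alpha}\in A\mid u_0=x)=\frac\alpha\mu\,G^{\rm sticky}_\alpha(x,0)\,\mathbf 1_{0\in A}+\alpha\int_{A\cap(0,\infty)}G^{\rm sticky}_\alpha(x,y)\,m'(y)\,dy,$$ equivalently the three-component mixture $$\mathbb{P}(u_{T_\alpha}\in A\mid u_0=x)=w_0(x)\,\mathbf 1_{0\in A}+w_<(x)\,\nu_<(A)+w_>(x)\,\nu_>(A),$$ where $\nu_<$ and $\nu_>$ are the probability measures with Lebesgue densities $$\frac{d\nu_<}{dy}\propto f_0^{\rm sticky}(y)\,m'(y)\,\mathbf 1_{(0,x)}(y),\qquad \frac{d\nu_>}{dy}\propto U(a,b,z_y)\,m'(y)\,\mathbf 1_{(x,\infty)}(y),$$ and the weights are $$w_0(x)=-c_\mu\,U(a,b,z_x),\quad w_<(x)=\frac{\alpha\,U(a,b,z_x)}{|\mathcal W|}\int_0^x f_0^{\rm sticky}(y)\,m'(y)\,dy,\quad w_>(x)=\frac{\alpha\,f_0^{\rm sticky}(x)}{|\mathcal W|}\int_x^\infty U(a,b,z_y)\,m'(y)\,dy,$$ satisfying $w_0(x)+w_<(x)+w_>(x)=1$.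
   Context: The sticky CIR process with zero potential is the regular diffusion on $[0,\infty)$ with scale density $s'(x)=x^{1-\delta}e^{\lambda\beta x^2/2}$ and speed measure $m(dx)=m'(x)\,dx+\mu^{-1}\delta_0(dx)$, $m'(x)=\beta x^{\delta-1}e^{-\lambda\beta x^2/2}$, and generator $\frac{d}{dm}\frac{d}{ds}$; equivalently the unique weak solution of $du_t=[\frac{\delta-1}{\beta u_t}-\lambda u_t]\mathbf 1_{\{u_t>0\}}dt+\sqrt{2/\beta}\,\mathbf 1_{\{u_t>0\}}dW_t$, $\mathbf 1_{\{u_t=0\}}dt=\mu^{-1}d\ell^0_t(u)$, where $\ell_t^0(u)=\lim_{\varepsilon\downarrow0}\bigl(\int_0^\varepsilon m'(y)\,dy\bigr)^{-1}\int_0^t\mathbf 1_{\{0<u_s<\varepsilon\}}ds$. Notation: $a=\alpha/(2\lambda)$, $b=\delta/2$, $z_x=\lambda\beta x^2/2$; $M(a,b,z)={}_1F_1(a;b;z)$ and $U(a,b,z)$ are Kummer's confluent hypergeometric functions of the first and second kind; $U_0=U(a,b,0)=\frac{\Gamma(1-b)}{\Gamma(1+a-b)}$; $|\mathcal W|=\lambda\beta\frac{\Gamma(b)}{\Gamma(a)}\bigl(\frac{\lambda\beta}2\bigr)^{-b}$; $c_\mu=\frac{-\alpha}{\mu|\mathcal W|+\alpha U_0}$; $f_0^{\rm sticky}(x)=M(a,b,z_x)+c_\mu U(a,b,z_x)$; and the sticky resolvent kernel is $G^{\rm sticky}_\alpha(x,y)=f_0^{\rm sticky}(x\wedge y)\,U(a,b,z_{x\vee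 y})/|\mathcal W|$. *)

theory Defs
  imports "HOL-Probability.Probability"
begin

section \<open>Diffusions on the closed half-line\<close>

definition path_sigma :: "'w measure \<Rightarrow> (real \<Rightarrow> 'w \<Rightarrow> real) \<Rightarrow> real set \<Rightarrow> 'w measure" where
  "path_sigma \<Omega> X I = sigma (space \<Omega>) {X t -` B \<inter> space \<Omega> | t B. t \<in> I \<and> B \<in> sets borel}"

text \<open>
  A regular diffusion on \<open>[0,\<infinity>)\<close> without killing: a continuous strong Markov process, given by
  its laws \<open>P x\<close> (start in \<open>x\<close>) on one measurable space \<open>\<Omega>\<close>, in which every point can be
  reached from every other point.  The measure carried by \<open>\<Omega>\<close> itself is irrelevant, and \<open>\<Omega>\<close> may
  carry more than the process.  The values \<open>X t\<close> for \<open>t < 0\<close> and \<open>P x\<close> for \<open>x < 0\<close> are junk.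
  The strong Markov property is required for finite stopping times of the natural filtration;
  for a stopping time \<open>\<tau>\<close> with values in \<open>[0,\<infinity>]\<close> it follows on \<open>{\<tau> < \<infinity>}\<close> from \<open>min \<tau> n\<close>.
\<close>

locale regular_diffusion =
  fixes \<Omega> :: "'w measure" and P :: "real \<Rightarrow> 'w measure" and X :: "real \<Rightarrow> 'w \<Rightarrow> real"
  assumes prob_space_P: "\<And>x. 0 \<le> x \<Longrightarrow> prob_space (P x)"
    and sets_P: "\<And>x. 0 \<le> x \<Longrightarrow> sets (P x) = sets \<Omega>"
    and measurable_X: "\<And>t. 0 \<le> t \<Longrightarrow> X t \<in> borel_measurable \<Omega>"
    and nonneg_X: "\<And>t \<omega>. 0 \<le> t \<Longrightarrow> \<omega> \<in> space \<Omega> \<Longrightarrow> 0 \<le> X t \<omega>"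
    and continuous_X: "\<And>\<omega>. \<omega> \<in> space \<Omega> \<Longrightarrow> continuous_on {0..} (\<lambda>t. X t \<omega>)"
    and start: "\<And>x. 0 \<le> x \<Longrightarrow> AE \<omega> in P x. X 0 \<omega> = x"
    and measurable_transition: "\<And>t A. 0 \<le> t \<Longrightarrow> A \<in> sets borel \<Longrightarrow>
      (\<lambda>x. measure (P x) {\<omega> \<in> space \<Omega>. X t \<omega> \<in> A}) \<in> borel_measurable (restrict_space borel {0..})"
    and strong_markov: "\<And>x \<tau> B t A. 0 \<le> x \<Longrightarrow>
      stopping_time (\<lambda>t. path_sigma \<Omega> X {0..t}) \<tau> \<Longrightarrow> (\<And>\<omega>. \<omega> \<in> space \<Omega> \<Longrightarrow> 0 \<le> \<tau> \<omega>) \<Longrightarrow>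
      B \<in> sets (filtration.pre_sigma (space \<Omega>) (\<lambda>t. path_sigma \<Omega> X {0..t}) \<tau>) \<Longrightarrow>
      0 \<le> t \<Longrightarrow> A \<in> sets borel \<Longrightarrow>
      measure (P x) (B \<inter> {\<omega> \<in> space \<Omega>. X (\<tau> \<omega> + t) \<omega> \<in> A}) =
        (LINT \<omega>:B|P x. measure (P (X (\<tau> \<omega>) \<omega>)) {\<omega>' \<in> space \<Omega>. X t \<omega>' \<in> A})"
    and regular: "\<And>x y. 0 \<le> x \<Longrightarrow> 0 \<le> y \<Longrightarrow>
      0 < measure (P x) {\<omega> \<in> space \<Omega>. \<exists>t\<ge>0. X t \<omega> = y}"

definition C0_halfline :: "(real \<Rightarrow> real) set" where
  "C0_halfline = {f. continuous_on {0..} f \<and> (f \<longlongrightarrow> 0) at_top}"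

text \<open>
  The infinitesimal generator on \<open>C\<^sub>0([0,\<infinity>))\<close>, as a graph: \<open>f\<close> is in its domain and is mapped
  to \<open>g\<close>.  Only the values of \<open>f\<close> and \<open>g\<close> on \<open>[0,\<infinity>)\<close> matter.
\<close>

definition infinitesimal_generator ::
    "(real \<Rightarrow> 'w measure) \<Rightarrow> (real \<Rightarrow> 'w \<Rightarrow> real) \<Rightarrow> (real \<Rightarrow> real) \<Rightarrow> (real \<Rightarrow> real) \<Rightarrow> bool" where
  "infinitesimal_generator P X f g \<longleftrightarrow>
     f \<in> C0_halfline \<and> g \<in> C0_halfline \<and>
     uniform_limit {0..} (\<lambda>h x. ((LINT \<omega>|P x. f (X h \<omega>)) - f x) / h) g (at_right 0)"

text \<open>
  \<open>g = d/dm d/ds f\<close> on \<open>[0,\<infinity>)\<close> for a scale function \<open>s\<close> and a speed measure \<open>m\<close>.  Here \<open>D\<close> is the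
  right derivative of \<open>f\<close> with respect to \<open>s\<close>.  The last conjunct is the case of the point \<open>0\<close> in
  \<open>dD = g dm\<close>, with the convention \<open>D(0-) = 0\<close> at a non-killing boundary point of the state space;
  if \<open>m\<close> has an atom at \<open>0\<close>, it is the sticky boundary condition.
\<close>

definition dm_ds :: "(real \<Rightarrow> real) \<Rightarrow> real measure \<Rightarrow> (real \<Rightarrow> real) \<Rightarrow> (real \<Rightarrow> real) \<Rightarrow> bool" where
  "dm_ds s m f g \<longleftrightarrow> (\<exists>D.
     (\<forall>x\<ge>0. ((\<lambda>y. (f y - f x) / (s y - s x)) \<longlongrightarrow> D x) (at_right x)) \<and>
     (\<forall>x y. 0 \<le> x \<and> x \<le> y \<longrightarrow> D y - D x = (LINT z:{x<..y}|m. g z)) \<and>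
     D 0 = measure m {0} * g 0)"

section \<open>The sticky CIR process\<close>

definition scale_density :: "real \<Rightarrow> real \<Rightarrow> real \<Rightarrow> real \<Rightarrow> real" where
  "scale_density lam \<beta> \<delta> x = x powr (1 - \<delta>) * exp (lam * \<beta> * x\<^sup>2 / 2)"

definition scale_fun :: "real \<Rightarrow> real \<Rightarrow> real \<Rightarrow> real \<Rightarrow> real" where
  "scale_fun lam \<beta> \<delta> x = (LBINT y:{0<..x}. scale_density lam \<beta> \<delta> y)"

definition speed_density :: "real \<Rightarrow> real \<Rightarrow> real \<Rightarrow> real \<Rightarrow> real" where
  "speed_density lam \<beta> \<delta> x = \<beta> * x powr (\<delta> - 1) * exp (- lam * \<beta> * x\<^sup>2 / 2)"

definition sticky_speed_measure :: "real \<Rightarrow> real \<Rightarrow> real \<Rightarrow> real \<Rightarrow> real measure" where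
  "sticky_speed_measure lam \<beta> \<delta> \<mu> = measure_of UNIV (sets borel)
     (\<lambda>A. (\<integral>\<^sup>+x\<in>A \<inter> {0<..}. ennreal (speed_density lam \<beta> \<delta> x) \<partial>lborel)
        + ennreal (1 / \<mu>) * indicator A 0)"

lemma sets_sticky_speed_measure [simp, measurable_cong]:
  "sets (sticky_speed_measure lam \<beta> \<delta> \<mu>) = sets borel"
  unfolding sticky_speed_measure_def using sets.sigma_sets_eq[of "borel :: real measure"] by simp

lemma emeasure_sticky_speed_measure:
  assumes "A \<in> sets borel"
  shows "emeasure (sticky_speed_measure lam \<beta> \<delta> \<mu>) A =
    (\<integral>\<^sup>+x\<in>A \<inter> {0<..}. ennreal (speed_density lam \<beta> \<delta> x) \<partial>lborel) + ennreal (1 / \<mu>) * indicator A 0"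
proof -
  let ?d = "\<lambda>x. ennreal (speed_density lam \<beta> \<delta> x) * indicator {0<..} x"
  have meas: "?d \<in> borel_measurable lborel"
    unfolding speed_density_def by measurable
  have dens: "(\<integral>\<^sup>+x\<in>B \<inter> {0<..}. ennreal (speed_density lam \<beta> \<delta> x) \<partial>lborel) = emeasure (density lborel ?d) B"
    if "B \<in> sets borel" for B
    using that by (subst emeasure_density[OF meas])
      (auto intro!: nn_integral_cong split: split_indicator)
  have atom: "ennreal (1 / \<mu>) * indicator B (0::real) =
      emeasure (density (return borel 0) (\<lambda>_. ennreal (1 / \<mu>))) B"
    if "B \<in> sets borel" for B :: "real set"
    using that by (subst emeasure_density) (simp_all add: nn_integral_cmult)
  let ?\<nu> = "\<lambda>B. (\<integral>\<^sup>+x\<in>B \<inter> {0<..}. ennreal (speed_density lam \<beta> \<delta> x) \<partial>lborel)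
        + ennreal (1 / \<mu>) * indicator B 0"
  have "countably_additive (sets borel) ?\<nu>"
  proof (rule countably_additiveI)
    fix B :: "nat \<Rightarrow> real set"
    assume B: "range B \<subseteq> sets borel" "disjoint_family B" "\<Union> (range B) \<in> sets borel"
    have "(\<Sum>i. ?\<nu> (B i)) = (\<Sum>i. emeasure (density lborel ?d) (B i)
         + emeasure (density (return borel 0) (\<lambda>_. ennreal (1 / \<mu>))) (B i))"
      using B(1) by (intro suminf_cong) (simp add: dens atom range_subsetD)
    also have "\<dots> = (\<Sum>i. emeasure (density lborel ?d) (B i))
         + (\<Sum>i. emeasure (density (return borel 0) (\<lambda>_. ennreal (1 / \<mu>))) (B i))"
      by (simp add: suminf_add)
    also have "\<dots> = ?\<nu> (\<Union> (range B))"
      using B by (simp add: suminf_emeasure dens atom)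
    finally show "(\<Sum>i. ?\<nu> (B i)) = ?\<nu> (\<Union> (range B))" .
  qed
  moreover have "positive (sets borel) ?\<nu>"
    by (simp add: positive_def)
  moreover have "sigma_algebra UNIV (sets (borel :: real measure))"
    using sets.sigma_algebra_axioms[of "borel :: real measure"] by simp
  ultimately show ?thesis
    unfolding sticky_speed_measure_def using assms
    by (intro emeasure_measure_of_sigma) auto
qed

definition sticky_CIR :: "real \<Rightarrow> real \<Rightarrow> real \<Rightarrow> real \<Rightarrow>
    'w measure \<Rightarrow> (real \<Rightarrow> 'w measure) \<Rightarrow> (real \<Rightarrow> 'w \<Rightarrow> real) \<Rightarrow> bool" where
  "sticky_CIR lam \<beta> \<delta> \<mu> \<Omega> P X \<longleftrightarrow>
     regular_diffusion \<Omega> P X \<and>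
     (\<forall>f g. infinitesimal_generator P X f g \<longleftrightarrow>
        f \<in> C0_halfline \<and> g \<in> C0_halfline \<and>
        dm_ds (scale_fun lam \<beta> \<delta>) (sticky_speed_measure lam \<beta> \<delta> \<mu>) f g)"

section \<open>Kummer functions and the sticky resolvent kernel\<close>

definition kummer_M :: "real \<Rightarrow> real \<Rightarrow> real \<Rightarrow> real" where
  "kummer_M a b z = (\<Sum>n. pochhammer a n / pochhammer b n * z ^ n / fact n)"

text \<open>
  The standard definition of Kummer's function of the second kind for \<open>b\<close> not an integer and
  \<open>z \<ge> 0\<close>; below, \<open>b = \<delta>/2\<close> lies in \<open>(1/2, 1)\<close>.
\<close>

definition kummer_U :: "real \<Rightarrow> real \<Rightarrow> real \<Rightarrow> real" where
  "kummer_U a b z = Gamma (1 - b) / Gamma (1 + a - b) * kummer_M a b z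
     + Gamma (b - 1) / Gamma a * z powr (1 - b) * kummer_M (1 + a - b) (2 - b) z"

text \<open>The functions \<open>x \<mapsto> M(a,b,z\<^sub>x)\<close> and \<open>x \<mapsto> U(a,b,z\<^sub>x)\<close>:\<close>

definition M_CIR :: "real \<Rightarrow> real \<Rightarrow> real \<Rightarrow> real \<Rightarrow> real \<Rightarrow> real" where
  "M_CIR lam \<beta> \<delta> \<alpha> x = kummer_M (\<alpha> / (2 * lam)) (\<delta> / 2) (lam * \<beta> * x\<^sup>2 / 2)"

definition U_CIR :: "real \<Rightarrow> real \<Rightarrow> real \<Rightarrow> real \<Rightarrow> real \<Rightarrow> real" where
  "U_CIR lam \<beta> \<delta> \<alpha> x = kummer_U (\<alpha> / (2 * lam)) (\<delta> / 2) (lam * \<beta> * x\<^sup>2 / 2)"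

definition abs_wronskian :: "real \<Rightarrow> real \<Rightarrow> real \<Rightarrow> real \<Rightarrow> real" where
  "abs_wronskian lam \<beta> \<delta> \<alpha> =
     lam * \<beta> * (Gamma (\<delta> / 2) / Gamma (\<alpha> / (2 * lam))) * (lam * \<beta> / 2) powr (- (\<delta> / 2))"

definition c_sticky :: "real \<Rightarrow> real \<Rightarrow> real \<Rightarrow> real \<Rightarrow> real \<Rightarrow> real" where
  "c_sticky lam \<beta> \<delta> \<mu> \<alpha> =
     - \<alpha> / (\<mu> * abs_wronskian lam \<beta> \<delta> \<alpha> + \<alpha> * kummer_U (\<alpha> / (2 * lam)) (\<delta> / 2) 0)"

definition f0_sticky :: "real \<Rightarrow> real \<Rightarrow> real \<Rightarrow> real \<Rightarrow> real \<Rightarrow> real \<Rightarrow> real" where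
  "f0_sticky lam \<beta> \<delta> \<mu> \<alpha> x = M_CIR lam \<beta> \<delta> \<alpha> x + c_sticky lam \<beta> \<delta> \<mu> \<alpha> * U_CIR lam \<beta> \<delta> \<alpha> x"

definition G_sticky :: "real \<Rightarrow> real \<Rightarrow> real \<Rightarrow> real \<Rightarrow> real \<Rightarrow> real \<Rightarrow> real \<Rightarrow> real" where
  "G_sticky lam \<beta> \<delta> \<mu> \<alpha> x y =
     f0_sticky lam \<beta> \<delta> \<mu> \<alpha> (min x y) * U_CIR lam \<beta> \<delta> \<alpha> (max x y) / abs_wronskian lam \<beta> \<delta> \<alpha>"

section \<open>The mixture components\<close>

text \<open>
  The measure with Lebesgue density proportional to \<open>f\<close> on \<open>S\<close> and total mass \<open>1\<close>.  It is a
  probability measure only if \<open>f\<close> is integrable on \<open>S\<close>, of constant sign almost everywhere and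
  with nonzero integral.
\<close>

definition normalized_density :: "real set \<Rightarrow> (real \<Rightarrow> real) \<Rightarrow> real measure" where
  "normalized_density S f = density lborel (\<lambda>y. ennreal (f y * indicator S y / (LBINT z:S. f z)))"

definition nu_less :: "real \<Rightarrow> real \<Rightarrow> real \<Rightarrow> real \<Rightarrow> real \<Rightarrow> real \<Rightarrow> real measure" where
  "nu_less lam \<beta> \<delta> \<mu> \<alpha> x =
     normalized_density {0<..<x} (\<lambda>y. f0_sticky lam \<beta> \<delta> \<mu> \<alpha> y * speed_density lam \<beta> \<delta> y)"

definition nu_greater :: "real \<Rightarrow> real \<Rightarrow> real \<Rightarrow> real \<Rightarrow> real \<Rightarrow> real measure" where
  "nu_greater lam \<beta> \<delta> \<alpha> x =
     normalized_density {x<..} (\<lambda>y. U_CIR lam \<beta> \<delta> \<alpha> y * speed_density lam \<beta> \<delta> y)"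

definition w_zero :: "real \<Rightarrow> real \<Rightarrow> real \<Rightarrow> real \<Rightarrow> real \<Rightarrow> real \<Rightarrow> real" where
  "w_zero lam \<beta> \<delta> \<mu> \<alpha> x = - c_sticky lam \<beta> \<delta> \<mu> \<alpha> * U_CIR lam \<beta> \<delta> \<alpha> x"

definition w_less :: "real \<Rightarrow> real \<Rightarrow> real \<Rightarrow> real \<Rightarrow> real \<Rightarrow> real \<Rightarrow> real" where
  "w_less lam \<beta> \<delta> \<mu> \<alpha> x = \<alpha> * U_CIR lam \<beta> \<delta> \<alpha> x / abs_wronskian lam \<beta> \<delta> \<alpha>
     * (LBINT y:{0<..<x}. f0_sticky lam \<beta> \<delta> \<mu> \<alpha> y * speed_density lam \<beta> \<delta> y)"

definition w_greater :: "real \<Rightarrow> real \<Rightarrow> real \<Rightarrow> real \<Rightarrow> real \<Rightarrow> real \<Rightarrow> real" where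
  "w_greater lam \<beta> \<delta> \<mu> \<alpha> x = \<alpha> * f0_sticky lam \<beta> \<delta> \<mu> \<alpha> x / abs_wronskian lam \<beta> \<delta> \<alpha>
     * (LBINT y:{x<..}. U_CIR lam \<beta> \<delta> \<alpha> y * speed_density lam \<beta> \<delta> y)"

end

theory Submission
  imports Defs "HOL-Real_Asymp.Real_Asymp"
begin

text \<open>
  For continuous \<open>g\<close> vanishing near infinity, \<open>F(x) = \<integral> G\<^sub>\<alpha>(x, y) g(y) m(dy)\<close> solves
  \<open>d/dm d/ds F = \<alpha> F - g\<close>, including the sticky boundary condition at \<open>0\<close>, and vanishes at infinity
  since \<open>U(a, b, z) \<rightarrow> 0\<close>. Hence \<open>F\<close> lies in the domain of the generator, and integrating
  \<open>(d/dt) e\<^sup>-\<^sup>\<alpha>\<^sup>t E\<^sub>x F(u\<^sub>t) = - e\<^sup>-\<^sup>\<alpha>\<^sup>t E\<^sub>x g(u\<^sub>t)\<close> over \<open>[0, \<infinity>)\<close> identifies \<open>\<alpha> F(x)\<close> with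
  \<open>E\<^sub>x g(u\<^sub>T)\<close> for the independent exponential time \<open>T\<close>. As such \<open>g\<close> determine the law of \<open>u\<^sub>T\<close>, that law
  is \<open>\<alpha> G\<^sub>\<alpha>(x, y) m(dy)\<close>; that the weights sum to \<open>1\<close> is then its total mass, and no separate
  integral has to be computed.

  The decay of \<open>U\<close>, which is defined by power series, comes from the integral representation
  \<open>\<Gamma>(a) U(a, b, z) = \<integral>\<^sub>0\<^sup>\<infinity> e\<^sup>-\<^sup>z\<^sup>t t\<^sup>a\<^sup>-\<^sup>1 (1 + t)\<^sup>b\<^sup>-\<^sup>a\<^sup>-\<^sup>1 dt\<close>: both sides solve Kummer's equation, and the
  coefficients in terms of the two series solutions are constant Wronskians, evaluated as \<open>z \<rightarrow> 0\<close>.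
\<close>

section \<open>Power series solutions of Kummer's equation\<close>

text \<open>The constant \<open>c\<close> is forced by the boundary: for the homogeneous equation
  the sticky condition at 0 reads \<open>Df0 0 = \<alpha> / \<mu> * f0 0\<close>, and with
  \<open>DM 0 = 0\<close> and \<open>DU 0 = - w\<close> it is a linear equation for
  \<open>c\<close>. The same identity equates the atom \<open>\<alpha> / \<mu> * G x 0\<close> with
  \<open>w_zero\<close>. Every homogeneous solution is carried together with its flux. The
  second-order equation thereby becomes a system f' = p r, p' = s f whose unknowns extend
  continuously to 0 and for which f q - g p is constant; up to sign, \<open>w\<close> is this
  constant for \<open>f0\<close> and \<open>U\<close>. The generator is given only as a graph on
  continuous functions vanishing at infinity, so a candidate for its domain must be shown to decay,
  while no growth estimate for \<open>f0\<close> is at hand. Test functions that vanish beyond some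
  R remove the obstacle, because F is then a multiple of \<open>U\<close> beyond R. Integrability of
  \<open>G x y * m' y\<close> over the half-line is not computed either: it follows once the kernel
  is known to be a probability law.\<close>

lemma pochhammer_le_power_mult:
  fixes a b :: real
  assumes "0 < a" "0 < b"
  shows "pochhammer a n \<le> (max 1 (a / b)) ^ n * pochhammer b n"
proof (induction n)
  case (Suc n)
  \<comment> \<open>The ratio (a + n) / (b + n) lies between 1 and a / b, which is where the base
    \<open>max 1 (a / b)\<close> comes from.\<close>
  have "a + real n \<le> max 1 (a / b) * (b + real n)"
  proof (cases "a \<le> b")
    case True
    then have "a + real n \<le> 1 * (b + real n)" by simp
    also have "\<dots> \<le> max 1 (a / b) * (b + real n)"
      using assms by (intro mult_right_mono) auto
    finally show ?thesis .
  next
    case False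
    then have "1 \<le> a / b" using assms by simp
    then have "a + real n \<le> (a / b) * (b + real n)"
      using assms False by (simp add: field_simps mult_right_mono)
    also have "\<dots> \<le> max 1 (a / b) * (b + real n)"
      using assms by (intro mult_right_mono) auto
    finally show ?thesis .
  qed
  then have "pochhammer a n * (a + real n)
      \<le> ((max 1 (a / b)) ^ n * pochhammer b n) * (max 1 (a / b) * (b + real n))"
    using Suc assms by (intro mult_mono) (auto intro!: mult_nonneg_nonneg pochhammer_nonneg)
  then show ?case by (simp add: pochhammer_Suc algebra_simps)
qed simp

definition kummer_coeff :: "real \<Rightarrow> real \<Rightarrow> nat \<Rightarrow> real" where
  "kummer_coeff a b n = pochhammer a n / pochhammer b n / fact n"

lemma kummer_M_altdef: "kummer_M a b z = (\<Sum>n. kummer_coeff a b n * z ^ n)"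
  unfolding kummer_M_def kummer_coeff_def by (simp add: field_simps)

lemma kummer_coeff_0 [simp]: "kummer_coeff a b 0 = 1"
  by (simp add: kummer_coeff_def)

lemma kummer_coeff_pos: "0 < a \<Longrightarrow> 0 < b \<Longrightarrow> 0 < kummer_coeff a b n"
  unfolding kummer_coeff_def by (intro divide_pos_pos pochhammer_pos) auto

lemma kummer_coeff_Suc:
  assumes "0 < b"
  shows "real (Suc n) * (b + real n) * kummer_coeff a b (Suc n) = (a + real n) * kummer_coeff a b n"
proof -
  have "b + real n \<noteq> 0" "pochhammer b n \<noteq> 0" "real (Suc n) \<noteq> 0"
    using assms pochhammer_pos[of b n] by auto
  then show ?thesis
    unfolding kummer_coeff_def by (simp add: pochhammer_Suc divide_simps del: of_nat_Suc)
qed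

text \<open>Ratios of Pochhammer symbols grow at most geometrically, so an exponential series
  dominates. Convergence for every \<open>z\<close> is what term-by-term differentiation
  requires.\<close>

lemma summable_kummer:
  assumes "0 < a" "0 < b"
  shows "summable (\<lambda>n. kummer_coeff a b n * z ^ n)"
proof (rule summable_comparison_test)
  let ?C = "max 1 (a / b)"
  show "summable (\<lambda>n. inverse (fact n) * (?C * \<bar>z\<bar>) ^ n)"
    by (rule summable_exp)
  have "norm (kummer_coeff a b n * z ^ n) \<le> inverse (fact n) * (?C * \<bar>z\<bar>) ^ n" for n
  proof -
    have "pochhammer a n / pochhammer b n \<le> ?C ^ n"
      using pochhammer_le_power_mult[OF assms, of n] pochhammer_pos[of b n] assms
      by (simp add: field_simps)
    then have "kummer_coeff a b n * \<bar>z\<bar> ^ n \<le> ?C ^ n / fact n * \<bar>z\<bar> ^ n"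
      unfolding kummer_coeff_def by (intro mult_right_mono divide_right_mono) auto
    then show ?thesis
      using kummer_coeff_pos[OF assms, of n]
      by (simp add: abs_mult power_abs power_mult_distrib field_simps)
  qed
  then show "\<exists>N. \<forall>n\<ge>N. norm (kummer_coeff a b n * z ^ n) \<le> inverse (fact n) * (?C * \<bar>z\<bar>) ^ n"
    by blast
qed

definition kummer_M' :: "real \<Rightarrow> real \<Rightarrow> real \<Rightarrow> real" where
  "kummer_M' a b z = (\<Sum>n. diffs (kummer_coeff a b) n * z ^ n)"

definition kummer_M'' :: "real \<Rightarrow> real \<Rightarrow> real \<Rightarrow> real" where
  "kummer_M'' a b z = (\<Sum>n. diffs (diffs (kummer_coeff a b)) n * z ^ n)"

lemma summable_diffs_kummer:
  assumes "0 < a" "0 < b"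
  shows "summable (\<lambda>n. diffs (kummer_coeff a b) n * z ^ n)"
    and "summable (\<lambda>n. diffs (diffs (kummer_coeff a b)) n * z ^ n)"
proof -
  show 1: "summable (\<lambda>n. diffs (kummer_coeff a b) n * z ^ n)" for z
    by (rule termdiff_converges_all) (rule summable_kummer[OF assms])
  show "summable (\<lambda>n. diffs (diffs (kummer_coeff a b)) n * z ^ n)"
    by (rule termdiff_converges_all) (rule 1)
qed

lemma DERIV_kummer_M:
  assumes "0 < a" "0 < b"
  shows "(kummer_M a b has_real_derivative kummer_M' a b z) (at z)"
    and "(kummer_M' a b has_real_derivative kummer_M'' a b z) (at z)"
proof -
  show "(kummer_M a b has_real_derivative kummer_M' a b z) (at z)"
    unfolding kummer_M_altdef[abs_def] kummer_M'_def
    by (rule termdiffs_strong_converges_everywhere) (rule summable_kummer[OF assms])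
  show "(kummer_M' a b has_real_derivative kummer_M'' a b z) (at z)"
    unfolding kummer_M'_def[abs_def] kummer_M''_def
    by (rule termdiffs_strong_converges_everywhere) (rule summable_diffs_kummer[OF assms])
qed

lemma kummer_ode:
  assumes "0 < a" "0 < b"
  shows "z * kummer_M'' a b z + (b - z) * kummer_M' a b z = a * kummer_M a b z"
proof -
  let ?c = "kummer_coeff a b"
  \<comment> \<open>Multiplying the differentiated series by \<open>z\<close> restores the original
    exponents: the coefficient of z^n becomes n * d n, and the term n = 0 vanishes. All four series
    can then be compared power by power.\<close>
  have shift: "(\<lambda>n. real n * d n * z ^ n) sums (z * (\<Sum>n. diffs d n * z ^ n))"
    if "summable (\<lambda>n. diffs d n * z ^ n)" for d :: "nat \<Rightarrow> real"
  proof -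
    have "(\<lambda>n. z * (diffs d n * z ^ n)) sums (z * (\<Sum>n. diffs d n * z ^ n))"
      using that by (intro sums_mult summable_sums)
    then have "(\<lambda>n. real (Suc n) * d (Suc n) * z ^ Suc n) sums (z * (\<Sum>n. diffs d n * z ^ n))"
      by (simp add: diffs_def algebra_simps)
    then show ?thesis
      by (subst (asm) sums_Suc_iff) simp
  qed
  have 1: "(\<lambda>n. real n * diffs ?c n * z ^ n) sums (z * kummer_M'' a b z)"
    unfolding kummer_M''_def by (rule shift) (rule summable_diffs_kummer[OF assms])
  have 2: "(\<lambda>n. b * (diffs ?c n * z ^ n)) sums (b * kummer_M' a b z)"
    unfolding kummer_M'_def by (intro sums_mult summable_sums summable_diffs_kummer[OF assms])
  have 3: "(\<lambda>n. real n * ?c n * z ^ n) sums (z * kummer_M' a b z)"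
    unfolding kummer_M'_def by (rule shift) (rule summable_diffs_kummer[OF assms])
  have 4: "(\<lambda>n. a * (?c n * z ^ n)) sums (a * kummer_M a b z)"
    unfolding kummer_M_altdef by (intro sums_mult summable_sums summable_kummer[OF assms])
  have "real n * diffs ?c n * z ^ n + b * (diffs ?c n * z ^ n) - real n * ?c n * z ^ n
      = a * (?c n * z ^ n)" for n
  proof -
    have "(b + real n) * diffs ?c n = (a + real n) * ?c n"
      using kummer_coeff_Suc[OF assms(2), of n a] by (simp add: diffs_def mult_ac del: of_nat_Suc)
    then have "((b + real n) * diffs ?c n) * z ^ n = ((a + real n) * ?c n) * z ^ n" by simp
    then show ?thesis by (simp add: algebra_simps)
  qed
  with sums_diff[OF sums_add[OF 1 2] 3] sums_unique2[OF _ 4]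
  have "z * kummer_M'' a b z + b * kummer_M' a b z - z * kummer_M' a b z = a * kummer_M a b z"
    by simp
  then show ?thesis by (simp add: algebra_simps)
qed

lemma kummer_M_0 [simp]: "kummer_M a b 0 = 1"
  unfolding kummer_M_altdef by (subst powser_zero) simp

lemma kummer_M_ge_1:
  assumes "0 < a" "0 < b" "0 \<le> z"
  shows "1 \<le> kummer_M a b z"
proof -
  have "(\<Sum>n\<in>{0}. kummer_coeff a b n * z ^ n) \<le> kummer_M a b z"
    unfolding kummer_M_altdef using assms
    by (intro sum_le_suminf summable_kummer) (auto intro!: mult_nonneg_nonneg less_imp_le[OF kummer_coeff_pos])
  then show ?thesis by simp
qed

lemmas continuous_kummer_M [continuous_intros] =
  DERIV_continuous_on[OF DERIV_subset[OF DERIV_kummer_M(1) subset_UNIV]]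
lemmas continuous_kummer_M' [continuous_intros] =
  DERIV_continuous_on[OF DERIV_subset[OF DERIV_kummer_M(2) subset_UNIV]]

text \<open>
  For a solution \<open>w\<close> of Kummer's equation, \<open>p(z) = z\<^sup>b e\<^sup>-\<^sup>z w'(z)\<close> satisfies
  \<open>p' = a z\<^sup>b\<^sup>-\<^sup>1 e\<^sup>-\<^sup>z w\<close>; unlike \<open>w'\<close>, it has a limit at \<open>0\<close> for every solution.
\<close>

definition kummer_flux_M :: "real \<Rightarrow> real \<Rightarrow> real \<Rightarrow> real" where
  "kummer_flux_M a b z = z powr b * exp (- z) * kummer_M' a b z"

text \<open>The second Frobenius solution of Kummer's equation at 0, with exponent 1 - b.\<close>

definition kummer_N :: "real \<Rightarrow> real \<Rightarrow> real \<Rightarrow> real" where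
  "kummer_N a b z = z powr (1 - b) * kummer_M (1 + a - b) (2 - b) z"

text \<open>The flux z^b e^(-z) N' with the powers of z already cancelled, so that its value at 0 is
  the limit 1 - b. The uncancelled product would evaluate to 0 there, since
  \<open>0 powr b = 0\<close>.\<close>

definition kummer_flux_N :: "real \<Rightarrow> real \<Rightarrow> real \<Rightarrow> real" where
  "kummer_flux_N a b z = exp (- z) *
     ((1 - b) * kummer_M (1 + a - b) (2 - b) z + z * kummer_M' (1 + a - b) (2 - b) z)"

lemma DERIV_kummer_flux_M:
  assumes "0 < a" "0 < b" "0 < z"
  shows "(kummer_M a b has_real_derivative kummer_flux_M a b z * exp z * z powr (- b)) (at z)"
    and "(kummer_flux_M a b has_real_derivative a * z powr (b - 1) * exp (- z) * kummer_M a b z) (at z)"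
proof -
  have "kummer_flux_M a b z * exp z * z powr (- b) = kummer_M' a b z"
    using assms by (simp add: kummer_flux_M_def powr_minus exp_minus field_simps)
  then show "(kummer_M a b has_real_derivative kummer_flux_M a b z * exp z * z powr (- b)) (at z)"
    using DERIV_kummer_M(1)[OF assms(1,2)] by simp
  have z: "z powr b = z * z powr (b - 1)"
    using assms by (simp add: powr_diff)
  have "(kummer_flux_M a b has_real_derivative
     (b * z powr (b - 1) * exp (- z) - z powr b * exp (- z)) * kummer_M' a b z
      + z powr b * exp (- z) * kummer_M'' a b z) (at z)"
    unfolding kummer_flux_M_def[abs_def] using assms
    by (auto intro!: derivative_eq_intros DERIV_kummer_M simp: algebra_simps)
  also have "(b * z powr (b - 1) * exp (- z) - z powr b * exp (- z)) * kummer_M' a b z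
      + z powr b * exp (- z) * kummer_M'' a b z
     = z powr (b - 1) * exp (- z) * (z * kummer_M'' a b z + (b - z) * kummer_M' a b z)"
    by (simp add: z algebra_simps)
  also have "\<dots> = a * z powr (b - 1) * exp (- z) * kummer_M a b z"
    by (simp add: kummer_ode[OF assms(1,2)])
  finally show "(kummer_flux_M a b has_real_derivative a * z powr (b - 1) * exp (- z) * kummer_M a b z) (at z)" .
qed

text \<open>Kummer's equation for the parameters \<open>1 + a - b\<close> and \<open>2 - b\<close>
  has right-hand side (1 + a - b) M; differentiating the flux contributes -(1 - b) M. What remains
  is a M, so both fluxes satisfy the same equation.\<close>

lemma DERIV_kummer_flux_N:
  assumes "0 < a" "b < 1" "0 < z"
  shows "(kummer_N a b has_real_derivative kummer_flux_N a b z * exp z * z powr (- b)) (at z)"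
    and "(kummer_flux_N a b has_real_derivative a * z powr (b - 1) * exp (- z) * kummer_N a b z) (at z)"
proof -
  have ab: "0 < 1 + a - b" "0 < 2 - b" using assms by auto
  have "(kummer_N a b has_real_derivative (1 - b) * z powr (- b) * kummer_M (1 + a - b) (2 - b) z
     + z powr (1 - b) * kummer_M' (1 + a - b) (2 - b) z) (at z)"
    unfolding kummer_N_def[abs_def] using assms
    by (auto intro!: derivative_eq_intros DERIV_kummer_M ab simp: algebra_simps)
  also have "(1 - b) * z powr (- b) * kummer_M (1 + a - b) (2 - b) z
     + z powr (1 - b) * kummer_M' (1 + a - b) (2 - b) z = kummer_flux_N a b z * exp z * z powr (- b)"
    using assms by (simp add: kummer_flux_N_def exp_minus powr_minus powr_diff divide_simps)
  finally show "(kummer_N a b has_real_derivative kummer_flux_N a b z * exp z * z powr (- b)) (at z)" .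
  let ?M = "kummer_M (1 + a - b) (2 - b) z" and ?M' = "kummer_M' (1 + a - b) (2 - b) z"
    and ?M'' = "kummer_M'' (1 + a - b) (2 - b) z"
  have "(kummer_flux_N a b has_real_derivative
      exp (- z) * ((1 - b) * ?M' + ?M' + z * ?M'') - exp (- z) * ((1 - b) * ?M + z * ?M')) (at z)"
    unfolding kummer_flux_N_def[abs_def]
    by (auto intro!: derivative_eq_intros DERIV_kummer_M ab simp: algebra_simps)
  also have "exp (- z) * ((1 - b) * ?M' + ?M' + z * ?M'') - exp (- z) * ((1 - b) * ?M + z * ?M')
      = exp (- z) * ((z * ?M'' + ((2 - b) - z) * ?M') - (1 - b) * ?M)"
    by (simp add: algebra_simps)
  also have "\<dots> = exp (- z) * (a * ?M)"
    by (simp only: kummer_ode[OF ab]) (simp add: algebra_simps)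
  also have "\<dots> = a * z powr (b - 1) * exp (- z) * kummer_N a b z"
    using assms by (simp add: kummer_N_def flip: powr_add)
  finally show "(kummer_flux_N a b has_real_derivative a * z powr (b - 1) * exp (- z) * kummer_N a b z) (at z)" .
qed

lemma continuous_on_powr_atLeast_0: "0 < c \<Longrightarrow> continuous_on {0..} (\<lambda>z::real. z powr c)"
  by (intro continuous_on_powr') (auto intro!: continuous_intros)

lemma continuous_on_kummer:
  assumes "0 < a" "0 < b" "b < 1"
  shows "continuous_on {0..} (kummer_M a b)" "continuous_on {0..} (kummer_flux_M a b)"
    "continuous_on {0..} (kummer_N a b)" "continuous_on {0..} (kummer_flux_N a b)"
  unfolding kummer_flux_M_def[abs_def] kummer_N_def[abs_def] kummer_flux_N_def[abs_def] using assms
  by (auto intro!: continuous_intros continuous_on_powr_atLeast_0)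

lemma kummer_at_0:
  assumes "b < 1"
  shows "kummer_flux_M a b 0 = 0" "kummer_N a b 0 = 0" "kummer_flux_N a b 0 = 1 - b"
  using assms by (simp_all add: kummer_flux_M_def kummer_N_def kummer_flux_N_def)

section \<open>The integral representation of \<open>U\<close>\<close>

lemma nn_integral_Gamma_scaled:
  fixes c z :: real
  assumes c: "-1 < c" and z: "0 < z"
  shows "(\<integral>\<^sup>+t. ennreal (indicator {0<..} t * (exp (- z * t) * t powr c)) \<partial>lborel)
    = ennreal (Gamma (c + 1) * z powr (- (c + 1)))"
proof -
  let ?f = "\<lambda>s. ennreal (indicator {0..} s * s powr (c + 1 - 1) / exp s)"
  have "ennreal (Gamma (c + 1)) = (\<integral>\<^sup>+s. ?f s \<partial>lborel)"
    using c by (intro Gamma_conv_nn_integral_real) simp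
  also have "\<dots> = ennreal \<bar>z\<bar> * (\<integral>\<^sup>+t. ?f (0 + z * t) \<partial>lborel)"
    using z by (intro nn_integral_real_affine) auto
  also have "(\<integral>\<^sup>+t. ?f (0 + z * t) \<partial>lborel)
      = (\<integral>\<^sup>+t. ennreal (z powr c) * ennreal (indicator {0<..} t * (exp (- z * t) * t powr c)) \<partial>lborel)"
    using z by (intro nn_integral_cong)
      (auto simp: indicator_def powr_mult exp_minus zero_le_mult_iff divide_inverse mult_ac simp flip: ennreal_mult'')
  also have "\<dots> = ennreal (z powr c) * (\<integral>\<^sup>+t. ennreal (indicator {0<..} t * (exp (- z * t) * t powr c)) \<partial>lborel)"
    by (intro nn_integral_cmult) auto
  finally have eq: "ennreal (Gamma (c + 1)) = ennreal (z powr (c + 1)) *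
      (\<integral>\<^sup>+t. ennreal (indicator {0<..} t * (exp (- z * t) * t powr c)) \<partial>lborel)"
    using z by (simp add: powr_add ennreal_mult'' mult.assoc mult.left_commute mult.commute)
  have "ennreal (Gamma (c + 1) * z powr (- (c + 1))) = ennreal (z powr (- (c + 1))) * ennreal (Gamma (c + 1))"
    using z by (simp add: ennreal_mult'' mult.commute)
  also have "\<dots> = ennreal (z powr (- (c + 1)) * z powr (c + 1)) *
      (\<integral>\<^sup>+t. ennreal (indicator {0<..} t * (exp (- z * t) * t powr c)) \<partial>lborel)"
    by (simp only: eq ennreal_mult'' powr_ge_zero mult.assoc)
  also have "z powr (- (c + 1)) * z powr (c + 1) = 1"
    using z by (simp flip: powr_add)
  finally show ?thesis by simp
qed

lemma Gamma_integral_scaled: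
  fixes c z :: real
  assumes c: "-1 < c" and z: "0 < z"
  shows "set_integrable lborel {0<..} (\<lambda>t. exp (- z * t) * t powr c)"
    and "(LBINT t:{0<..}. exp (- z * t) * t powr c) = Gamma (c + 1) * z powr (- (c + 1))"
proof -
  have "Gamma (c + 1) * z powr (- (c + 1)) \<ge> 0"
    using assms by (intro mult_nonneg_nonneg less_imp_le[OF Gamma_real_pos]) auto
  then have "has_bochner_integral lborel (\<lambda>t. indicator {0<..} t * (exp (- z * t) * t powr c))
      (Gamma (c + 1) * z powr (- (c + 1)))"
    by (intro has_bochner_integral_nn_integral nn_integral_Gamma_scaled assms) auto
  then show "set_integrable lborel {0<..} (\<lambda>t. exp (- z * t) * t powr c)"
    and "(LBINT t:{0<..}. exp (- z * t) * t powr c) = Gamma (c + 1) * z powr (- (c + 1))"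
    by (auto simp: has_bochner_integral_iff set_integrable_def set_lebesgue_integral_def)
qed

text \<open>The value of the integral representation at z = 0. Writing Gamma(1 + a - b) (1 + t)^(b -
  a - 1) as a Gamma integral in s and exchanging the order by Tonelli factors the double integral
  into Gamma(a) Gamma(1 - b).\<close>

lemma nn_integral_Beta_prime:
  fixes a b :: real
  assumes a: "0 < a" and b: "b < 1"
  shows "(\<integral>\<^sup>+t. ennreal (indicator {0<..} t * (t powr (a - 1) * (1 + t) powr (b - a - 1))) \<partial>lborel)
    = ennreal (Gamma a * Gamma (1 - b) / Gamma (1 + a - b))" (is "?I = _")
proof -
  let ?G = "Gamma (1 + a - b)"
  have G: "?G > 0" using assms by (intro Gamma_real_pos) auto
  let ?h = "\<lambda>t s. ennreal (indicator {0<..} t * t powr (a - 1) *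
     (indicator {0<..} s * (exp (- (1 + t) * s) * s powr (a - b))))"
  have "ennreal ?G * ?I = (\<integral>\<^sup>+t. ennreal ?G * ennreal (indicator {0<..} t * (t powr (a - 1) * (1 + t) powr (b - a - 1))) \<partial>lborel)"
    by (intro nn_integral_cmult[symmetric]) auto
  also have "\<dots> = (\<integral>\<^sup>+t. \<integral>\<^sup>+s. ?h t s \<partial>lborel \<partial>lborel)"
  proof (intro nn_integral_cong)
    fix t :: real
    show "ennreal ?G * ennreal (indicator {0<..} t * (t powr (a - 1) * (1 + t) powr (b - a - 1)))
        = (\<integral>\<^sup>+s. ?h t s \<partial>lborel)"
    proof (cases "t > 0")
      case True
      have "(\<integral>\<^sup>+s. ?h t s \<partial>lborel) = ennreal (t powr (a - 1)) *
          (\<integral>\<^sup>+s. ennreal (indicator {0<..} s * (exp (- (1 + t) * s) * s powr (a - b))) \<partial>lborel)"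
        using True by (subst nn_integral_cmult[symmetric])
          (auto intro!: nn_integral_cong simp flip: ennreal_mult'')
      also have "\<dots> = ennreal (t powr (a - 1)) * ennreal (Gamma (a - b + 1) * (1 + t) powr (- (a - b + 1)))"
        using True assms by (subst nn_integral_Gamma_scaled) auto
      also have "\<dots> = ennreal ?G * ennreal (t powr (a - 1) * (1 + t) powr (b - a - 1))"
        using G by (simp add: algebra_simps flip: ennreal_mult'')
      finally show ?thesis using True by simp
    qed simp
  qed
  also have "\<dots> = (\<integral>\<^sup>+s. \<integral>\<^sup>+t. ?h t s \<partial>lborel \<partial>lborel)"
    by (intro lborel_pair.Fubini') auto
  also have "\<dots> = (\<integral>\<^sup>+s. ennreal (Gamma a) * ennreal (indicator {0<..} s * (exp (- 1 * s) * s powr (- b))) \<partial>lborel)"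
  proof (intro nn_integral_cong)
    fix s :: real
    show "(\<integral>\<^sup>+t. ?h t s \<partial>lborel) = ennreal (Gamma a) * ennreal (indicator {0<..} s * (exp (- 1 * s) * s powr (- b)))"
    proof (cases "s > 0")
      case True
      have "(\<integral>\<^sup>+t. ?h t s \<partial>lborel) = (\<integral>\<^sup>+t. ennreal (exp (- s) * s powr (a - b)) *
          ennreal (indicator {0<..} t * (exp (- s * t) * t powr (a - 1))) \<partial>lborel)"
        using True by (intro nn_integral_cong)
          (auto simp: exp_add[symmetric] algebra_simps indicator_def simp flip: ennreal_mult'')
      also have "\<dots> = ennreal (exp (- s) * s powr (a - b)) *
          (\<integral>\<^sup>+t. ennreal (indicator {0<..} t * (exp (- s * t) * t powr (a - 1))) \<partial>lborel)"
        by (intro nn_integral_cmult) auto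
      also have "\<dots> = ennreal (exp (- s) * s powr (a - b)) * ennreal (Gamma (a - 1 + 1) * s powr (- (a - 1 + 1)))"
        using True assms by (subst nn_integral_Gamma_scaled) auto
      also have "\<dots> = ennreal (Gamma a * (exp (- s) * (s powr (a - b) * s powr (- a))))"
        using Gamma_real_pos[OF a] by (simp add: mult_ac flip: ennreal_mult'')
      also have "s powr (a - b) * s powr (- a) = s powr (- b)"
        by (simp flip: powr_add)
      finally show ?thesis using True Gamma_real_pos[OF a] by (simp flip: ennreal_mult'')
    qed simp
  qed
  also have "\<dots> = ennreal (Gamma a) * ennreal (Gamma (- b + 1) * 1 powr (- (- b + 1)))"
    using assms by (subst nn_integral_cmult, simp, subst nn_integral_Gamma_scaled) auto
  finally have "ennreal ?G * ?I = ennreal (Gamma a * Gamma (1 - b))"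
    using Gamma_real_pos[OF a] Gamma_real_pos[of "1 - b"] b by (simp flip: ennreal_mult'')
  then have "ennreal (inverse ?G) * (ennreal ?G * ?I) = ennreal (inverse ?G) * ennreal (Gamma a * Gamma (1 - b))"
    by simp
  moreover have "ennreal (inverse ?G) * (ennreal ?G * ?I) = ?I"
    using G by (subst mult.assoc[symmetric]) (simp flip: ennreal_mult'')
  ultimately show ?thesis
    using G Gamma_real_pos[OF a] Gamma_real_pos[of "1 - b"] b
    by (simp add: field_simps flip: ennreal_mult'')
qed

section \<open>The integral representation and its derivatives in z\<close>

definition kummer_int :: "real \<Rightarrow> real \<Rightarrow> real \<Rightarrow> real" where
  "kummer_int c d z = (LBINT t:{0<..}. exp (- z * t) * t powr c * (1 + t) powr d)"

lemma powr_nonpos_le_1: "1 \<le> x \<Longrightarrow> d \<le> 0 \<Longrightarrow> x powr d \<le> (1::real)"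
  by (metis powr_mono powr_zero_eq_one not_one_le_zero)

lemma set_integrable_kummer_int:
  fixes c d z :: real
  assumes "-1 < c" "d \<le> 0" "0 < z"
  shows "set_integrable lborel {0<..} (\<lambda>t. exp (- z * t) * t powr c * (1 + t) powr d)"
proof (rule set_integrable_bound[OF Gamma_integral_scaled(1)[OF assms(1,3)]])
  show "set_borel_measurable lborel {0<..} (\<lambda>t. exp (- z * t) * t powr c * (1 + t) powr d)"
    unfolding set_borel_measurable_def by measurable
  have "exp (- z * t) * t powr c * (1 + t) powr d \<le> exp (- z * t) * t powr c" if "t > 0" for t
    using that assms by (intro mult_left_le powr_nonpos_le_1) auto
  then show "AE t in lborel. t \<in> {0<..} \<longrightarrow>
      norm (exp (- z * t) * t powr c * (1 + t) powr d) \<le> norm (exp (- z * t) * t powr c)"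
    by (auto simp: abs_mult)
qed

lemma kummer_int_le:
  assumes "-1 < c" "d \<le> 0" "0 < z"
  shows "kummer_int c d z \<le> Gamma (c + 1) * z powr (- (c + 1))"
  unfolding kummer_int_def Gamma_integral_scaled(2)[OF assms(1,3), symmetric]
  using assms by (intro set_integral_mono set_integrable_kummer_int Gamma_integral_scaled(1) mult_left_le powr_nonpos_le_1) auto

lemma set_integral_pos:
  fixes f :: "real \<Rightarrow> real"
  assumes f: "set_integrable lborel S f" and pos: "\<And>t. t \<in> S \<Longrightarrow> 0 < f t"
    and S: "S \<in> sets lborel" "emeasure lborel S \<noteq> 0"
  shows "0 < (LBINT t:S. f t)"
proof -
  have nonneg: "AE t in lborel. 0 \<le> indicator S t *\<^sub>R f t"
    using pos by (auto simp: indicator_def less_imp_le)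
  have "(LBINT t:S. f t) \<noteq> 0"
  proof
    assume "(LBINT t:S. f t) = 0"
    then have "AE t in lborel. indicator S t *\<^sub>R f t = 0"
      using f nonneg unfolding set_integrable_def set_lebesgue_integral_def
      by (subst (asm) integral_nonneg_eq_0_iff_AE) auto
    then have "AE t in lborel. t \<notin> S"
      by eventually_elim (use pos in \<open>force simp: indicator_def split: if_splits\<close>)
    then have "emeasure lborel {t \<in> space lborel. \<not> t \<notin> S} = 0"
      using S by (subst (asm) AE_iff_measurable) auto
    with S show False by simp
  qed
  moreover have "0 \<le> (LBINT t:S. f t)"
    unfolding set_lebesgue_integral_def using nonneg by (rule integral_nonneg_AE)
  ultimately show ?thesis by simp
qed

lemma emeasure_lborel_greaterThan [simp]: "emeasure lborel {a<..} \<noteq> 0" for a :: real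
proof -
  have "emeasure lborel {a<..a + 1} \<le> emeasure lborel {a<..}"
    by (intro emeasure_mono) auto
  then show ?thesis by auto
qed

lemma kummer_int_pos:
  assumes "-1 < c" "d \<le> 0" "0 < z"
  shows "0 < kummer_int c d z"
  unfolding kummer_int_def
  by (intro set_integral_pos set_integrable_kummer_int assms) auto

lemma abs_exp_diff_le: "\<bar>exp (- x) - 1 + x\<bar> \<le> exp \<bar>x\<bar> * x\<^sup>2 / 2" for x :: real
proof -
  obtain t where t: "\<bar>t\<bar> \<le> \<bar>- x\<bar>" "exp (- x) = (\<Sum>m<2. (- x) ^ m / fact m) + exp t / fact 2 * (- x) ^ 2"
    using Maclaurin_exp_le[of "- x" 2] by auto
  then have "exp (- x) - 1 + x = exp t * x\<^sup>2 / 2" by (simp add: numeral_2_eq_2)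
  then have "\<bar>exp (- x) - 1 + x\<bar> = exp t * x\<^sup>2 / 2" by (simp only:) simp
  also have "exp t * x\<^sup>2 \<le> exp \<bar>x\<bar> * x\<^sup>2" using t by (intro mult_right_mono) auto
  finally show ?thesis by simp
qed

text \<open>Differentiation under the integral sign with an explicit remainder. The restriction |h|
  <= z / 2 lets half of the decay e^(-z t) absorb the factor e^(|h| t) from Taylor's formula for
  exp, and the square of t raises the exponent \<open>c\<close> by 2.\<close>

lemma kummer_int_taylor:
  assumes c: "-1 < c" and d: "d \<le> 0" and z: "0 < z" and h: "\<bar>h\<bar> \<le> z / 2"
  shows "\<bar>kummer_int c d (z + h) - kummer_int c d z + h * kummer_int (c + 1) d z\<bar>
    \<le> h\<^sup>2 / 2 * kummer_int (c + 2) d (z / 2)"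
proof -
  let ?F = "\<lambda>c z t. exp (- z * t) * t powr c * (1 + t) powr d"
  have zh: "0 < z + h" using z h by linarith
  note int = set_integrable_kummer_int[OF _ d]
  have i1: "set_integrable lborel {0<..} (?F c (z + h))" "set_integrable lborel {0<..} (?F c z)"
    "set_integrable lborel {0<..} (\<lambda>t. h * ?F (c + 1) z t)"
    "set_integrable lborel {0<..} (\<lambda>t. h\<^sup>2 / 2 * ?F (c + 2) (z / 2) t)"
    using c z zh by (intro int set_integrable_mult_right; simp)+
  have eq: "kummer_int c d (z + h) - kummer_int c d z + h * kummer_int (c + 1) d z
    = (LBINT t:{0<..}. ?F c (z + h) t - ?F c z t + h * ?F (c + 1) z t)"
    unfolding kummer_int_def using i1
    by (subst set_integral_add) (auto intro!: set_integral_diff)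
  have "\<bar>LBINT t:{0<..}. ?F c (z + h) t - ?F c z t + h * ?F (c + 1) z t\<bar>
     \<le> (LBINT t:{0<..}. \<bar>?F c (z + h) t - ?F c z t + h * ?F (c + 1) z t\<bar>)"
    using set_integral_norm_bound[OF set_integral_add(1)[OF set_integral_diff(1)[OF i1(1,2)] i1(3)]] by simp
  also have "\<dots> \<le> (LBINT t:{0<..}. h\<^sup>2 / 2 * ?F (c + 2) (z / 2) t)"
  proof (rule set_integral_mono)
    show "set_integrable lborel {0<..} (\<lambda>t. \<bar>?F c (z + h) t - ?F c z t + h * ?F (c + 1) z t\<bar>)"
      using i1 by (intro set_integrable_abs set_integral_add(1) set_integral_diff(1)) auto
    fix t :: real assume "t \<in> {0<..}"
    then have t: "t > 0" by simp
    have "exp (- (z + h) * t) = exp (- z * t) * exp (- (h * t))"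
      by (simp add: algebra_simps flip: exp_add)
    then have "?F c (z + h) t - ?F c z t + h * ?F (c + 1) z t
        = (t powr c * (1 + t) powr d * exp (- z * t)) * (exp (- (h * t)) - 1 + h * t)"
      using t by (simp add: powr_add algebra_simps)
    then have "\<bar>?F c (z + h) t - ?F c z t + h * ?F (c + 1) z t\<bar>
        = (t powr c * (1 + t) powr d * exp (- z * t)) * \<bar>exp (- (h * t)) - 1 + h * t\<bar>"
      by (simp add: abs_mult)
    also have "\<dots> \<le> (t powr c * (1 + t) powr d * exp (- z * t)) * (exp \<bar>h * t\<bar> * (h * t)\<^sup>2 / 2)"
      by (intro mult_left_mono abs_exp_diff_le) auto
    also have "\<dots> \<le> (t powr c * (1 + t) powr d * exp (- z * t)) * (exp (z / 2 * t) * (h * t)\<^sup>2 / 2)"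
      using t h by (intro mult_left_mono divide_right_mono mult_right_mono) (auto simp: abs_mult)
    also have "\<dots> = h\<^sup>2 / 2 * (exp (- z * t) * exp (z / 2 * t) * (t powr c * t\<^sup>2) * (1 + t) powr d)"
      by (simp add: power_mult_distrib)
    also have "exp (- z * t) * exp (z / 2 * t) = exp (- (z / 2) * t)"
      by (simp flip: exp_add)
    also have "t powr c * t\<^sup>2 = t powr (c + 2)"
      using t by (simp add: powr_add)
    finally show "\<bar>?F c (z + h) t - ?F c z t + h * ?F (c + 1) z t\<bar> \<le> h\<^sup>2 / 2 * ?F (c + 2) (z / 2) t" .
  qed (use i1 in auto)
  also have "\<dots> = h\<^sup>2 / 2 * kummer_int (c + 2) d (z / 2)"
    unfolding kummer_int_def by (rule set_integral_mult_right)
  finally show ?thesis unfolding eq .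
qed

text \<open>Differentiation raises \<open>c\<close> by one and keeps \<open>d\<close>, which is why
  both exponents stay free in \<open>kummer_int\<close>. The quadratic remainder makes the error of
  the difference quotient of order |h|.\<close>

lemma DERIV_kummer_int:
  assumes "-1 < c" "d \<le> 0" "0 < z"
  shows "(kummer_int c d has_real_derivative - kummer_int (c + 1) d z) (at z)"
proof -
  let ?q = "\<lambda>h. (kummer_int c d (z + h) - kummer_int c d z) / h"
  let ?C = "kummer_int (c + 2) d (z / 2)"
  have "\<forall>\<^sub>F h in at 0. norm (?q h - (- kummer_int (c + 1) d z)) \<le> \<bar>h\<bar> / 2 * ?C"
  proof -
    have "\<forall>\<^sub>F h in at (0::real). \<bar>h\<bar> \<le> z / 2 \<and> h \<noteq> 0"
      unfolding eventually_at using assms by (intro exI[of _ "z / 2"]) (auto simp: dist_real_def)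
    then show ?thesis
    proof eventually_elim
      case (elim h)
      have "norm (?q h - (- kummer_int (c + 1) d z))
         = \<bar>kummer_int c d (z + h) - kummer_int c d z + h * kummer_int (c + 1) d z\<bar> / \<bar>h\<bar>"
        using elim by (simp add: field_simps flip: abs_divide)
      also have "\<dots> \<le> (h\<^sup>2 / 2 * ?C) / \<bar>h\<bar>"
        using elim assms by (intro divide_right_mono kummer_int_taylor) auto
      also have "\<dots> = \<bar>h\<bar> / 2 * ?C"
        using elim by (simp add: power2_eq_square field_simps abs_if)
      finally show ?case .
    qed
  qed
  moreover have "((\<lambda>h::real. \<bar>h\<bar> / 2 * ?C) \<longlongrightarrow> 0) (at 0)"
    by (auto intro!: tendsto_eq_intros)
  ultimately have "((\<lambda>h. ?q h - (- kummer_int (c + 1) d z)) \<longlongrightarrow> 0) (at 0)"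
    by (rule Lim_null_comparison)
  then show ?thesis unfolding DERIV_def by (simp only: LIM_zero_iff)
qed

text \<open>This is Kummer's equation for the integral at \<open>a - 1\<close>, whose first two
  derivatives in z are minus the integral at \<open>a\<close> and the integral at
  \<open>a + 1\<close>. It holds because
  \<open>- (exp (- z * t) * t powr a * (1 + t) powr (b - a))\<close> vanishes at both ends, so its
  derivative in t integrates to 0.\<close>

lemma kummer_int_contiguous:
  assumes a: "0 < a" and b: "b < 1" and z: "0 < z"
  defines "d \<equiv> b - a - 1"
  shows "(z - b) * kummer_int a d z + z * kummer_int (a + 1) d z = a * kummer_int (a - 1) d z"
proof -
  let ?G = "\<lambda>c t. exp (- z * t) * t powr c * (1 + t) powr d"
  let ?F = "\<lambda>t. - (exp (- z * t) * t powr a * (1 + t) powr (b - a))"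
  let ?f = "\<lambda>t. ((z - b) * ?G a t + z * ?G (a + 1) t) - a * ?G (a - 1) t"
  have d: "d \<le> 0" using a b by (simp add: d_def)
  note int = set_integrable_kummer_int[OF _ d z]
  have i: "set_integrable lborel {0<..} (?G a)" "set_integrable lborel {0<..} (?G (a + 1))"
    "set_integrable lborel {0<..} (?G (a - 1))"
    using a by (intro int; simp)+
  have fint: "set_integrable lborel {0<..} ?f"
    by (intro set_integral_diff(1) set_integral_add(1) set_integrable_mult_right i)
  have "(LBINT t=ereal 0..\<infinity>. ?f t) = 0 - 0"
  proof (rule interval_integral_FTC_integrable)
    fix t :: real assume "ereal 0 < ereal t"
    then have t: "t > 0" by simp
    have "(?F has_real_derivative
        - ((- z * exp (- z * t) * t powr a + exp (- z * t) * (a * t powr (a - 1))) * (1 + t) powr (b - a)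
          + exp (- z * t) * t powr a * ((b - a) * (1 + t) powr (b - a - 1)))) (at t)"
      using t by (auto intro!: derivative_eq_intros simp: algebra_simps)
    also have "(1 + t) powr (b - a) = (1 + t) * (1 + t) powr d"
      using t by (simp add: d_def powr_diff)
    also have "- ((- z * exp (- z * t) * t powr a + exp (- z * t) * (a * t powr (a - 1))) * ((1 + t) * (1 + t) powr d)
          + exp (- z * t) * t powr a * ((b - a) * (1 + t) powr (b - a - 1))) = ?f t"
      using t by (simp add: powr_add powr_diff d_def divide_simps) (simp add: algebra_simps)
    finally show "(?F has_vector_derivative ?f t) (at t)"
      by (simp add: has_real_derivative_iff_has_vector_derivative)
    show "isCont ?f t" using t by (auto intro!: continuous_intros)
  next
    show "set_integrable lborel (einterval (ereal 0) \<infinity>) ?f"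
      using fint by (simp add: einterval_def greaterThan_def)
    have "((\<lambda>t. ?F t) \<longlongrightarrow> - (exp (- z * 0) * 0 * (1 + 0) powr (b - a))) (at_right 0)"
      using a by (intro tendsto_intros) (auto intro!: tendsto_eq_intros eventually_at_rightI[of 0 1])
    then show "((?F \<circ> real_of_ereal) \<longlongrightarrow> 0) (at_right (ereal 0))"
      by (simp add: ereal_tendsto_simps)
    have "((\<lambda>t::real. exp (- z * t) * (1 + t)) \<longlongrightarrow> 0) at_top"
      using z by real_asymp
    \<comment> \<open>A crude bound suffices against the exponential: t^a <= (1 + t)^a leaves (1 +
      t)^b, which is at most 1 + t.\<close>
    moreover have "\<forall>\<^sub>F t in at_top. norm (?F t) \<le> exp (- z * t) * (1 + t)"
      using eventually_gt_at_top[of "0::real"]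
    proof eventually_elim
      case (elim t)
      have "t powr a * (1 + t) powr (b - a) \<le> (1 + t) powr a * (1 + t) powr (b - a)"
        using elim a by (intro mult_right_mono powr_mono2) auto
      also have "\<dots> = (1 + t) powr b" by (simp flip: powr_add)
      also have "\<dots> \<le> (1 + t) powr 1" using elim b by (intro powr_mono) auto
      finally show ?case using elim by (simp add: abs_mult mult.assoc)
    qed
    ultimately have "(?F \<longlongrightarrow> 0) at_top" by (rule Lim_null_comparison[rotated])
    then show "((?F \<circ> real_of_ereal) \<longlongrightarrow> 0) (at_left \<infinity>)"
      by (simp add: ereal_tendsto_simps)
  qed simp
  then have "(LBINT t:{0<..}. ?f t) = 0"
    by (subst interval_lebesgue_integral_0_infty[symmetric]) (simp add: zero_ereal_def)
  moreover have "(LBINT t:{0<..}. ?f t)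
      = (z - b) * kummer_int a d z + z * kummer_int (a + 1) d z - a * kummer_int (a - 1) d z"
    unfolding kummer_int_def
    by (subst set_integral_diff set_integral_add, (intro set_integral_add(1) set_integrable_mult_right i)+,
        simp only: set_integral_mult_right)+
  ultimately show ?thesis by simp
qed

section \<open>Constant Wronskians and boundary values at 0\<close>

lemma wronskian_constant:
  fixes f g p q r s :: "real \<Rightarrow> real"
  assumes f: "\<And>z. 0 < z \<Longrightarrow> (f has_real_derivative p z * r z) (at z)"
    and p: "\<And>z. 0 < z \<Longrightarrow> (p has_real_derivative s z * f z) (at z)"
    and g: "\<And>z. 0 < z \<Longrightarrow> (g has_real_derivative q z * r z) (at z)"
    and q: "\<And>z. 0 < z \<Longrightarrow> (q has_real_derivative s z * g z) (at z)"
    and lim: "(\<lambda>n. f (Z n) * q (Z n) - g (Z n) * p (Z n)) \<longlonglongrightarrow> W" and Z: "\<And>n. 0 < Z n"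
    and z: "0 < z"
  shows "f z * q z - g z * p z = W"
proof -
  \<comment> \<open>The products p q r and s f g occur twice with opposite signs, for arbitrary
    \<open>r\<close> and \<open>s\<close>. The same lemma thus serves in the variable z and later in
    x.\<close>
  have "((\<lambda>z. f z * q z - g z * p z) has_real_derivative 0) (at z within {0<..})" if "z \<in> {0<..}" for z
  proof -
    from that have "0 < z" by simp
    have "((\<lambda>z. f z * q z - g z * p z) has_real_derivative
        (p z * r z * q z + s z * g z * f z) - (q z * r z * p z + s z * f z * g z)) (at z)"
      by (rule DERIV_diff[OF DERIV_mult[OF f q] DERIV_mult[OF g p]]) fact+
    moreover have "(p z * r z * q z + s z * g z * f z) - (q z * r z * p z + s z * f z * g z) = 0"
      by (simp add: algebra_simps)
    ultimately show ?thesis by (simp add: has_field_derivative_at_within)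
  qed
  then have "\<exists>c. \<forall>z\<in>{0<..}. f z * q z - g z * p z = c"
    by (intro has_field_derivative_zero_constant convex_real_interval)
  then obtain c where c: "f z * q z - g z * p z = c" if "0 < z" for z by blast
  have "(\<lambda>n. f (Z n) * q (Z n) - g (Z n) * p (Z n)) = (\<lambda>n. c)"
    by (intro ext c Z)
  with lim have "c = W"
    by (simp only: LIMSEQ_const_iff)
  then show ?thesis using c[OF z] by simp
qed

text \<open>Dominated convergence with the integrand at z = 0 as the majorant; by the Beta integral
  it is integrable for a > 0 and b < 1.\<close>

lemma kummer_int_tendsto_0:
  assumes a: "0 < a" and b: "b < 1"
  shows "(\<lambda>n. kummer_int (a - 1) (b - a - 1) (inverse (real (Suc n))))
    \<longlonglongrightarrow> Gamma a * Gamma (1 - b) / Gamma (1 + a - b)"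
proof -
  let ?w = "\<lambda>t. indicator {0<..} t * (t powr (a - 1) * (1 + t) powr (b - a - 1))"
  have w: "has_bochner_integral lborel ?w (Gamma a * Gamma (1 - b) / Gamma (1 + a - b))"
    using assms by (intro has_bochner_integral_nn_integral nn_integral_Beta_prime)
      (auto intro!: divide_nonneg_nonneg mult_nonneg_nonneg less_imp_le[OF Gamma_real_pos])
  have "(\<lambda>n. LBINT t. indicator {0<..} t *\<^sub>R (exp (- inverse (real (Suc n)) * t) * t powr (a - 1) * (1 + t) powr (b - a - 1)))
     \<longlonglongrightarrow> (LBINT t. ?w t)"
  proof (rule integral_dominated_convergence)
    show "AE t in lborel. (\<lambda>n. indicator {0<..} t *\<^sub>R (exp (- inverse (real (Suc n)) * t) * t powr (a - 1) * (1 + t) powr (b - a - 1)))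
        \<longlonglongrightarrow> ?w t"
    proof (intro AE_I2)
      fix t :: real
      have "(\<lambda>n. indicator {0<..} t *\<^sub>R (exp (- inverse (real (Suc n)) * t) * t powr (a - 1) * (1 + t) powr (b - a - 1)))
         \<longlonglongrightarrow> indicator {0<..} t *\<^sub>R (exp (- 0 * t) * t powr (a - 1) * (1 + t) powr (b - a - 1))"
        by (intro tendsto_scaleR tendsto_mult tendsto_exp tendsto_minus tendsto_const LIMSEQ_inverse_real_of_nat)
      then show "(\<lambda>n. indicator {0<..} t *\<^sub>R (exp (- inverse (real (Suc n)) * t) * t powr (a - 1) * (1 + t) powr (b - a - 1)))
        \<longlonglongrightarrow> ?w t" by simp
    qed
    show "AE t in lborel. norm (indicator {0<..} t *\<^sub>R
       (exp (- inverse (real (Suc n)) * t) * t powr (a - 1) * (1 + t) powr (b - a - 1))) \<le> ?w t" for n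
    proof (intro AE_I2)
      fix t :: real
      have "exp (- inverse (real (Suc n)) * t) * (t powr (a - 1) * (1 + t) powr (b - a - 1))
          \<le> 1 * (t powr (a - 1) * (1 + t) powr (b - a - 1))" if "t > 0"
        using that by (intro mult_right_mono) auto
      then show "norm (indicator {0<..} t *\<^sub>R
       (exp (- inverse (real (Suc n)) * t) * t powr (a - 1) * (1 + t) powr (b - a - 1))) \<le> ?w t"
        by (cases "t > 0") (simp_all add: abs_mult mult.assoc del: of_nat_Suc)
    qed
  qed (use w in \<open>auto simp: has_bochner_integral_iff\<close>)
  then show ?thesis
    using w by (simp add: kummer_int_def set_lebesgue_integral_def has_bochner_integral_iff)
qed

text \<open>For b > 0 the integral with exponent \<open>a\<close> diverges at z = 0. The
  substitution s = z t moves this singularity into the factor z^b and leaves an integral with a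
  finite limit.\<close>

lemma kummer_int_scaled:
  fixes a b z :: real
  assumes z: "0 < z"
  shows "z powr b * kummer_int a (b - a - 1) z
    = (LBINT s:{0<..}. exp (- s) * s powr a * (z + s) powr (b - a - 1))"
proof -
  let ?f = "\<lambda>s. indicator {0<..} s *\<^sub>R (exp (- s) * s powr a * (z + s) powr (b - a - 1))"
  have "(LBINT s. ?f s) = \<bar>z\<bar> *\<^sub>R (LBINT t. ?f (0 + z * t))"
    using z by (intro lborel_integral_real_affine) simp
  also have "(LBINT t. ?f (0 + z * t)) = (LBINT t. z powr (b - 1) *
      (indicator {0<..} t *\<^sub>R (exp (- z * t) * t powr a * (1 + t) powr (b - a - 1))))"
  proof (intro Bochner_Integration.integral_cong refl)
    fix t :: real
    show "?f (0 + z * t) = z powr (b - 1) *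
      (indicator {0<..} t *\<^sub>R (exp (- z * t) * t powr a * (1 + t) powr (b - a - 1)))"
    proof (cases "t > 0")
      case True
      have "z + z * t = z * (1 + t)" by (simp add: algebra_simps)
      then have "(z + z * t) powr (b - a - 1) = z powr (b - a - 1) * (1 + t) powr (b - a - 1)"
        using True z by (simp add: powr_mult)
      moreover have "z powr a * z powr (b - a - 1) = z powr (b - 1)"
        by (simp flip: powr_add)
      ultimately show ?thesis using True z by (simp add: powr_mult mult_ac)
    qed (use z in \<open>simp add: indicator_def zero_less_mult_iff\<close>)
  qed
  also have "\<dots> = z powr (b - 1) * kummer_int a (b - a - 1) z"
    unfolding kummer_int_def set_lebesgue_integral_def by (rule integral_mult_right_zero)
  finally show ?thesis
    using z by (simp add: set_lebesgue_integral_def powr_diff)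
qed

lemma kummer_int_powr_tendsto_0:
  assumes a: "0 < a" and b: "0 < b" "b < 1"
  shows "(\<lambda>n. inverse (real (Suc n)) powr b * kummer_int a (b - a - 1) (inverse (real (Suc n))))
    \<longlonglongrightarrow> Gamma b"
proof -
  let ?w = "\<lambda>s. indicator {0<..} s *\<^sub>R (exp (- 1 * s) * s powr (b - 1))"
  let ?z = "\<lambda>n. inverse (real (Suc n))"
  let ?f = "\<lambda>n s. indicator {0<..} s *\<^sub>R (exp (- s) * s powr a * (?z n + s) powr (b - a - 1))"
  have w: "integrable lborel ?w" "(LBINT s. ?w s) = Gamma b"
    using Gamma_integral_scaled[of "b - 1" 1] b
    by (auto simp: set_integrable_def set_lebesgue_integral_def)
  have ws: "?w s = indicator {0<..} s *\<^sub>R (exp (- s) * s powr a * (0 + s) powr (b - a - 1))" for s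
    by (simp add: mult.assoc flip: powr_add)
  have "(\<lambda>n. LBINT s. ?f n s) \<longlonglongrightarrow> (LBINT s. ?w s)"
  proof (rule integral_dominated_convergence)
    show "AE s in lborel. (\<lambda>n. ?f n s) \<longlonglongrightarrow> ?w s"
    proof (intro AE_I2)
      fix s :: real
      show "(\<lambda>n. ?f n s) \<longlonglongrightarrow> ?w s"
      proof (cases "s > 0")
        case True
        then show ?thesis unfolding ws by (intro tendsto_intros LIMSEQ_inverse_real_of_nat) auto
      qed simp
    qed
    show "AE s in lborel. norm (?f n s) \<le> ?w s" for n
    proof (intro AE_I2)
      fix s :: real
      show "norm (?f n s) \<le> ?w s"
      proof (cases "s > 0")
        case True
        \<comment> \<open>Since b - a - 1 < 0, the power decreases in its base, so the integrand at
          z = 0 is a majorant; it equals e^(-s) s^(b - 1), the integrand of Gamma(b).\<close>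
        then have "(?z n + s) powr (b - a - 1) \<le> (0 + s) powr (b - a - 1)"
          using a b by (intro powr_mono2') auto
        then show ?thesis unfolding ws using True by (auto simp: abs_mult intro!: mult_left_mono)
      qed simp
    qed
  qed (use w in auto)
  then show ?thesis
    unfolding w(2) by (subst kummer_int_scaled) (simp_all only: set_lebesgue_integral_def positive_imp_inverse_positive of_nat_0_less_iff zero_less_Suc)
qed

definition kummer_flux_U :: "real \<Rightarrow> real \<Rightarrow> real \<Rightarrow> real" where
  "kummer_flux_U a b z = Gamma (1 - b) / Gamma (1 + a - b) * kummer_flux_M a b z
     + Gamma (b - 1) / Gamma a * kummer_flux_N a b z"

lemma kummer_U_altdef:
  "kummer_U a b z = Gamma (1 - b) / Gamma (1 + a - b) * kummer_M a b z
     + Gamma (b - 1) / Gamma a * kummer_N a b z"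
  by (simp add: kummer_U_def kummer_N_def)

text \<open>Expresses the negative second coefficient of \<open>kummer_U\<close> through Gamma(b),
  the quantity that the limit of the flux delivers.\<close>

lemma Gamma_minus_1: "0 < b \<Longrightarrow> b < 1 \<Longrightarrow> Gamma (b - 1) = - Gamma b / (1 - b)" for b :: real
proof -
  assume b: "0 < b" "b < 1"
  have "b - 1 \<notin> \<int>\<^sub>\<le>\<^sub>0"
  proof
    assume "b - 1 \<in> \<int>\<^sub>\<le>\<^sub>0"
    then obtain n where n: "b - 1 = of_int n" by (elim nonpos_Ints_cases)
    with b have "real_of_int (- 1) < real_of_int n" "real_of_int n < real_of_int 0" by simp_all
    then show False unfolding of_int_less_iff by simp
  qed
  from Gamma_plus1[OF this] b show ?thesis by (simp add: field_simps)
qed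

lemma DERIV_kummer_flux_U:
  assumes "0 < a" "0 < b" "b < 1" "0 < z"
  shows "(kummer_U a b has_real_derivative kummer_flux_U a b z * exp z * z powr (- b)) (at z)"
    and "(kummer_flux_U a b has_real_derivative a * z powr (b - 1) * exp (- z) * kummer_U a b z) (at z)"
  unfolding kummer_U_altdef[abs_def] kummer_flux_U_def[abs_def]
  by (rule DERIV_cong[OF DERIV_add[OF DERIV_cmult[OF DERIV_kummer_flux_M(1)] DERIV_cmult[OF DERIV_kummer_flux_N(1)]]];
      use assms in \<open>simp add: algebra_simps\<close>)
    (rule DERIV_cong[OF DERIV_add[OF DERIV_cmult[OF DERIV_kummer_flux_M(2)] DERIV_cmult[OF DERIV_kummer_flux_N(2)]]];
      use assms in \<open>simp add: algebra_simps\<close>)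

lemma kummer_U_eq_int:
  assumes a: "0 < a" and b: "0 < b" "b < 1" and z: "0 < z"
  shows "kummer_U a b z = kummer_int (a - 1) (b - a - 1) z / Gamma a"
    and "kummer_flux_U a b z = - (z powr b * exp (- z) * kummer_int a (b - a - 1) z / Gamma a)"
proof -
  let ?d = "b - a - 1" and ?Z = "\<lambda>n. inverse (real (Suc n))"
  let ?r = "\<lambda>z. exp z * z powr (- b)" and ?s = "\<lambda>z. a * z powr (b - 1) * exp (- z)"
  let ?J = "\<lambda>z. kummer_int (a - 1) ?d z / Gamma a"
  let ?p = "\<lambda>z. - (z powr b * exp (- z) * kummer_int a ?d z / Gamma a)"
  let ?U0 = "Gamma (1 - b) / Gamma (1 + a - b)"
  have Ga: "Gamma a > 0" using a by (rule Gamma_real_pos)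
  have J: "(?J has_real_derivative ?p z * ?r z) (at z)" if "0 < z" for z
  proof -
    have "(z powr b * z powr (- b)) * (exp (- z) * exp z) = 1"
      using that by (simp flip: powr_add exp_add)
    then have "?p z * ?r z = - kummer_int a ?d z / Gamma a"
      by (simp add: field_simps)
    moreover have "(?J has_real_derivative - kummer_int a ?d z / Gamma a) (at z)"
      using DERIV_kummer_int[of "a - 1" ?d z] a b that by (intro DERIV_cdivide) simp
    ultimately show ?thesis by (simp only:)
  qed
  have p: "(?p has_real_derivative ?s z * ?J z) (at z)" if "0 < z" for z
  proof -
    have zb: "z powr b = z * z powr (b - 1)"
      using that by (simp add: powr_diff)
    have "((\<lambda>z. z powr b * exp (- z) * kummer_int a ?d z) has_real_derivative
        (b * z powr (b - 1) * exp (- z) - z powr b * exp (- z)) * kummer_int a ?d z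
        - z powr b * exp (- z) * kummer_int (a + 1) ?d z) (at z)"
      using that a b by (auto intro!: derivative_eq_intros DERIV_kummer_int simp: algebra_simps)
    then have "(?p has_real_derivative - (((b * z powr (b - 1) * exp (- z) - z powr b * exp (- z)) * kummer_int a ?d z
        - z powr b * exp (- z) * kummer_int (a + 1) ?d z) / Gamma a)) (at z)"
      by (intro DERIV_minus DERIV_cdivide)
    also have "- (((b * z powr (b - 1) * exp (- z) - z powr b * exp (- z)) * kummer_int a ?d z
        - z powr b * exp (- z) * kummer_int (a + 1) ?d z) / Gamma a)
      = z powr (b - 1) * exp (- z) * ((z - b) * kummer_int a ?d z + z * kummer_int (a + 1) ?d z) / Gamma a"
      unfolding zb using Ga by (simp add: field_simps)
    also have "\<dots> = ?s z * ?J z"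
      using kummer_int_contiguous[OF a b(2) that] by simp
    finally show ?thesis .
  qed
  have Z: "0 < ?Z n" for n by simp
  have lim0: "(\<lambda>n. f (?Z n)) \<longlonglongrightarrow> f 0" if "continuous_on {0..} f" for f :: "real \<Rightarrow> real"
    using that by (rule continuous_on_tendsto_compose[OF _ LIMSEQ_inverse_real_of_nat]) auto
  note cont = continuous_on_kummer[OF a b] and at0 = kummer_at_0[OF b(2), of a]
  note derivs = DERIV_kummer_flux_M[OF a b(1)]
    DERIV_kummer_flux_N[OF a b(2)]
  have limJ: "(\<lambda>n. ?J (?Z n)) \<longlonglongrightarrow> ?U0"
    using tendsto_divide[OF kummer_int_tendsto_0[OF a b(2)] tendsto_const[of "Gamma a"]] Ga by simp
  \<comment> \<open>The derivative of the integral blows up at 0, but its flux tends to -Gamma(b) /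
    Gamma(a). This nonzero value is what separates it from multiples of M, whose flux vanishes at
    0.\<close>
  have limp: "(\<lambda>n. ?p (?Z n)) \<longlonglongrightarrow> - (Gamma b / Gamma a)"
  proof -
    have "(\<lambda>n. - (exp (- ?Z n) * (?Z n powr b * kummer_int a ?d (?Z n)) / Gamma a)) \<longlonglongrightarrow> - (exp (- 0) * Gamma b / Gamma a)"
      using Ga by (intro tendsto_intros LIMSEQ_inverse_real_of_nat kummer_int_powr_tendsto_0 a b) simp
    then show ?thesis by (simp add: mult_ac del: of_nat_Suc)
  qed
  have MN: "kummer_M a b z * kummer_flux_N a b z - kummer_N a b z * kummer_flux_M a b z = 1 - b"
  proof (rule wronskian_constant[where r = ?r and s = ?s and Z = ?Z and f = "kummer_M a b" and g = "kummer_N a b"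
      and p = "kummer_flux_M a b" and q = "kummer_flux_N a b"])
    have "(\<lambda>n. kummer_M a b (?Z n) * kummer_flux_N a b (?Z n) - kummer_N a b (?Z n) * kummer_flux_M a b (?Z n))
      \<longlonglongrightarrow> kummer_M a b 0 * kummer_flux_N a b 0 - kummer_N a b 0 * kummer_flux_M a b 0"
      by (intro tendsto_intros lim0 cont)
    then show "(\<lambda>n. kummer_M a b (?Z n) * kummer_flux_N a b (?Z n) - kummer_N a b (?Z n) * kummer_flux_M a b (?Z n))
      \<longlonglongrightarrow> 1 - b" by (simp add: at0)
  qed (use derivs Z z in \<open>simp_all add: mult.assoc\<close>)
  have JM: "?J z * kummer_flux_M a b z - kummer_M a b z * ?p z = Gamma b / Gamma a"
  proof (rule wronskian_constant[where r = ?r and s = ?s and Z = ?Z and f = ?J and p = ?p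
      and g = "kummer_M a b" and q = "kummer_flux_M a b"])
    have "(\<lambda>n. ?J (?Z n) * kummer_flux_M a b (?Z n) - kummer_M a b (?Z n) * ?p (?Z n))
      \<longlonglongrightarrow> ?U0 * kummer_flux_M a b 0 - kummer_M a b 0 * (- (Gamma b / Gamma a))"
      by (intro tendsto_diff tendsto_mult lim0 cont limJ limp)
    then show "(\<lambda>n. ?J (?Z n) * kummer_flux_M a b (?Z n) - kummer_M a b (?Z n) * ?p (?Z n))
      \<longlonglongrightarrow> Gamma b / Gamma a" by (simp add: at0 del: of_nat_Suc)
  qed (use derivs J p Z z in \<open>simp_all add: mult.assoc\<close>)
  have JN: "?J z * kummer_flux_N a b z - kummer_N a b z * ?p z = ?U0 * (1 - b)"
  proof (rule wronskian_constant[where r = ?r and s = ?s and Z = ?Z and f = ?J and p = ?p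
      and g = "kummer_N a b" and q = "kummer_flux_N a b"])
    have "(\<lambda>n. ?J (?Z n) * kummer_flux_N a b (?Z n) - kummer_N a b (?Z n) * ?p (?Z n))
      \<longlonglongrightarrow> ?U0 * kummer_flux_N a b 0 - kummer_N a b 0 * (- (Gamma b / Gamma a))"
      by (intro tendsto_diff tendsto_mult lim0 cont limJ limp)
    then show "(\<lambda>n. ?J (?Z n) * kummer_flux_N a b (?Z n) - kummer_N a b (?Z n) * ?p (?Z n))
      \<longlonglongrightarrow> ?U0 * (1 - b)" by (simp add: at0 del: of_nat_Suc)
  qed (use derivs J p Z z in \<open>simp_all add: mult.assoc\<close>)
  \<comment> \<open>Cramer's rule: the three Wronskians determine a solution and its flux as one and
    the same combination of M, N and of their fluxes. Here -B / (1 - b) stands for Gamma(b -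
    1).\<close>
  have solve: "j = U * m + (- B / (1 - b) / A) * n \<and> q = U * p1 + (- B / (1 - b) / A) * p2"
    if 1: "m * p2 - n * p1 = 1 - b" and 2: "j * p1 - m * q = B / A" and 3: "j * p2 - n * q = U * (1 - b)"
    for m p2 n p1 j q U A B :: real
  proof -
    have "(1 - b) * j = m * (j * p2 - n * q) - n * (j * p1 - m * q)"
      "(1 - b) * q = p1 * (j * p2 - n * q) - p2 * (j * p1 - m * q)"
      unfolding 1[symmetric] by (simp_all add: algebra_simps)
    then have "(1 - b) * j = (1 - b) * (U * m) - n * (B / A)" "(1 - b) * q = (1 - b) * (U * p1) - p2 * (B / A)"
      unfolding 2 3 by simp_all
    then have "j = ((1 - b) * (U * m) - n * (B / A)) / (1 - b)" "q = ((1 - b) * (U * p1) - p2 * (B / A)) / (1 - b)"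
      using b by (simp_all add: field_simps)
    then show ?thesis using b by (simp add: diff_divide_distrib mult.commute)
  qed
  from solve[OF MN JM JN] show "kummer_U a b z = ?J z" "kummer_flux_U a b z = ?p z"
    by (simp_all add: kummer_U_altdef kummer_flux_U_def Gamma_minus_1[OF b])
qed

text \<open>The integral representation is available for z > 0 only; at 0 positivity is read off the
  series.\<close>

lemma kummer_U_pos:
  assumes "0 < a" "0 < b" "b < 1" "0 \<le> z"
  shows "0 < kummer_U a b z"
proof (cases "z = 0")
  case True
  then show ?thesis using assms
    by (auto simp: kummer_U_altdef kummer_at_0 intro!: divide_pos_pos Gamma_real_pos)
next
  case False
  then show ?thesis using assms
    by (subst kummer_U_eq_int) (auto intro!: divide_pos_pos Gamma_real_pos kummer_int_pos)
qed

lemma kummer_flux_U_neg: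
  assumes "0 < a" "0 < b" "b < 1" "0 < z"
  shows "kummer_flux_U a b z < 0"
  using assms by (subst kummer_U_eq_int) (auto intro!: divide_pos_pos mult_pos_pos Gamma_real_pos kummer_int_pos)

text \<open>Dropping the factor (1 + t)^(b - a - 1) <= 1 from the integral leaves a Gamma integral,
  hence U(a, b, z) <= z^(-a).\<close>

lemma kummer_U_at_top:
  assumes a: "0 < a" and b: "0 < b" "b < 1"
  shows "(kummer_U a b \<longlongrightarrow> 0) at_top"
proof -
  have Ga: "Gamma a > 0" using a by (rule Gamma_real_pos)
  have "\<forall>\<^sub>F z in at_top. norm (kummer_U a b z) \<le> z powr (- a)"
    using eventually_gt_at_top[of "0::real"]
  proof eventually_elim
    case (elim z)
    have "kummer_U a b z \<le> (Gamma (a - 1 + 1) * z powr (- (a - 1 + 1))) / Gamma a"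
      unfolding kummer_U_eq_int(1)[OF a b elim] using a b elim Ga
      by (intro divide_right_mono kummer_int_le) simp_all
    then show ?case using kummer_U_pos[OF a b, of z] elim Ga by simp
  qed
  moreover have "((\<lambda>z. z powr (- a)) \<longlongrightarrow> 0) at_top"
    using a by (intro tendsto_neg_powr filterlim_ident) simp
  ultimately show "(kummer_U a b \<longlongrightarrow> 0) at_top" by (rule Lim_null_comparison)
qed

lemma kummer_U_at_0:
  assumes "0 < a" "0 < b" "b < 1"
  shows "kummer_U a b 0 = Gamma (1 - b) / Gamma (1 + a - b)" "kummer_flux_U a b 0 = - (Gamma b / Gamma a)"
  using assms by (simp_all add: kummer_U_altdef kummer_flux_U_def kummer_at_0 Gamma_minus_1)

lemma continuous_on_kummer_U:
  assumes "0 < a" "0 < b" "b < 1"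
  shows "continuous_on {0..} (kummer_U a b)" "continuous_on {0..} (kummer_flux_U a b)"
  unfolding kummer_U_altdef[abs_def] kummer_flux_U_def[abs_def]
  by (intro continuous_intros continuous_on_kummer assms)+

section \<open>The resolvent equation\<close>

lemma density_sticky_speed_indicator:
  assumes S: "S \<in> sets borel" "S \<subseteq> {0<..}" and "\<beta> > 0"
  shows "density (sticky_speed_measure lam \<beta> \<delta> \<mu>) (indicator S)
    = density lborel (\<lambda>y. ennreal (speed_density lam \<beta> \<delta> y * indicator S y))" (is "density ?m _ = density _ (\<lambda>y. ennreal (?d y * _))")
proof (rule measure_eqI)
  note [measurable] = S(1)
  have [measurable]: "?d \<in> borel_measurable borel"
    unfolding speed_density_def by measurable
  fix A assume "A \<in> sets (density ?m (indicator S))"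
  then have A: "A \<in> sets borel" by simp
  have "emeasure (density ?m (indicator S)) A = (\<integral>\<^sup>+y. indicator (S \<inter> A) y \<partial>?m)"
    by (rule trans[OF emeasure_density nn_integral_cong]) (use A in \<open>auto simp: indicator_def\<close>)
  also have "\<dots> = emeasure ?m (S \<inter> A)"
    using A S by (intro nn_integral_indicator) auto
  also have "\<dots> = (\<integral>\<^sup>+y\<in>S \<inter> A \<inter> {0<..}. ennreal (?d y) \<partial>lborel)"
    using A S by (subst emeasure_sticky_speed_measure) (auto simp: indicator_def)
  also have "\<dots> = emeasure (density lborel (\<lambda>y. ennreal (?d y * indicator S y))) A"
    using A S by (subst emeasure_density) (auto intro!: nn_integral_cong simp: indicator_def)
  finally show "emeasure (density ?m (indicator S)) A
    = emeasure (density lborel (\<lambda>y. ennreal (?d y * indicator S y))) A" .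
qed simp

text \<open>Away from the atom the speed measure is a Lebesgue density. Both sides are the integral
  of \<open>h\<close>, cut off to \<open>S\<close>, against the same density measure; the second
  indicator produced by \<open>integral_density\<close> is absorbed by the first.\<close>

lemma set_integral_sticky_speed:
  assumes S: "S \<in> sets borel" "S \<subseteq> {0<..}" and "\<beta> > 0"
    and h: "(\<lambda>y. indicator S y *\<^sub>R h y) \<in> borel_measurable borel"
  shows "(LINT y:S|sticky_speed_measure lam \<beta> \<delta> \<mu>. h y) = (LBINT y:S. h y * speed_density lam \<beta> \<delta> y)"
proof -
  let ?m = "sticky_speed_measure lam \<beta> \<delta> \<mu>" and ?d = "speed_density lam \<beta> \<delta>"
  let ?h = "\<lambda>y. indicator S y *\<^sub>R h y"
  note [measurable] = S(1) h
  have d [measurable]: "?d \<in> borel_measurable borel"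
    unfolding speed_density_def by measurable
  have d0: "0 \<le> ?d y" for y
    using \<open>\<beta> > 0\<close> by (simp add: speed_density_def)
  have "integral\<^sup>L (density ?m (\<lambda>y. ennreal (indicator S y))) ?h
     = integral\<^sup>L (density lborel (\<lambda>y. ennreal (?d y * indicator S y))) ?h"
    using density_sticky_speed_indicator[OF S \<open>\<beta> > 0\<close>] by (simp add: ennreal_indicator)
  moreover have "integral\<^sup>L (density ?m (\<lambda>y. ennreal (indicator S y))) ?h = (LINT y|?m. indicator S y *\<^sub>R ?h y)"
    by (intro integral_density) (use h in \<open>simp_all add: measurable_cong_sets[OF sets_sticky_speed_measure refl]\<close>)
  moreover have "integral\<^sup>L (density lborel (\<lambda>y. ennreal (?d y * indicator S y))) ?h
     = (LINT y|lborel. (?d y * indicator S y) *\<^sub>R ?h y)"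
    using d0 h by (intro integral_density) auto
  moreover have "(\<lambda>y. indicator S y *\<^sub>R ?h y) = ?h" "(\<lambda>y. (?d y * indicator S y) *\<^sub>R ?h y) = (\<lambda>y. indicator S y *\<^sub>R (h y * ?d y))"
    by (auto simp: indicator_def)
  ultimately show ?thesis unfolding set_lebesgue_integral_def by simp
qed

lemma emeasure_sticky_speed_0: "emeasure (sticky_speed_measure lam \<beta> \<delta> \<mu>) {0} = ennreal (1 / \<mu>)"
proof -
  have "{0} \<inter> {0<..} = ({} :: real set)" by auto
  then show ?thesis by (simp add: emeasure_sticky_speed_measure)
qed

lemma nn_integral_sticky_speed:
  assumes [measurable]: "h \<in> borel_measurable borel" and "\<beta> > 0"
  shows "(\<integral>\<^sup>+y. h y * indicator {0..} y \<partial>sticky_speed_measure lam \<beta> \<delta> \<mu>)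
    = h 0 * ennreal (1 / \<mu>) + (\<integral>\<^sup>+y. h y * ennreal (speed_density lam \<beta> \<delta> y * indicator {0<..} y) \<partial>lborel)"
proof -
  let ?m = "sticky_speed_measure lam \<beta> \<delta> \<mu>" and ?d = "speed_density lam \<beta> \<delta>"
  have [measurable]: "?d \<in> borel_measurable borel"
    unfolding speed_density_def by measurable
  have "(\<integral>\<^sup>+y. h y * indicator {0..} y \<partial>?m) = (\<integral>\<^sup>+y. h y * indicator {0} y + indicator {0<..} y * h y \<partial>?m)"
    by (intro nn_integral_cong) (auto simp: indicator_def)
  also have "\<dots> = (\<integral>\<^sup>+y. h y * indicator {0} y \<partial>?m) + (\<integral>\<^sup>+y. indicator {0<..} y * h y \<partial>?m)"
    by (intro nn_integral_add) auto
  also have "(\<integral>\<^sup>+y. h y * indicator {0} y \<partial>?m) = h 0 * ennreal (1 / \<mu>)"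
    by (subst nn_integral_indicator_singleton) (auto simp: emeasure_sticky_speed_0)
  also have "(\<integral>\<^sup>+y. indicator {0<..} y * h y \<partial>?m) = integral\<^sup>N (density ?m (indicator {0<..})) h"
    by (intro nn_integral_density[symmetric]) auto
  also have "\<dots> = (\<integral>\<^sup>+y. ennreal (?d y * indicator {0<..} y) * h y \<partial>lborel)"
    by (subst density_sticky_speed_indicator) (auto simp: \<open>\<beta> > 0\<close> nn_integral_density)
  finally show ?thesis by (simp add: mult.commute)
qed

lemma continuous_on_indicator_measurable:
  fixes h :: "real \<Rightarrow> real"
  assumes "continuous_on {0..} h" "S \<in> sets borel" "S \<subseteq> {0..}"
  shows "(\<lambda>y. indicator S y *\<^sub>R h y) \<in> borel_measurable borel"
  using assms continuous_on_subset by (intro borel_measurable_continuous_on_indicator) auto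

lemma DERIV_integral_atLeast_0:
  fixes h :: "real \<Rightarrow> real"
  assumes "continuous_on {0..} h" "0 < x"
  shows "((\<lambda>x. integral {0..x} h) has_real_derivative h x) (at x)"
proof -
  have "((\<lambda>x. integral {0..x} h) has_real_derivative h x) (at x within {0..x + 1})"
    using assms by (intro integral_has_real_derivative) (auto elim: continuous_on_subset)
  then show ?thesis using assms by (simp add: at_within_Icc_at)
qed

text \<open>Continuity is local: relative to the half-line, \<open>{0..x + 1}\<close> is a
  neighbourhood of x.\<close>

lemma continuous_on_atLeast_0I:
  fixes F :: "real \<Rightarrow> real"
  assumes "\<And>c. 0 \<le> c \<Longrightarrow> continuous_on {0..c} F"
  shows "continuous_on {0..} F"
proof -
  have "continuous_on (\<Union>c\<in>{0..}. {0..<c + 1}) F"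
  proof (rule continuous_on_subset[where s = "{0..}"])
    show "continuous_on {0..} F"
      unfolding continuous_on_eq_continuous_within
    proof
      fix x :: real assume x: "x \<in> {0..}"
      then have "continuous (at x within {0..x + 1}) F"
        using assms[of "x + 1"] by (auto simp: continuous_on_eq_continuous_within)
      moreover have "at x within {0..x + 1} = at x within {0..}"
        using x by (intro at_within_nhd[where S = "{..<x + 1}"]) auto
      ultimately show "continuous (at x within {0..}) F" by simp
    qed
  qed auto
  then show ?thesis by (rule continuous_on_subset) (auto intro!: bexI[of _ x for x])
qed

lemma continuous_on_integral_atLeast_0:
  fixes h :: "real \<Rightarrow> real"
  assumes "continuous_on {0..} h"
  shows "continuous_on {0..} (\<lambda>x. integral {0..x} h)"
  using assms
  by (intro continuous_on_atLeast_0I indefinite_integral_continuous_1 integrable_continuous_interval)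
    (auto elim: continuous_on_subset)

section \<open>Homogeneous solutions in the space variable\<close>

locale cir_parameters =
  fixes lam \<beta> \<mu> \<alpha> \<delta> :: real
  assumes pos: "lam > 0" "\<beta> > 0" "\<mu> > 0" "\<alpha> > 0"
    and delta: "1 < \<delta>" "\<delta> < 2"
begin

abbreviation "a \<equiv> \<alpha> / (2 * lam)"
abbreviation "b \<equiv> \<delta> / 2"
abbreviation "z x \<equiv> lam * \<beta> * x\<^sup>2 / 2"
abbreviation "s' \<equiv> scale_density lam \<beta> \<delta>"
abbreviation "m' \<equiv> speed_density lam \<beta> \<delta>"
abbreviation "M \<equiv> M_CIR lam \<beta> \<delta> \<alpha>"
abbreviation "U \<equiv> U_CIR lam \<beta> \<delta> \<alpha>"
abbreviation "w \<equiv> abs_wronskian lam \<beta> \<delta> \<alpha>"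
abbreviation "c \<equiv> c_sticky lam \<beta> \<delta> \<mu> \<alpha>"
abbreviation "f0 \<equiv> f0_sticky lam \<beta> \<delta> \<mu> \<alpha>"

text \<open>Ratio of \<open>d/ds\<close> to the operator \<open>z\<^sup>b e\<^sup>-\<^sup>z d/dz\<close>:\<close>

definition "kap = lam * \<beta> * (lam * \<beta> / 2) powr (- b)"
definition "DM x = kap * kummer_flux_M a b (z x)"
definition "DU x = kap * kummer_flux_U a b (z x)"
definition "Df0 x = DM x + c * DU x"

lemma ab: "0 < a" "0 < b" "b < 1"
  using pos delta by auto

lemma kap_pos: "0 < kap"
  unfolding kap_def using pos by auto

lemma abs_wronskian_eq: "w = kap * (Gamma b / Gamma a)"
  by (simp add: abs_wronskian_def kap_def)

lemma abs_wronskian_pos: "0 < w"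
  unfolding abs_wronskian_eq using Gamma_real_pos[OF ab(1)] Gamma_real_pos[OF ab(2)] kap_pos by simp

lemma z_pos: "0 < x \<Longrightarrow> 0 < z x" and z_nonneg: "0 \<le> z x"
  using pos by auto

text \<open>Since z has derivative \<open>lam * \<beta> * x\<close> and z^(-b) is proportional to
  x^(-\<delta>), the chain rule turns the system in z into f' = s' D and D' = \<alpha> m' f, that
  is, d/dm d/ds f = \<alpha> f. The eigenvalue arises from
  \<open>2 * lam * a = \<alpha>\<close>.\<close>

lemma DERIV_in_x:
  assumes x: "0 < x"
    and W: "(W has_real_derivative p (z x) * exp (z x) * z x powr (- b)) (at (z x))"
    and p: "(p has_real_derivative a * z x powr (b - 1) * exp (- z x) * W (z x)) (at (z x))"
  shows "((\<lambda>x. W (z x)) has_real_derivative s' x * (kap * p (z x))) (at x)"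
    and "((\<lambda>x. kap * p (z x)) has_real_derivative \<alpha> * m' x * W (z x)) (at x)"
proof -
  have z': "(z has_real_derivative lam * \<beta> * x) (at x)"
    by (auto intro!: derivative_eq_intros)
  have zpow: "z x powr e = (lam * \<beta> / 2) powr e * x powr (2 * e)" for e
  proof -
    have "z x powr e = (lam * \<beta> / 2) powr e * (x\<^sup>2) powr e"
      using pos by (simp flip: powr_mult)
    also have "(x\<^sup>2) powr e = x powr (2 * e)"
      using x by (simp add: powr_powr flip: powr_numeral)
    finally show ?thesis .
  qed
  have xx: "x * x powr e = x powr (e + 1)" for e using x by (simp add: powr_add)
  have "((\<lambda>x. W (z x)) has_real_derivative (p (z x) * exp (z x) * z x powr (- b)) * (lam * \<beta> * x)) (at x)"
    using DERIV_chain2[OF W z'] .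
  also have "(p (z x) * exp (z x) * z x powr (- b)) * (lam * \<beta> * x)
      = (x * x powr (- \<delta>)) * exp (z x) * (kap * p (z x))"
    unfolding zpow kap_def by simp
  also have "(x * x powr (- \<delta>)) * exp (z x) = s' x"
    unfolding xx scale_density_def by simp
  finally show "((\<lambda>x. W (z x)) has_real_derivative s' x * (kap * p (z x))) (at x)" .
  have "((\<lambda>x. kap * p (z x)) has_real_derivative
     kap * ((a * z x powr (b - 1) * exp (- z x) * W (z x)) * (lam * \<beta> * x))) (at x)"
    by (intro DERIV_cmult DERIV_chain2[OF p z'])
  also have "kap * ((a * z x powr (b - 1) * exp (- z x) * W (z x)) * (lam * \<beta> * x))
    = lam * \<beta> * a * (lam * \<beta>) * ((lam * \<beta> / 2) powr (- b) * (lam * \<beta> / 2) powr (b - 1)) * (x * x powr (\<delta> - 2)) * exp (- z x) * W (z x)"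
    unfolding zpow kap_def by (simp add: right_diff_distrib)
  also have "(lam * \<beta> / 2) powr (- b) * (lam * \<beta> / 2) powr (b - 1) = 2 / (lam * \<beta>)"
  proof -
    have "(lam * \<beta> / 2) powr (- b) * (lam * \<beta> / 2) powr (b - 1) = (lam * \<beta> / 2) powr (- 1)"
      unfolding powr_add[symmetric] by simp
    also have "\<dots> = 2 / (lam * \<beta>)"
      using pos by (subst powr_minus) simp
    finally show ?thesis .
  qed
  also have "lam * \<beta> * a * (lam * \<beta>) * (2 / (lam * \<beta>)) * (x * x powr (\<delta> - 2)) * exp (- z x) * W (z x)
    = \<alpha> * m' x * W (z x)"
    unfolding xx speed_density_def using pos by (simp add: field_simps)
  finally show "((\<lambda>x. kap * p (z x)) has_real_derivative \<alpha> * m' x * W (z x)) (at x)" .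
qed

lemma DERIV_M:
  assumes "0 < x"
  shows "(M has_real_derivative s' x * DM x) (at x)" "(DM has_real_derivative \<alpha> * m' x * M x) (at x)"
  using DERIV_in_x[OF assms DERIV_kummer_flux_M[OF ab(1,2) z_pos[OF assms]]]
  unfolding M_CIR_def[abs_def] DM_def[abs_def] .

lemma DERIV_U:
  assumes "0 < x"
  shows "(U has_real_derivative s' x * DU x) (at x)" "(DU has_real_derivative \<alpha> * m' x * U x) (at x)"
  using DERIV_in_x[OF assms DERIV_kummer_flux_U[OF ab z_pos[OF assms]]]
  unfolding U_CIR_def[abs_def] DU_def[abs_def] .

lemma DERIV_f0:
  assumes "0 < x"
  shows "(f0 has_real_derivative s' x * Df0 x) (at x)" "(Df0 has_real_derivative \<alpha> * m' x * f0 x) (at x)"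
  using DERIV_add[OF DERIV_M(1)[OF assms] DERIV_cmult[OF DERIV_U(1)[OF assms], of c]]
    DERIV_add[OF DERIV_M(2)[OF assms] DERIV_cmult[OF DERIV_U(2)[OF assms], of c]]
  unfolding f0_sticky_def[abs_def] Df0_def[abs_def] by (simp_all add: algebra_simps)

lemma continuous_on_in_x: "continuous_on {0..} W \<Longrightarrow> continuous_on UNIV (\<lambda>x. W (z x))"
  by (rule continuous_on_compose2[where g = W]) (auto intro!: continuous_intros simp: z_nonneg pos less_imp_le)

lemma continuous_M: "continuous_on S M" "continuous_on S DM"
  and continuous_U: "continuous_on S U" "continuous_on S DU"
  unfolding M_CIR_def[abs_def] DM_def[abs_def] U_CIR_def[abs_def] DU_def[abs_def]
  by (rule continuous_on_subset[OF _ subset_UNIV];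
      intro continuous_on_mult continuous_on_const continuous_on_in_x continuous_on_kummer continuous_on_kummer_U ab)+

lemma continuous_f0: "continuous_on S f0" "continuous_on S Df0"
  unfolding f0_sticky_def[abs_def] Df0_def[abs_def]
  by (intro continuous_intros continuous_M continuous_U)+

text \<open>The identity \<open>DU 0 = - w\<close> explains the constant \<open>w\<close>: it is
  minus the scale derivative of \<open>U\<close> at 0. As \<open>DM 0 = 0\<close>, the scale
  derivative of \<open>f0\<close> at 0 stems from its \<open>U\<close> part alone.\<close>

lemma at_0:
  shows "M 0 = 1" "DM 0 = 0" "U 0 = kummer_U a b 0" "DU 0 = - w" "f0 0 = 1 + c * U 0" "Df0 0 = - c * w"
  using ab
  by (simp_all add: M_CIR_def DM_def U_CIR_def DU_def f0_sticky_def Df0_def kummer_at_0 kummer_U_at_0(2)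
      abs_wronskian_eq del: times_divide_eq_left times_divide_eq_right)

lemma U_pos: "0 < U x"
  unfolding U_CIR_def using ab by (intro kummer_U_pos z_nonneg)

lemma DU_neg: "0 < x \<Longrightarrow> DU x < 0"
  unfolding DU_def using ab kap_pos by (intro mult_pos_neg kummer_flux_U_neg z_pos)

lemma s'_pos: "0 < x \<Longrightarrow> 0 < s' x"
  by (simp add: scale_density_def)

lemma m'_pos: "0 < x \<Longrightarrow> 0 < m' x"
  using pos by (simp add: speed_density_def)

lemma m'_nonneg: "0 \<le> m' x"
  using pos by (simp add: speed_density_def)

lemma continuous_m': "continuous_on {0..} m'"
  unfolding speed_density_def[abs_def] using delta
  by (intro continuous_intros continuous_on_powr_atLeast_0) auto

lemma U_at_top: "(U \<longlongrightarrow> 0) at_top"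
proof -
  have "filterlim z at_top at_top" using pos by real_asymp
  from filterlim_compose[OF kummer_U_at_top[OF ab] this] show ?thesis
    unfolding U_CIR_def[abs_def] .
qed

text \<open>The third claim is the sticky boundary condition for \<open>f0\<close>, solved for
  \<open>c\<close> by means of \<open>Df0 0 = - c * w\<close>. All claims rest on the positive
  denominator \<open>\<mu> * w + \<alpha> * U 0\<close>.\<close>

lemma c_neg: "c < 0" and f0_0_pos: "0 < f0 0" and c_f0_0: "- c = \<alpha> / \<mu> * f0 0 / w"
proof -
  have D: "0 < \<mu> * w + \<alpha> * U 0"
    using pos abs_wronskian_pos U_pos[of 0] by (intro add_pos_pos mult_pos_pos)
  have c: "c = - \<alpha> / (\<mu> * w + \<alpha> * U 0)"
    by (simp add: c_sticky_def at_0)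
  show "c < 0" unfolding c using D pos by (simp add: divide_neg_pos)
  have f: "f0 0 = \<mu> * w / (\<mu> * w + \<alpha> * U 0)"
    unfolding at_0(5) c using D by (simp add: field_simps)
  show "0 < f0 0" unfolding f using D pos abs_wronskian_pos by simp
  have "- (- \<alpha> / X) = \<alpha> / \<mu> * (\<mu> * w / X) / w" for X
    using pos abs_wronskian_pos by simp
  then show "- c = \<alpha> / \<mu> * f0 0 / w" unfolding f c .
qed

lemma U_antimono:
  assumes "0 \<le> x"
  shows "U x \<le> U 0"
proof (cases "x = 0")
  case False
  with assms have "U x < U 0"
  proof (intro DERIV_neg_imp_decreasing_open[of 0 x U])
    fix y assume "0 < y" "y < x"
    then show "\<exists>d. (U has_real_derivative d) (at y) \<and> d < 0"
      using DERIV_U(1)[of y] s'_pos[of y] DU_neg[of y] by (auto intro!: mult_pos_neg)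
  qed (auto intro: continuous_U)
  then show ?thesis by simp
qed simp

text \<open>As \<open>c < 0\<close> and \<open>U\<close> is largest at 0, the amount subtracted from
  \<open>M\<close> is largest there, while \<open>M\<close> is at least its value 1 at 0. So the
  positive number \<open>f0 0\<close> is a lower bound.\<close>

lemma f0_pos: "0 \<le> x \<Longrightarrow> 0 < f0 x"
proof -
  assume x: "0 \<le> x"
  have "1 \<le> M x" unfolding M_CIR_def using ab by (intro kummer_M_ge_1 z_nonneg)
  moreover have "c * U 0 \<le> c * U x" using U_antimono[OF x] c_neg by (intro mult_left_mono_neg) auto
  ultimately have "f0 0 \<le> f0 x" unfolding at_0(5) by (simp add: f0_sticky_def)
  then show ?thesis using f0_0_pos by simp
qed

text \<open>Adding a multiple of \<open>U\<close> to \<open>M\<close> does not change the Wronskian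
  with \<open>U\<close>, and the Wronskian of \<open>M\<close> and \<open>U\<close> has the value
  \<open>M 0 * DU 0 = - w\<close> at 0.\<close>

lemma wronskian: "0 \<le> x \<Longrightarrow> f0 x * DU x - U x * Df0 x = - w"
proof -
  assume x: "0 \<le> x"
  have "M x * DU x - U x * DM x = - w"
  proof (cases "x = 0")
    case False
    show ?thesis
    proof (rule wronskian_constant[where f = M and p = DM and g = U and q = DU and r = s' and s = "\<lambda>x. \<alpha> * m' x"
          and Z = "\<lambda>n. inverse (real (Suc n))"])
      have *: "(\<lambda>n. F (inverse (real (Suc n)))) \<longlonglongrightarrow> F 0" if "continuous_on UNIV F" for F :: "real \<Rightarrow> real"
        using that by (rule continuous_on_tendsto_compose[OF _ LIMSEQ_inverse_real_of_nat]) auto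
      have "continuous_on UNIV (\<lambda>x. M x * DU x - U x * DM x)"
        by (intro continuous_intros continuous_M continuous_U)
      from *[OF this] show "(\<lambda>n. M (inverse (real (Suc n))) * DU (inverse (real (Suc n)))
          - U (inverse (real (Suc n))) * DM (inverse (real (Suc n)))) \<longlonglongrightarrow> - w"
        by (simp add: at_0)
    qed (use x False DERIV_M DERIV_U in \<open>auto simp: mult.commute\<close>)
  qed (simp add: at_0)
  then show ?thesis unfolding f0_sticky_def Df0_def by (simp add: algebra_simps)
qed

section \<open>The scale function and the operator d/dm d/ds\<close>

lemma scale_fun_eq_integral:
  assumes "0 \<le> y"
  shows "scale_fun lam \<beta> \<delta> y = integral {0..y} s'" "s' integrable_on {0..y}"
proof -
  let ?C = "exp (z y)"
  \<comment> \<open>The singularity of the scale density at 0 is integrable because \<delta> < 2,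
    and on \<open>{0..y}\<close> the exponential factor is at most its value at
    \<open>y\<close>.\<close>
  have "(\<lambda>t. t powr (1 - \<delta>)) integrable_on {0..y}"
    using assms delta by (intro integrable_on_powr_from_0) auto
  then have "(\<lambda>t. t powr (1 - \<delta>)) absolutely_integrable_on {0..y}"
    by (subst absolutely_integrable_on_iff_nonneg) auto
  from integrable_mult_right[OF this[unfolded set_integrable_def], of ?C]
  have "integrable lborel (\<lambda>t. indicator {0..y} t *\<^sub>R (?C * t powr (1 - \<delta>)))"
    by (subst (asm) integrable_completion) (auto simp: mult_ac)
  then have *: "set_integrable lborel {0..y} s'"
    unfolding set_integrable_def
  proof (rule Bochner_Integration.integrable_bound)
    show "AE t in lborel. norm (indicator {0..y} t *\<^sub>R s' t) \<le> norm (indicator {0..y} t *\<^sub>R (?C * t powr (1 - \<delta>)))"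
    proof (intro AE_I2)
      fix t :: real
      have "t powr (1 - \<delta>) * exp (z t) \<le> ?C * t powr (1 - \<delta>)" if "0 \<le> t" "t \<le> y"
        unfolding mult.commute[of ?C] using that pos
        by (intro mult_left_mono) (auto intro!: divide_right_mono mult_left_mono power_mono)
      then show "norm (indicator {0..y} t *\<^sub>R s' t) \<le> norm (indicator {0..y} t *\<^sub>R (?C * t powr (1 - \<delta>)))"
        by (auto simp: indicator_def scale_density_def abs_mult)
    qed
  qed (simp add: scale_density_def[abs_def])
  \<comment> \<open>Adding the endpoint 0 changes nothing even pointwise:
    \<open>0 powr (1 - \<delta>) = 0\<close> makes the scale density 0 there.\<close>
  have "scale_fun lam \<beta> \<delta> y = (LBINT t:{0..y}. s' t)"
    unfolding scale_fun_def set_lebesgue_integral_def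
    by (intro Bochner_Integration.integral_cong) (auto simp: indicator_def scale_density_def)
  with set_borel_integral_eq_integral[OF *]
  show "scale_fun lam \<beta> \<delta> y = integral {0..y} s'" "s' integrable_on {0..y}" by simp_all
qed

lemma continuous_on_scale_fun: "continuous_on {0..} (scale_fun lam \<beta> \<delta>)"
proof (rule continuous_on_atLeast_0I)
  fix y :: real assume "0 \<le> y"
  then have "continuous_on {0..y} (\<lambda>x. integral {0..x} s')"
    by (intro indefinite_integral_continuous_1 scale_fun_eq_integral)
  then show "continuous_on {0..y} (scale_fun lam \<beta> \<delta>)"
    by (rule continuous_on_eq) (simp add: scale_fun_eq_integral)
qed

lemma DERIV_scale_fun:
  assumes x: "0 < x"
  shows "(scale_fun lam \<beta> \<delta> has_real_derivative s' x) (at x)"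
proof -
  have "continuous (at x) s'"
    unfolding scale_density_def[abs_def] using x by (auto intro!: continuous_intros)
  then have "((\<lambda>u. integral {0..u} s') has_vector_derivative s' x) (at x within ({0..x + 1} - {}))"
    using x by (intro integral_has_vector_derivative_continuous_at scale_fun_eq_integral(2))
      (auto intro: continuous_at_imp_continuous_at_within)
  then have "((\<lambda>u. integral {0..u} s') has_real_derivative s' x) (at x)"
    using x by (simp add: has_real_derivative_iff_has_vector_derivative at_within_Icc_at)
  then show ?thesis
    by (rule has_field_derivative_transform_within_open[where S = "{0<..}"])
      (use x in \<open>auto simp: scale_fun_eq_integral\<close>)
qed

text \<open>L'Hopital's rule from the right: the quotient of the derivatives is \<open>D\<close>
  itself. This also covers x = 0, where the scale density is singular and \<open>f\<close> may have
  no ordinary derivative.\<close>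

lemma tendsto_difference_quotient_scale:
  assumes x: "0 \<le> x" and f: "continuous_on {0..} f" and D: "continuous_on {0..} D"
    and deriv: "\<And>y. 0 < y \<Longrightarrow> (f has_real_derivative s' y * D y) (at y)"
  shows "((\<lambda>y. (f y - f x) / (scale_fun lam \<beta> \<delta> y - scale_fun lam \<beta> \<delta> x)) \<longlongrightarrow> D x) (at_right x)"
proof -
  let ?s = "scale_fun lam \<beta> \<delta>"
  have right: "(F \<longlongrightarrow> F x) (at_right x)" if "continuous_on {0..} F" for F :: "real \<Rightarrow> real"
  proof -
    have "(F \<longlongrightarrow> F x) (at x within {0..})" using that x by (simp add: continuous_on_def)
    then show ?thesis by (rule tendsto_within_subset) (use x in auto)
  qed
  have ev: "\<forall>\<^sub>F y in at_right x. x < y" by (simp add: eventually_at_right_less)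
  show ?thesis
  proof (rule lhopital_right[where f' = "\<lambda>y. s' y * D y" and g' = s'])
    show "((\<lambda>y. f y - f x) \<longlongrightarrow> 0) (at_right x)" using right[OF f] by (rule Lim_null[THEN iffD1])
    show "((\<lambda>y. ?s y - ?s x) \<longlongrightarrow> 0) (at_right x)"
      using right[OF continuous_on_scale_fun] by (rule Lim_null[THEN iffD1])
    show "\<forall>\<^sub>F y in at_right x. ?s y - ?s x \<noteq> 0"
      using ev
    proof eventually_elim
      case (elim y)
      have "?s x < ?s y"
      proof (rule DERIV_pos_imp_increasing_open[OF elim])
        fix t assume "x < t" "t < y"
        then show "\<exists>d. (?s has_real_derivative d) (at t) \<and> 0 < d"
          using DERIV_scale_fun[of t] s'_pos[of t] x by auto
      qed (rule continuous_on_subset[OF continuous_on_scale_fun], use x in auto)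
      then show ?case by simp
    qed
    show "\<forall>\<^sub>F y in at_right x. s' y \<noteq> 0"
      using ev
    proof eventually_elim
      case (elim y)
      then show ?case using s'_pos[of y] x by simp
    qed
    show "\<forall>\<^sub>F y in at_right x. ((\<lambda>y. f y - f x) has_real_derivative s' y * D y) (at y)"
      using ev
    proof eventually_elim
      case (elim y)
      then have "((\<lambda>y. f y - f x) has_real_derivative s' y * D y - 0) (at y)"
        using x by (intro DERIV_diff DERIV_const deriv) simp
      then show ?case by simp
    qed
    show "\<forall>\<^sub>F y in at_right x. ((\<lambda>y. ?s y - ?s x) has_real_derivative s' y) (at y)"
      using ev
    proof eventually_elim
      case (elim y)
      then have "((\<lambda>y. ?s y - ?s x) has_real_derivative s' y - 0) (at y)"
        using x by (intro DERIV_diff DERIV_const DERIV_scale_fun) simp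
      then show ?case by simp
    qed
    show "((\<lambda>y. s' y * D y / s' y) \<longlongrightarrow> D x) (at_right x)"
    proof (rule Lim_transform_eventually[OF right[OF D]])
      show "\<forall>\<^sub>F y in at_right x. D y = s' y * D y / s' y"
        using ev
      proof eventually_elim
        case (elim y)
        then show ?case using s'_pos[of y] x by simp
      qed
    qed
  qed
qed

lemma measure_sticky_speed_0: "measure (sticky_speed_measure lam \<beta> \<delta> \<mu>) {0} = 1 / \<mu>"
  using pos by (simp add: measure_def emeasure_sticky_speed_0)

text \<open>Reduces the generator condition to classical derivatives on the open half-line and one
  equation at 0, where the speed measure has an atom of mass 1 / \<mu>.\<close>

lemma dm_ds_I:
  assumes f: "continuous_on {0..} f" and D: "continuous_on {0..} D" and h: "continuous_on {0..} h"
    and f': "\<And>y. 0 < y \<Longrightarrow> (f has_real_derivative s' y * D y) (at y)"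
    and D': "\<And>y. 0 < y \<Longrightarrow> (D has_real_derivative m' y * h y) (at y)"
    and D0: "D 0 = h 0 / \<mu>"
  shows "dm_ds (scale_fun lam \<beta> \<delta>) (sticky_speed_measure lam \<beta> \<delta> \<mu>) f h"
  unfolding dm_ds_def
proof (intro exI[of _ D] conjI allI impI)
  fix x :: real assume "0 \<le> x"
  then show "((\<lambda>y. (f y - f x) / (scale_fun lam \<beta> \<delta> y - scale_fun lam \<beta> \<delta> x)) \<longlongrightarrow> D x) (at_right x)"
    by (rule tendsto_difference_quotient_scale) fact+
next
  fix x y :: real assume "0 \<le> x \<and> x \<le> y"
  then have xy: "0 \<le> x" "x \<le> y" by auto
  have sub: "{x..y} \<subseteq> {0..}" using xy by auto
  \<comment> \<open>The left endpoint may be 0, where \<open>D\<close> is only known to be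
    continuous; hence the fundamental theorem with derivatives in the interior.\<close>
  have "((\<lambda>t. h t * m' t) has_integral D y - D x) {x..y}"
  proof (rule fundamental_theorem_of_calculus_interior)
    show "continuous_on {x..y} D" using D sub by (rule continuous_on_subset)
    show "(D has_vector_derivative h t * m' t) (at t)" if "t \<in> {x<..<y}" for t
      using D'[of t] that xy by (simp add: has_real_derivative_iff_has_vector_derivative mult.commute)
  qed fact
  then have "D y - D x = integral {x..y} (\<lambda>t. h t * m' t)" by (simp add: integral_unique)
  also have "\<dots> = (LBINT t:{x..y}. h t * m' t)"
    by (intro set_borel_integral_eq_integral(2)[symmetric] borel_integrable_atLeastAtMost'
        continuous_on_mult continuous_on_subset[OF h sub] continuous_on_subset[OF continuous_m' sub])
  also have "\<dots> = (LBINT t:{x<..y}. h t * m' t)"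
  proof (rule set_integral_cong_set)
    have "(\<lambda>t. indicator S t *\<^sub>R (h t * m' t)) \<in> borel_measurable borel"
      if "S \<in> sets borel" "S \<subseteq> {0..}" for S
      using that by (intro continuous_on_indicator_measurable continuous_on_mult h continuous_m')
    moreover have "{x<..y} \<subseteq> {0..}" using xy by auto
    ultimately have "(\<lambda>t. indicator S t *\<^sub>R (h t * m' t)) \<in> borel_measurable borel" if "S \<in> {{x..y}, {x<..y}}" for S
      using that sub by auto
    from this[of "{x..y}"] this[of "{x<..y}"]
    show "set_borel_measurable lborel {x..y} (\<lambda>t. h t * m' t)" "set_borel_measurable lborel {x<..y} (\<lambda>t. h t * m' t)"
      unfolding set_borel_measurable_def using xy by auto
    have "AE t in lborel. t \<noteq> x" by (rule AE_lborel_singleton)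
    then show "AE t in lborel. (t \<in> {x<..y}) = (t \<in> {x..y})" by eventually_elim auto
  qed
  also have "\<dots> = (LINT t:{x<..y}|sticky_speed_measure lam \<beta> \<delta> \<mu>. h t)"
    using xy pos by (intro set_integral_sticky_speed[symmetric] continuous_on_indicator_measurable h) auto
  finally show "D y - D x = (LINT t:{x<..y}|sticky_speed_measure lam \<beta> \<delta> \<mu>. h t)" .
qed (simp add: measure_sticky_speed_0 D0)

section \<open>The inhomogeneous equation by variation of constants\<close>

definition resolvent_left :: "(real \<Rightarrow> real) \<Rightarrow> real \<Rightarrow> real" where
  "resolvent_left g x = f0 0 * g 0 / \<mu> + integral {0..x} (\<lambda>y. f0 y * g y * m' y)"

text \<open>For \<open>g\<close> vanishing beyond \<open>R\<close>, this is the integral of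
  \<open>U y * g y * m' y\<close> over y > x; the difference form keeps it meaningful for x > R. The
  atom of the speed measure enters only \<open>resolvent_left\<close>, as its first summand, because
  0 lies to the left of every x > 0.\<close>

definition resolvent_right :: "(real \<Rightarrow> real) \<Rightarrow> real \<Rightarrow> real \<Rightarrow> real" where
  "resolvent_right g R x = integral {0..R} (\<lambda>y. U y * g y * m' y) - integral {0..x} (\<lambda>y. U y * g y * m' y)"

definition resolvent :: "(real \<Rightarrow> real) \<Rightarrow> real \<Rightarrow> real \<Rightarrow> real" where
  "resolvent g R x = (U x * resolvent_left g x + f0 x * resolvent_right g R x) / w"

lemma integral_eq_of_zero_beyond:
  fixes h :: "real \<Rightarrow> real"
  assumes "continuous_on {0..} h" "\<And>y. R \<le> y \<Longrightarrow> h y = 0" "0 \<le> R" "R \<le> x"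
  shows "integral {0..x} h = integral {0..R} h"
proof -
  have "integral {0..R} h + integral {R..x} h = integral {0..x} h"
    using assms by (intro Henstock_Kurzweil_Integration.integral_combine integrable_continuous_interval) (auto elim: continuous_on_subset)
  moreover have "integral {R..x} h = integral {R..x} (\<lambda>_. 0)"
    using assms by (intro Henstock_Kurzweil_Integration.integral_cong) auto
  ultimately show ?thesis by simp
qed

text \<open>In F' the terms with the derivatives of \<open>resolvent_left\<close> and
  \<open>resolvent_right\<close> cancel, as both carry the product of \<open>f0\<close> and
  \<open>U\<close> with opposite signs. In the derivative of the scale derivative they combine to
  the Wronskian of \<open>f0\<close> and \<open>U\<close>, which after division by \<open>w\<close>
  contributes exactly -g.\<close>

lemma resolvent_solves:
  assumes g: "continuous_on {0..} g" and R: "0 \<le> R" "\<And>y. R \<le> y \<Longrightarrow> g y = 0"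
  defines "h \<equiv> \<lambda>x. \<alpha> * resolvent g R x - g x"
  shows "resolvent g R \<in> C0_halfline" "h \<in> C0_halfline"
    "dm_ds (scale_fun lam \<beta> \<delta>) (sticky_speed_measure lam \<beta> \<delta> \<mu>) (resolvent g R) h"
proof -
  let ?A = "resolvent_left g" and ?B = "resolvent_right g R"
  let ?D = "\<lambda>x. (DU x * ?A x + Df0 x * ?B x) / w"
  have cont: "continuous_on {0..} (\<lambda>y. f0 y * g y * m' y)" "continuous_on {0..} (\<lambda>y. U y * g y * m' y)"
    by (intro continuous_on_mult continuous_f0 continuous_U g continuous_m')+
  have cA: "continuous_on {0..} ?A"
    unfolding resolvent_left_def[abs_def] by (intro continuous_on_add continuous_on_const continuous_on_integral_atLeast_0 cont)
  have cB: "continuous_on {0..} ?B"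
    unfolding resolvent_right_def[abs_def] by (intro continuous_on_diff continuous_on_const continuous_on_integral_atLeast_0 cont)
  have w0: "w \<noteq> 0" using abs_wronskian_pos by simp
  have cF: "continuous_on {0..} (resolvent g R)" and cD: "continuous_on {0..} ?D"
    unfolding resolvent_def[abs_def] using w0
    by (intro continuous_on_divide continuous_on_add continuous_on_mult continuous_U continuous_f0 cA cB continuous_on_const; simp)+
  have ch: "continuous_on {0..} h"
    unfolding h_def by (intro continuous_on_diff continuous_on_mult continuous_on_const cF g)
  have A': "(?A has_real_derivative f0 x * g x * m' x) (at x)" if "0 < x" for x
    unfolding resolvent_left_def[abs_def]
    using DERIV_add[OF DERIV_const DERIV_integral_atLeast_0[OF cont(1) that]] by simp
  have B': "(?B has_real_derivative - (U x * g x * m' x)) (at x)" if "0 < x" for x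
    unfolding resolvent_right_def[abs_def]
    using DERIV_diff[OF DERIV_const DERIV_integral_atLeast_0[OF cont(2) that]] by simp
  show dm: "dm_ds (scale_fun lam \<beta> \<delta>) (sticky_speed_measure lam \<beta> \<delta> \<mu>) (resolvent g R) h"
  proof (rule dm_ds_I[where D = ?D])
    fix x :: real assume x: "0 < x"
    have "(resolvent g R has_real_derivative
      ((s' x * DU x) * ?A x + (f0 x * g x * m' x) * U x + ((s' x * Df0 x) * ?B x + (- (U x * g x * m' x)) * f0 x)) / w) (at x)"
      unfolding resolvent_def[abs_def]
      by (intro DERIV_cdivide DERIV_add DERIV_mult DERIV_U DERIV_f0 A' B' x)
    also have "((s' x * DU x) * ?A x + (f0 x * g x * m' x) * U x + ((s' x * Df0 x) * ?B x + (- (U x * g x * m' x)) * f0 x)) / w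
        = s' x * ?D x"
      by (simp add: algebra_simps)
    finally show "(resolvent g R has_real_derivative s' x * ?D x) (at x)" .
    have "(?D has_real_derivative
      ((\<alpha> * m' x * U x) * ?A x + (f0 x * g x * m' x) * DU x + ((\<alpha> * m' x * f0 x) * ?B x + (- (U x * g x * m' x)) * Df0 x)) / w) (at x)"
      by (intro DERIV_cdivide DERIV_add DERIV_mult DERIV_U DERIV_f0 A' B' x)
    also have "((\<alpha> * m' x * U x) * ?A x + (f0 x * g x * m' x) * DU x + ((\<alpha> * m' x * f0 x) * ?B x + (- (U x * g x * m' x)) * Df0 x)) / w
        = m' x * (\<alpha> * resolvent g R x + g x * (f0 x * DU x - U x * Df0 x) / w)"
      unfolding resolvent_def by (simp add: algebra_simps add_divide_distrib diff_divide_distrib)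
    also have "\<dots> = m' x * h x"
      using wronskian[of x] x w0 by (simp add: h_def)
    finally show "(?D has_real_derivative m' x * h x) (at x)" .
  next
    \<comment> \<open>The \<open>f0\<close> part of the boundary equation is the sticky condition
      for \<open>f0\<close>. For the \<open>U\<close> part, the atom term in
      \<open>resolvent_left\<close> and the Wronskian at 0 together supply the missing
      -g(0).\<close>
    have A0: "?A 0 = f0 0 * g 0 / \<mu>" by (simp add: resolvent_left_def)
    have Df: "Df0 0 = \<alpha> / \<mu> * f0 0" using c_f0_0 w0 unfolding at_0(6) by simp
    have "w * h 0 = \<alpha> * (U 0 * ?A 0 + f0 0 * ?B 0) - w * g 0"
      using w0 by (simp add: h_def resolvent_def right_diff_distrib)
    also have "w * g 0 = g 0 * (U 0 * Df0 0 - f0 0 * DU 0)"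
      using wronskian[of 0] by (simp add: mult.commute)
    finally have "w * h 0 = \<alpha> * (U 0 * ?A 0 + f0 0 * ?B 0) - g 0 * (U 0 * Df0 0 - f0 0 * DU 0)" .
    also have "\<dots> = \<mu> * (DU 0 * ?A 0 + Df0 0 * ?B 0)"
      unfolding A0 Df using pos by (simp add: field_simps)
    finally have "h 0 = \<mu> * (DU 0 * ?A 0 + Df0 0 * ?B 0) / w" using w0 by (simp add: field_simps)
    then show "?D 0 = h 0 / \<mu>" using pos by simp
  qed (fact cF cD ch)+
  \<comment> \<open>Beyond \<open>R\<close> the right-hand integral vanishes and \<open>f0\<close>
    drops out; a constant multiple of \<open>U\<close> is left.\<close>
  have F_lim: "(resolvent g R \<longlongrightarrow> 0) at_top"
  proof (rule Lim_transform_eventually)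
    show "((\<lambda>x. U x * (?A R / w)) \<longlongrightarrow> 0) at_top"
      by (intro tendsto_mult_left_zero U_at_top)
    show "\<forall>\<^sub>F x in at_top. U x * (?A R / w) = resolvent g R x"
      using eventually_ge_at_top[of R]
    proof eventually_elim
      case (elim x)
      have "?A x = ?A R" "?B x = 0"
        unfolding resolvent_left_def resolvent_right_def using R elim
          integral_eq_of_zero_beyond[OF cont(1) _ R(1) elim] integral_eq_of_zero_beyond[OF cont(2) _ R(1) elim]
        by simp_all
      then show ?case by (simp add: resolvent_def)
    qed
  qed
  then show "resolvent g R \<in> C0_halfline" using cF by (simp add: C0_halfline_def)
  have "((\<lambda>x. \<alpha> * resolvent g R x) \<longlongrightarrow> 0) at_top"
    using F_lim by (rule tendsto_mult_right_zero)
  then have "(h \<longlongrightarrow> 0) at_top"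
  proof (rule Lim_transform_eventually)
    show "\<forall>\<^sub>F x in at_top. \<alpha> * resolvent g R x = h x"
      using eventually_ge_at_top[of R] by eventually_elim (simp add: h_def R)
  qed
  then show "h \<in> C0_halfline" using ch by (simp add: C0_halfline_def)
qed

end

section \<open>Regular diffusions at an exponential time\<close>

lemma C0_halfline_bounded:
  assumes "f \<in> C0_halfline"
  obtains B where "0 < B" "\<And>x. 0 \<le> x \<Longrightarrow> \<bar>f x\<bar> \<le> B"
proof -
  have cont: "continuous_on {0..} f" and "(f \<longlongrightarrow> 0) at_top"
    using assms by (auto simp: C0_halfline_def)
  then have "\<forall>\<^sub>F x in at_top. \<bar>f x\<bar> < 1"
    using order_tendstoD(2)[OF tendsto_rabs_zero] by fastforce
  then obtain N where N: "\<And>x. N \<le> x \<Longrightarrow> \<bar>f x\<bar> < 1"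
    by (auto simp: eventually_at_top_linorder)
  have "compact (f ` {0..N})"
    by (intro compact_continuous_image continuous_on_subset[OF cont]) auto
  then have "bounded (f ` {0..N})" by (rule compact_imp_bounded)
  then obtain C where C: "\<forall>y\<in>f ` {0..N}. norm y \<le> C" by (auto simp only: bounded_iff)
  show thesis
  proof (rule that[of "max 1 C"])
    fix x :: real assume "0 \<le> x"
    show "\<bar>f x\<bar> \<le> max 1 C"
    proof (cases "N \<le> x")
      case True
      with N[of x] show ?thesis by linarith
    next
      case False
      then have "f x \<in> f ` {0..N}" using \<open>0 \<le> x\<close> by auto
      with C have "norm (f x) \<le> C" by blast
      then show ?thesis by simp
    qed
  qed simp
qed

text \<open>A right difference quotient controlled uniformly in the base point also controls the
  left one: the quotient over [t - k, t] is the right quotient at t - k, and continuity moves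
  \<psi>(t - k) to \<psi>(t).\<close>

lemma DERIV_of_uniform_right_derivative:
  fixes \<phi> \<psi> :: "real \<Rightarrow> real"
  assumes t: "0 < t" and cont: "isCont \<psi> t"
    and unif: "\<And>e. 0 < e \<Longrightarrow> \<exists>d>0. \<forall>h t. 0 < h \<and> h < d \<and> 0 \<le> t \<longrightarrow> \<bar>\<phi> (t + h) - \<phi> t - h * \<psi> t\<bar> \<le> e * h"
  shows "(\<phi> has_real_derivative \<psi> t) (at t)"
  unfolding DERIV_def LIM_eq
proof (intro allI impI)
  fix r :: real assume r: "0 < r"
  obtain d1 where d1: "0 < d1" "\<And>h t. 0 < h \<Longrightarrow> h < d1 \<Longrightarrow> 0 \<le> t \<Longrightarrow> \<bar>\<phi> (t + h) - \<phi> t - h * \<psi> t\<bar> \<le> r / 3 * h"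
    using unif[of "r / 3"] r by auto
  obtain d2 where d2: "0 < d2" "\<And>u. \<bar>u - t\<bar> < d2 \<Longrightarrow> \<bar>\<psi> u - \<psi> t\<bar> < r / 3"
    using cont[unfolded isCont_def, THEN LIM_D, of "r / 3"] r by (metis abs_zero diff_self divide_pos_pos real_norm_def zero_less_numeral)
  show "\<exists>s>0. \<forall>h::real. h \<noteq> 0 \<and> norm (h - 0) < s \<longrightarrow> norm ((\<phi> (t + h) - \<phi> t) / h - \<psi> t) < r"
  proof (intro exI[of _ "min (min d1 d2) t"] conjI allI impI)
    fix h :: real assume h: "h \<noteq> 0 \<and> norm (h - 0) < min (min d1 d2) t"
    show "norm ((\<phi> (t + h) - \<phi> t) / h - \<psi> t) < r"
    proof (cases "0 < h")
      case True
      then have "\<bar>\<phi> (t + h) - \<phi> t - h * \<psi> t\<bar> / h \<le> r / 3"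
        using d1(2)[of h t] h t by (simp add: field_simps)
      moreover have "\<bar>(\<phi> (t + h) - \<phi> t) / h - \<psi> t\<bar> = \<bar>\<phi> (t + h) - \<phi> t - h * \<psi> t\<bar> / h"
        using True by (simp add: diff_divide_distrib flip: abs_divide[of _ h, unfolded abs_of_pos[OF True]])
      ultimately show ?thesis unfolding real_norm_def using r by linarith
    next
      case False
      define k u where "k = - h" and "u = t + h"
      have k: "0 < k" "k < d1" "0 \<le> u" and tu: "t = u + k"
        using h False by (auto simp: k_def u_def)
      have "\<bar>(\<phi> t - \<phi> u) - k * \<psi> u\<bar> / k \<le> r / 3"
        using d1(2)[OF k] k(1) unfolding tu by (simp add: field_simps)
      moreover have "\<bar>(\<phi> t - \<phi> u) / k - \<psi> u\<bar> = \<bar>(\<phi> t - \<phi> u) - k * \<psi> u\<bar> / k"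
        using k(1) by (simp add: diff_divide_distrib flip: abs_divide[of _ k, unfolded abs_of_pos[OF k(1)]])
      moreover have "\<bar>\<psi> u - \<psi> t\<bar> < r / 3"
        using h by (intro d2(2)) (auto simp: u_def)
      ultimately have "\<bar>(\<phi> t - \<phi> u) / k - \<psi> t\<bar> < r" using r by arith
      moreover have "(\<phi> (t + h) - \<phi> t) / h = (\<phi> t - \<phi> u) / k"
        using k(1) by (simp add: k_def u_def field_simps)
      ultimately show ?thesis by simp
    qed
  qed (use d1 d2 t in auto)
qed

context regular_diffusion
begin

section \<open>Transition kernels and the semigroup\<close>

abbreviation halfline :: "real measure" where "halfline \<equiv> restrict_space borel {0..}"

text \<open>The half-line is the state space of the kernel because \<open>P y\<close> is arbitrary
  for y < 0, so measurability in the starting point is known for nonnegative states only.\<close>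

definition transition :: "real \<Rightarrow> real \<Rightarrow> real measure" where
  "transition t x = distr (P x) halfline (X t)"

definition expect :: "(real \<Rightarrow> real) \<Rightarrow> real \<Rightarrow> real \<Rightarrow> real" where
  "expect f t x = (LINT \<omega>|P x. f (X t \<omega>))"

lemma space_P: "0 \<le> x \<Longrightarrow> space (P x) = space \<Omega>"
  using sets_eq_imp_space_eq[OF sets_P] .

lemma measurable_X_halfline:
  assumes "0 \<le> t"
  shows "X t \<in> \<Omega> \<rightarrow>\<^sub>M halfline" "0 \<le> x \<Longrightarrow> X t \<in> P x \<rightarrow>\<^sub>M halfline"
proof -
  show 1: "X t \<in> \<Omega> \<rightarrow>\<^sub>M halfline"
    using assms measurable_X nonneg_X by (intro measurable_restrict_space2) auto
  show "X t \<in> P x \<rightarrow>\<^sub>M halfline" if "0 \<le> x"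
    using 1 by (simp add: measurable_cong_sets[OF sets_P[OF that] refl])
qed

lemma measurable_continuous_X:
  assumes "continuous_on {0..} f" "0 \<le> t" "0 \<le> x"
  shows "(\<lambda>\<omega>. f (X t \<omega>)) \<in> borel_measurable (P x)"
  using measurable_compose[OF measurable_X_halfline(2)[OF assms(2,3)]
      borel_measurable_continuous_on_restrict[OF assms(1)]] .

lemma emeasure_transition:
  assumes y: "0 \<le> y" and t: "0 \<le> t" and A: "A \<in> sets halfline"
  shows "emeasure (transition t y) A = ennreal (measure (P y) {\<omega> \<in> space \<Omega>. X t \<omega> \<in> A})"
proof -
  interpret prob_space "P y" using y by (rule prob_space_P)
  show ?thesis
    unfolding transition_def using A
    by (subst emeasure_distr)
      (auto simp: measurable_X_halfline t y emeasure_eq_measure space_P intro!: arg_cong[where f = "measure (P y)"])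
qed

lemma measurable_transition_kernel:
  assumes t: "0 \<le> t"
  shows "transition t \<in> halfline \<rightarrow>\<^sub>M subprob_algebra halfline"
proof (rule measurable_subprob_algebra)
  fix y assume "y \<in> space halfline"
  then have y: "0 \<le> y" by (simp add: space_restrict_space)
  interpret prob_space "P y" using y by (rule prob_space_P)
  show "subprob_space (transition t y)"
    unfolding transition_def by (intro prob_space_imp_subprob_space prob_space_distr measurable_X_halfline t y)
  show "sets (transition t y) = sets halfline" by (simp add: transition_def)
next
  fix A assume A: "A \<in> sets halfline"
  then have A': "A \<in> sets borel" by (auto simp: sets_restrict_space_iff)
  have "emeasure (transition t y) A = ennreal (measure (P y) {\<omega> \<in> space \<Omega>. X t \<omega> \<in> A})"
    if "y \<in> space halfline" for y
    using that A t by (intro emeasure_transition) (auto simp: space_restrict_space)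
  then show "(\<lambda>y. emeasure (transition t y) A) \<in> borel_measurable halfline"
    using measurable_transition[OF t A'] by (subst measurable_cong) auto
qed

lemma expect_eq_integral_transition:
  assumes "continuous_on {0..} f" "0 \<le> t" "0 \<le> x"
  shows "expect f t x = integral\<^sup>L (transition t x) f"
  unfolding transition_def expect_def
  using measurable_X_halfline(2)[OF assms(2,3)] borel_measurable_continuous_on_restrict[OF assms(1)]
  by (rule integral_distr[symmetric])

text \<open>The strong Markov property at the constant stopping time \<open>t\<close>, with the
  whole space as the event. The work lies in recognising the \<open>path_sigma\<close> family as a
  filtration.\<close>

lemma markov:
  assumes x: "0 \<le> x" and t: "0 \<le> t" and s: "0 \<le> s" and A: "A \<in> sets borel"
  shows "measure (P x) {\<omega> \<in> space \<Omega>. X (t + s) \<omega> \<in> A}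
    = (LINT \<omega>|P x. measure (P (X t \<omega>)) {\<omega>' \<in> space \<Omega>. X s \<omega>' \<in> A})"
proof -
  let ?F = "\<lambda>t. path_sigma \<Omega> X {0..t}"
  have sub: "{X t -` B \<inter> space \<Omega> |t B. t \<in> I \<and> B \<in> sets borel} \<subseteq> Pow (space \<Omega>)" for I
    by auto
  have space_F: "space (path_sigma \<Omega> X I) = space \<Omega>" for I
    unfolding path_sigma_def by (rule space_measure_of[OF sub])
  interpret filtration "space \<Omega>" ?F
  proof
    fix i j :: real assume "i \<le> j"
    then show "sets (?F i) \<subseteq> sets (?F j)"
      unfolding path_sigma_def sets_measure_of[OF sub] by (intro sigma_sets_mono') force
  qed (rule space_F)
  have "space \<Omega> \<in> sets (pre_sigma (\<lambda>_. t))"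
    using sets.top[of "pre_sigma (\<lambda>_. t)"] by (simp add: space_pre_sigma)
  from strong_markov[OF x stopping_time_const t this s A]
  have "measure (P x) (space \<Omega> \<inter> {\<omega> \<in> space \<Omega>. X (t + s) \<omega> \<in> A})
    = (LINT \<omega>:space \<Omega>|P x. measure (P (X t \<omega>)) {\<omega>' \<in> space \<Omega>. X s \<omega>' \<in> A})" .
  moreover have "(LINT \<omega>:space \<Omega>|P x. measure (P (X t \<omega>)) {\<omega>' \<in> space \<Omega>. X s \<omega>' \<in> A})
    = (LINT \<omega>|P x. measure (P (X t \<omega>)) {\<omega>' \<in> space \<Omega>. X s \<omega>' \<in> A})"
    unfolding set_lebesgue_integral_def
    by (intro Bochner_Integration.integral_cong) (simp_all add: space_P[OF x])
  moreover have "space \<Omega> \<inter> {\<omega> \<in> space \<Omega>. X (t + s) \<omega> \<in> A} = {\<omega> \<in> space \<Omega>. X (t + s) \<omega> \<in> A}" by auto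
  ultimately show ?thesis by simp
qed

text \<open>Phrased with the monadic bind of kernels, so that the semigroup property for
  expectations follows from \<open>integral_bind\<close> without approximation by simple
  functions.\<close>

lemma chapman_kolmogorov:
  assumes x: "0 \<le> x" and t: "0 \<le> t" and s: "0 \<le> s"
  shows "transition t x \<bind> transition s = transition (t + s) x"
proof (rule measure_eqI)
  have ne: "space (transition t x) \<noteq> {}"
    by (auto simp: transition_def space_restrict_space)
  have ker: "transition s \<in> transition t x \<rightarrow>\<^sub>M subprob_algebra halfline"
    using measurable_transition_kernel[OF s] by (simp add: transition_def)
  show "sets (transition t x \<bind> transition s) = sets (transition (t + s) x)"
    using sets_bind[OF sets_kernel[OF ker] ne] by (simp add: transition_def)
  fix A assume "A \<in> sets (transition t x \<bind> transition s)"
  then have A: "A \<in> sets halfline"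
    using sets_bind[OF sets_kernel[OF ker] ne] by simp
  then have A': "A \<in> sets borel" by (auto simp: sets_restrict_space_iff)
  interpret prob_space "P x" using x by (rule prob_space_P)
  let ?p = "\<lambda>y. measure (P y) {\<omega>' \<in> space \<Omega>. X s \<omega>' \<in> A}"
  note tr = emeasure_transition[OF _ _ A]
  have meas: "(\<lambda>\<omega>. ?p (X t \<omega>)) \<in> borel_measurable (P x)"
    by (rule measurable_compose[OF measurable_X_halfline(2)[OF t x] measurable_transition[OF s A']])
  have "emeasure (transition t x \<bind> transition s) A = (\<integral>\<^sup>+y. emeasure (transition s y) A \<partial>transition t x)"
    by (rule emeasure_bind[OF ne ker A])
  also have "\<dots> = (\<integral>\<^sup>+\<omega>. emeasure (transition s (X t \<omega>)) A \<partial>P x)"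
    unfolding transition_def[of t x] using t x
      measurable_compose[OF measurable_transition_kernel[OF s] measurable_emeasure_subprob_algebra[OF A]]
    by (intro nn_integral_distr) (simp_all add: measurable_X_halfline)
  also have "\<dots> = (\<integral>\<^sup>+\<omega>. ennreal (?p (X t \<omega>)) \<partial>P x)"
    by (intro nn_integral_cong tr nonneg_X t s) (simp add: space_P x)
  also have "\<dots> = ennreal (LINT \<omega>|P x. ?p (X t \<omega>))"
  proof (intro nn_integral_eq_integral integrable_const_bound[where B = 1] meas AE_I2)
    fix \<omega> assume "\<omega> \<in> space (P x)"
    then have "prob_space (P (X t \<omega>))" by (intro prob_space_P nonneg_X t) (simp add: space_P x)
    then show "norm (?p (X t \<omega>)) \<le> 1" by (simp add: prob_space.prob_le_1)
  qed simp
  also have "\<dots> = emeasure (transition (t + s) x) A"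
    using markov[OF x t s A'] t s by (simp add: tr x)
  finally show "emeasure (transition t x \<bind> transition s) A = emeasure (transition (t + s) x) A" .
qed

lemma expect_bounded:
  assumes B: "\<And>y. 0 \<le> y \<Longrightarrow> \<bar>f y\<bar> \<le> B" and f: "continuous_on {0..} f" and t: "0 \<le> t" and x: "0 \<le> x"
  shows "integrable (P x) (\<lambda>\<omega>. f (X t \<omega>))" "\<bar>expect f t x\<bar> \<le> B"
proof -
  interpret prob_space "P x" using x by (rule prob_space_P)
  have *: "AE \<omega> in P x. \<bar>f (X t \<omega>)\<bar> \<le> B"
    by (intro AE_I2 B nonneg_X t) (simp add: space_P x)
  then show int: "integrable (P x) (\<lambda>\<omega>. f (X t \<omega>))"
    by (intro integrable_const_bound[where B = B] measurable_continuous_X f t x) auto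
  have "\<bar>expect f t x\<bar> \<le> (LINT \<omega>|P x. \<bar>f (X t \<omega>)\<bar>)"
    unfolding expect_def by (rule integral_abs_bound)
  also have "\<dots> \<le> B" using * int by (intro integral_le_const) auto
  finally show "\<bar>expect f t x\<bar> \<le> B" .
qed

lemma measurable_expect:
  assumes "f \<in> C0_halfline" "0 \<le> s"
  shows "expect f s \<in> borel_measurable halfline"
proof -
  have f: "continuous_on {0..} f" using assms by (simp add: C0_halfline_def)
  have "(\<lambda>y. integral\<^sup>L (transition s y) f) \<in> borel_measurable halfline"
    by (rule measurable_compose[OF measurable_transition_kernel[OF assms(2)]
        integral_measurable_subprob_algebra[OF borel_measurable_continuous_on_restrict[OF f]]])
  then show ?thesis
    by (rule measurable_cong[THEN iffD1, rotated])
      (simp add: expect_eq_integral_transition[OF f assms(2)] space_restrict_space)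
qed

lemma expect_semigroup:
  assumes f: "f \<in> C0_halfline" and x: "0 \<le> x" and t: "0 \<le> t" and s: "0 \<le> s"
  shows "expect f (t + s) x = (LINT \<omega>|P x. expect f s (X t \<omega>))"
proof -
  obtain B where B: "\<And>y. 0 \<le> y \<Longrightarrow> \<bar>f y\<bar> \<le> B" using C0_halfline_bounded[OF f] by metis
  have cf: "continuous_on {0..} f" using f by (simp add: C0_halfline_def)
  note mf = borel_measurable_continuous_on_restrict[OF cf]
  interpret prob_space "P x" using x by (rule prob_space_P)
  interpret T: prob_space "transition t x"
    unfolding transition_def by (intro prob_space_distr measurable_X_halfline t x)
  have ker: "transition s \<in> transition t x \<rightarrow>\<^sub>M subprob_algebra halfline"
    using measurable_transition_kernel[OF s] by (simp add: transition_def)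
  have "expect f (t + s) x = integral\<^sup>L (transition t x \<bind> transition s) f"
    using t s x by (simp add: expect_eq_integral_transition[OF cf] chapman_kolmogorov)
  also have "\<dots> = (LINT y|transition t x. integral\<^sup>L (transition s y) f)"
  proof (rule integral_bind[OF mf _ ker _ AE_I2[where M = "transition t x"]])
    show "\<bar>f y\<bar> \<le> B" if "y \<in> space halfline" for y
      using that by (intro B) (simp add: space_restrict_space)
    show "finite_measure (transition t x)" by (rule T.finite_measure_axioms)
    show "emeasure (transition s y) (space (transition s y)) \<le> ennreal 1" if "y \<in> space (transition t x)" for y
      using subprob_space.emeasure_space_le_1[OF subprob_space_kernel[OF ker that]] by simp
  qed
  also have "\<dots> = (LINT \<omega>|P x. integral\<^sup>L (transition s (X t \<omega>)) f)"
    unfolding transition_def[of t x]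
    by (intro integral_distr measurable_X_halfline t x
        measurable_compose[OF measurable_transition_kernel[OF s] integral_measurable_subprob_algebra[OF mf]])
  also have "\<dots> = (LINT \<omega>|P x. expect f s (X t \<omega>))"
    by (intro Bochner_Integration.integral_cong refl expect_eq_integral_transition[symmetric] cf s nonneg_X t)
      (simp add: space_P x)
  finally show ?thesis .
qed

text \<open>Path continuity makes the integrand converge along every sequence of times, and
  \<open>f\<close> is bounded.\<close>

lemma continuous_on_expect:
  assumes f: "f \<in> C0_halfline" and x: "0 \<le> x"
  shows "continuous_on {0..} (\<lambda>t. expect f t x)"
  unfolding continuous_on_sequentially
proof (intro ballI allI impI)
  fix t :: real and s :: "nat \<Rightarrow> real" assume "t \<in> {0..}" "(\<forall>n. s n \<in> {0..}) \<and> s \<longlonglongrightarrow> t"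
  then have t: "0 \<le> t" and s: "0 \<le> s n" "s \<longlonglongrightarrow> t" for n by auto
  obtain B where B: "\<And>y. 0 \<le> y \<Longrightarrow> \<bar>f y\<bar> \<le> B" using C0_halfline_bounded[OF f] by metis
  have cf: "continuous_on {0..} f" using f by (simp add: C0_halfline_def)
  interpret prob_space "P x" using x by (rule prob_space_P)
  have "(\<lambda>n. expect f (s n) x) \<longlonglongrightarrow> expect f t x"
    unfolding expect_def
  proof (rule integral_dominated_convergence[where w = "\<lambda>_. B"])
    show "AE \<omega> in P x. (\<lambda>n. f (X (s n) \<omega>)) \<longlonglongrightarrow> f (X t \<omega>)"
    proof (intro AE_I2)
      fix \<omega> assume "\<omega> \<in> space (P x)"
      then have \<omega>: "\<omega> \<in> space \<Omega>" by (simp add: space_P x)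
      have "(\<lambda>n. X (s n) \<omega>) \<longlonglongrightarrow> X t \<omega>"
        by (rule continuous_on_tendsto_compose[OF continuous_X[OF \<omega>] s(2)]) (use s(1) t in auto)
      then show "(\<lambda>n. f (X (s n) \<omega>)) \<longlonglongrightarrow> f (X t \<omega>)"
        by (rule continuous_on_tendsto_compose[OF cf]) (use nonneg_X s(1) t \<omega> in auto)
    qed
    show "AE \<omega> in P x. norm (f (X (s n) \<omega>)) \<le> B" for n
      using s(1) x by (intro AE_I2) (simp add: B nonneg_X space_P)
  qed (use measurable_continuous_X[OF cf _ x] s(1) t in auto)
  then show "((\<lambda>t. expect f t x) \<circ> s) \<longlonglongrightarrow> expect f t x" by (simp add: comp_def)
qed

lemma expect_0:
  assumes "continuous_on {0..} f" "0 \<le> x"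
  shows "expect f 0 x = f x"
proof -
  interpret prob_space "P x" using assms(2) by (rule prob_space_P)
  have "expect f 0 x = (LINT \<omega>|P x. f x)"
    unfolding expect_def
  proof (rule integral_cong_AE)
    show "AE \<omega> in P x. f (X 0 \<omega>) = f x" using start[OF assms(2)] by eventually_elim simp
  qed (use measurable_continuous_X assms in auto)
  then show ?thesis by (simp add: prob_space)
qed

text \<open>Conditioning on the state at time \<open>t\<close> writes the increment over [t, t + h]
  as the mean of a quantity that the generator controls uniformly in the state. The error is
  therefore uniform in \<open>t\<close>, as the one-sided criterion demands.\<close>

lemma DERIV_expect:
  assumes gen: "infinitesimal_generator P X f g" and x: "0 \<le> x" and t: "0 < t"
  shows "((\<lambda>t. expect f t x) has_real_derivative expect g t x) (at t)"
proof (rule DERIV_of_uniform_right_derivative[OF t])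
  have f: "f \<in> C0_halfline" and g: "g \<in> C0_halfline"
    and lim: "uniform_limit {0..} (\<lambda>h x. (expect f h x - f x) / h) g (at_right 0)"
    using gen unfolding infinitesimal_generator_def expect_def by simp_all
  have cf: "continuous_on {0..} f" and cg: "continuous_on {0..} g" using f g by (auto simp: C0_halfline_def)
  obtain Bf where Bf: "\<And>y. 0 \<le> y \<Longrightarrow> \<bar>f y\<bar> \<le> Bf" using C0_halfline_bounded[OF f] by metis
  obtain Bg where Bg: "\<And>y. 0 \<le> y \<Longrightarrow> \<bar>g y\<bar> \<le> Bg" using C0_halfline_bounded[OF g] by metis
  show "isCont (\<lambda>t. expect g t x) t"
    using continuous_on_interior[OF continuous_on_expect[OF g x], of t] t by (simp add: interior_real_atLeast)
  fix e :: real assume e: "0 < e"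
  from uniform_limitD[OF lim e] obtain d where "0 < d"
    and *: "\<forall>h>0. h < d \<longrightarrow> (\<forall>y\<in>{0..}. dist ((expect f h y - f y) / h) (g y) < e)"
    unfolding eventually_at_right_field by blast
  then have d: "0 < d" "\<bar>(expect f h y - f y) / h - g y\<bar> < e" if "0 < h" "h < d" "0 \<le> y" for h y
    using *[rule_format, of h y] that by (simp_all add: dist_real_def)
  show "\<exists>d>0. \<forall>h t. 0 < h \<and> h < d \<and> 0 \<le> t \<longrightarrow> \<bar>expect f (t + h) x - expect f t x - h * expect g t x\<bar> \<le> e * h"
  proof (intro exI[of _ d] conjI allI impI)
    fix h t :: real assume "0 < h \<and> h < d \<and> 0 \<le> t"
    then have h: "0 < h" "h < d" and t: "0 \<le> t" by auto
    interpret prob_space "P x" using x by (rule prob_space_P)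
    have i1: "integrable (P x) (\<lambda>\<omega>. expect f h (X t \<omega>))"
    proof (rule integrable_const_bound[where B = Bf])
      show "AE \<omega> in P x. norm (expect f h (X t \<omega>)) \<le> Bf"
        using h t x by (intro AE_I2) (simp add: expect_bounded(2)[OF Bf cf] nonneg_X space_P)
      show "(\<lambda>\<omega>. expect f h (X t \<omega>)) \<in> borel_measurable (P x)"
        using h by (intro measurable_compose[OF measurable_X_halfline(2)[OF t x] measurable_expect[OF f]]) simp
    qed
    note i2 = expect_bounded(1)[OF Bf cf t x] and i3 = expect_bounded(1)[OF Bg cg t x]
    have eq: "expect f (t + h) x - expect f t x - h * expect g t x
        = (LINT \<omega>|P x. expect f h (X t \<omega>) - f (X t \<omega>) - h * g (X t \<omega>))"
      unfolding expect_semigroup[OF f x t less_imp_le[OF h(1)]] expect_def[of f t x] expect_def[of g t x]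
      using i1 i2 i3 by simp
    have "\<bar>expect f (t + h) x - expect f t x - h * expect g t x\<bar>
        \<le> (LINT \<omega>|P x. \<bar>expect f h (X t \<omega>) - f (X t \<omega>) - h * g (X t \<omega>)\<bar>)"
      unfolding eq by (rule integral_abs_bound)
    also have "\<dots> \<le> e * h"
    proof (rule integral_le_const)
      show "integrable (P x) (\<lambda>\<omega>. \<bar>expect f h (X t \<omega>) - f (X t \<omega>) - h * g (X t \<omega>)\<bar>)"
        using i1 i2 i3 by simp
      show "AE \<omega> in P x. \<bar>expect f h (X t \<omega>) - f (X t \<omega>) - h * g (X t \<omega>)\<bar> \<le> e * h"
      proof (intro AE_I2)
        fix \<omega> assume "\<omega> \<in> space (P x)"
        then have y: "0 \<le> X t \<omega>" using nonneg_X[OF t] by (simp add: space_P x)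
        have "expect f h (X t \<omega>) - f (X t \<omega>) - h * g (X t \<omega>)
            = h * ((expect f h (X t \<omega>) - f (X t \<omega>)) / h - g (X t \<omega>))"
          using h by (simp add: field_simps)
        then have "\<bar>expect f h (X t \<omega>) - f (X t \<omega>) - h * g (X t \<omega>)\<bar>
            = h * \<bar>(expect f h (X t \<omega>) - f (X t \<omega>)) / h - g (X t \<omega>)\<bar>"
          using h by (simp add: abs_mult)
        also have "\<dots> \<le> h * e" using d(2)[OF h y] h by (intro mult_left_mono) auto
        finally show "\<bar>expect f h (X t \<omega>) - f (X t \<omega>) - h * g (X t \<omega>)\<bar> \<le> e * h" by (simp add: mult.commute)
      qed
    qed
    finally show "\<bar>expect f (t + h) x - expect f t x - h * expect g t x\<bar> \<le> e * h" .
  qed (fact \<open>0 < d\<close>)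
qed

lemma resolvent_eq_laplace:
  assumes gen: "infinitesimal_generator P X f (\<lambda>x. \<alpha> * f x - g x)" and g: "g \<in> C0_halfline"
    and \<alpha>: "0 < \<alpha>" and x: "0 \<le> x"
  shows "\<alpha> * f x = (LBINT t. exponential_density \<alpha> t * expect g t x)"
proof -
  let ?h = "\<lambda>x. \<alpha> * f x - g x"
  have f: "f \<in> C0_halfline" using gen by (auto simp: infinitesimal_generator_def)
  have cf: "continuous_on {0..} f" and cg: "continuous_on {0..} g" using f g by (auto simp: C0_halfline_def)
  obtain Bf where Bf: "\<And>y. 0 \<le> y \<Longrightarrow> \<bar>f y\<bar> \<le> Bf" using C0_halfline_bounded[OF f] by metis
  obtain Bg where Bg: "\<And>y. 0 \<le> y \<Longrightarrow> \<bar>g y\<bar> \<le> Bg" using C0_halfline_bounded[OF g] by metis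
  have h: "expect ?h t x = \<alpha> * expect f t x - expect g t x" if "0 \<le> t" for t
    using expect_bounded(1)[OF Bf cf that x] expect_bounded(1)[OF Bg cg that x]
    unfolding expect_def by (subst Bochner_Integration.integral_diff) auto
  let ?F = "\<lambda>t. - (exp (- \<alpha> * t) * expect f t x)" and ?f = "\<lambda>t. exp (- \<alpha> * t) * expect g t x"
  have cont_g: "isCont (\<lambda>t. expect g t x) t" if "0 < t" for t
    using continuous_on_interior[OF continuous_on_expect[OF g x], of t] that by (simp add: interior_real_atLeast)
  \<comment> \<open>\<open>t powr 0\<close> equals 1 for t > 0; it fits the exponential majorant to
    \<open>Gamma_integral_scaled\<close> with exponent 0.\<close>
  have int: "set_integrable lborel {0<..} ?f"
  proof (rule set_integrable_bound[where f = "\<lambda>t. Bg * (exp (- \<alpha> * t) * t powr 0)"])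
    show "set_integrable lborel {0<..} (\<lambda>t. Bg * (exp (- \<alpha> * t) * t powr 0))"
      using Gamma_integral_scaled(1)[of 0 \<alpha>] \<alpha> by (intro set_integrable_mult_right) simp_all
    show "set_borel_measurable lborel {0<..} ?f"
    proof -
      have "(\<lambda>t. indicator {0<..} t *\<^sub>R ?f t) \<in> borel_measurable borel"
        by (intro continuous_on_indicator_measurable continuous_on_mult continuous_on_expect g x continuous_on_exp)
          (auto intro!: continuous_intros)
      then show ?thesis by (simp add: set_borel_measurable_def)
    qed
    show "AE t in lborel. t \<in> {0<..} \<longrightarrow> norm (?f t) \<le> norm (Bg * (exp (- \<alpha> * t) * t powr 0))"
    proof (intro AE_I2 impI)
      fix t :: real assume t: "t \<in> {0<..}"
      then have "0 \<le> t" by simp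
      from expect_bounded(2)[OF Bg cg this x] have "\<bar>expect g t x\<bar> \<le> Bg" .
      then have "exp (- \<alpha> * t) * \<bar>expect g t x\<bar> \<le> exp (- \<alpha> * t) * \<bar>Bg\<bar>" by (intro mult_left_mono) auto
      then show "norm (?f t) \<le> norm (Bg * (exp (- \<alpha> * t) * t powr 0))"
        using t by (simp add: abs_mult mult.commute)
    qed
  qed
  have "(LBINT t=ereal 0..\<infinity>. ?f t) = 0 - ?F 0"
  proof (rule interval_integral_FTC_integrable)
    fix t :: real assume "ereal 0 < ereal t"
    then have t: "t > 0" by simp
    have "(?F has_real_derivative - ((- \<alpha> * exp (- \<alpha> * t)) * expect f t x + expect ?h t x * exp (- \<alpha> * t))) (at t)"
      by (intro DERIV_minus DERIV_mult DERIV_expect[OF gen x t]) (auto intro!: derivative_eq_intros)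
    also have "- ((- \<alpha> * exp (- \<alpha> * t)) * expect f t x + expect ?h t x * exp (- \<alpha> * t)) = ?f t"
      using t by (simp add: h algebra_simps)
    finally show "(?F has_vector_derivative ?f t) (at t)"
      by (simp add: has_real_derivative_iff_has_vector_derivative)
    show "isCont ?f t" using cont_g[OF t] by (intro continuous_intros) auto
  next
    show "set_integrable lborel (einterval (ereal 0) \<infinity>) ?f"
      using int by (simp add: einterval_def greaterThan_def)
    have "continuous_on {0..} ?F"
      by (intro continuous_intros continuous_on_expect f x)
    then have "(?F \<longlongrightarrow> ?F 0) (at 0 within {0..})" unfolding continuous_on_def by (rule bspec) simp
    then have "(?F \<longlongrightarrow> ?F 0) (at_right 0)" by (rule tendsto_within_subset) auto
    then show "((?F \<circ> real_of_ereal) \<longlongrightarrow> ?F 0) (at_right (ereal 0))"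
      by (simp add: ereal_tendsto_simps)
    have "((\<lambda>t::real. exp (- \<alpha> * t) * Bf) \<longlongrightarrow> 0) at_top"
      using \<alpha> by real_asymp
    moreover have "\<forall>\<^sub>F t in at_top. norm (?F t) \<le> exp (- \<alpha> * t) * Bf"
      using eventually_gt_at_top[of "0::real"]
      by eventually_elim (use expect_bounded(2)[OF Bf cf _ x] in \<open>simp add: abs_mult\<close>)
    ultimately have "(?F \<longlongrightarrow> 0) at_top" by (rule Lim_null_comparison[rotated])
    then show "((?F \<circ> real_of_ereal) \<longlongrightarrow> 0) (at_left \<infinity>)"
      by (simp add: ereal_tendsto_simps)
  qed simp
  also have "0 - ?F 0 = f x" by (simp add: expect_0[OF cf x])
  finally have "(LBINT t:{0<..}. ?f t) = f x"
    by (subst interval_lebesgue_integral_0_infty[symmetric]) (simp add: zero_ereal_def)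
  then have "\<alpha> * f x = (LBINT t. \<alpha> * (indicator {0<..} t *\<^sub>R ?f t))"
    by (simp add: set_lebesgue_integral_def)
  also have "\<dots> = (LBINT t. exponential_density \<alpha> t * expect g t x)"
  proof (rule integral_cong_AE)
    show "(\<lambda>t. \<alpha> * (indicator {0<..} t *\<^sub>R ?f t)) \<in> borel_measurable lborel"
      using int by (auto simp: set_integrable_def)
    \<comment> \<open>The exponential density has the value \<alpha> at t = 0, where the indicator
      of the open half-line is 0; the integrands differ at most in this null point.\<close>
    have "AE t in lborel. t \<noteq> (0::real)" by (rule AE_lborel_singleton)
    then have *: "AE t in lborel. \<alpha> * (indicator {0<..} t *\<^sub>R ?f t) = exponential_density \<alpha> t * expect g t x"
      by eventually_elim (auto simp: exponential_density_def indicator_def mult_ac)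
    then show "AE t in lborel. \<alpha> * (indicator {0<..} t *\<^sub>R ?f t) = exponential_density \<alpha> t * expect g t x" .
    have "(\<lambda>t. indicator {0..} t *\<^sub>R (\<alpha> * exp (- t * \<alpha>) * expect g t x)) \<in> borel_measurable borel"
      by (intro continuous_on_indicator_measurable continuous_on_mult continuous_on_expect g x continuous_on_exp)
        (auto intro!: continuous_intros)
    also have "(\<lambda>t. indicator {0..} t *\<^sub>R (\<alpha> * exp (- t * \<alpha>) * expect g t x)) = (\<lambda>t. exponential_density \<alpha> t * expect g t x)"
      by (auto simp: exponential_density_def indicator_def)
    finally show "(\<lambda>t. exponential_density \<alpha> t * expect g t x) \<in> borel_measurable lborel" by simp
  qed
  finally show ?thesis .
qed

section \<open>The process at an independent random time\<close>

lemma sets_path_sigma: "sets (path_sigma \<Omega> X I) = sigma_sets (space \<Omega>) {X t -` B \<inter> space \<Omega> |t B. t \<in> I \<and> B \<in> sets borel}"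
  and space_path_sigma: "space (path_sigma \<Omega> X I) = space \<Omega>"
proof -
  have "{X t -` B \<inter> space \<Omega> |t B. t \<in> I \<and> B \<in> sets borel} \<subseteq> Pow (space \<Omega>)" by auto
  then show "sets (path_sigma \<Omega> X I) = sigma_sets (space \<Omega>) {X t -` B \<inter> space \<Omega> |t B. t \<in> I \<and> B \<in> sets borel}"
    "space (path_sigma \<Omega> X I) = space \<Omega>"
    unfolding path_sigma_def by (rule sets_measure_of, rule space_measure_of)
qed

lemma measurable_X_path_sigma: "t \<in> I \<Longrightarrow> X t \<in> borel_measurable (path_sigma \<Omega> X I)"
  by (rule measurableI) (auto simp: sets_path_sigma space_path_sigma intro!: sigma_sets.Basic)

lemma sets_path_sigma_le: "I \<subseteq> {0..} \<Longrightarrow> sets (path_sigma \<Omega> X I) \<subseteq> sets \<Omega>"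
  unfolding sets_path_sigma
  by (intro sets.sigma_sets_subset) (auto intro!: measurable_sets[OF measurable_X])

text \<open>
  By continuity of the paths, \<open>X t \<omega>\<close> is jointly measurable, as the limit of its values on the grids
  of mesh \<open>1 / (n + 1)\<close>.
\<close>

lemma measurable_X_pair:
  "(\<lambda>(\<omega>, t). X (max 0 t) \<omega>) \<in> path_sigma \<Omega> X {0..} \<Otimes>\<^sub>M borel \<rightarrow>\<^sub>M halfline"
proof -
  let ?N = "path_sigma \<Omega> X {0..}"
  define q where "q n t = real (nat \<lfloor>real (Suc n) * max 0 t\<rfloor>) / real (Suc n)" for n :: nat and t :: real
  have q_lim: "(\<lambda>n. q n t) \<longlonglongrightarrow> max 0 t" for t
  proof (rule tendsto_sandwich)
    have "of_int \<lfloor>y\<rfloor> \<le> y" "y - 1 \<le> of_int \<lfloor>y\<rfloor>" for y :: real by linarith+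
    moreover have "real (nat \<lfloor>real (Suc n) * max 0 t\<rfloor>) = of_int \<lfloor>real (Suc n) * max 0 t\<rfloor>" for n by simp
    ultimately have le: "real (nat \<lfloor>real (Suc n) * max 0 t\<rfloor>) \<le> real (Suc n) * max 0 t"
      "real (Suc n) * max 0 t - 1 \<le> real (nat \<lfloor>real (Suc n) * max 0 t\<rfloor>)" for n by metis+
    show "\<forall>\<^sub>F n in sequentially. max 0 t - inverse (real (Suc n)) \<le> q n t"
    proof (intro always_eventually allI)
      fix n
      have "(real (Suc n) * max 0 t - 1) / real (Suc n) \<le> q n t"
        unfolding q_def by (intro divide_right_mono le) simp
      then show "max 0 t - inverse (real (Suc n)) \<le> q n t"
        by (simp add: diff_divide_distrib inverse_eq_divide del: of_nat_Suc)
    qed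
    show "\<forall>\<^sub>F n in sequentially. q n t \<le> max 0 t"
      using le(1) by (intro always_eventually allI) (simp add: q_def field_simps del: of_nat_Suc)
    show "(\<lambda>n. max 0 t - inverse (real (Suc n))) \<longlonglongrightarrow> max 0 t"
      using tendsto_diff[OF tendsto_const LIMSEQ_inverse_real_of_nat, of "max 0 t"] by simp
  qed simp
  have "(\<lambda>p. X (max 0 (snd p)) (fst p)) \<in> borel_measurable (?N \<Otimes>\<^sub>M borel)"
  proof (rule borel_measurable_LIMSEQ_real)
    fix p assume "p \<in> space (?N \<Otimes>\<^sub>M (borel :: real measure))"
    then have "fst p \<in> space \<Omega>" by (auto simp: space_pair_measure space_path_sigma)
    from continuous_on_tendsto_compose[OF continuous_X[OF this] q_lim]
    show "(\<lambda>n. X (q n (snd p)) (fst p)) \<longlonglongrightarrow> X (max 0 (snd p)) (fst p)"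
      by (simp add: q_def)
  next
    fix n
    have "(\<lambda>p. X (real k / real (Suc n)) (fst p)) \<in> borel_measurable (?N \<Otimes>\<^sub>M (borel :: real measure))" for k
      by (rule measurable_compose[OF measurable_fst measurable_X_path_sigma]) simp
    moreover have "(\<lambda>p. nat \<lfloor>real (Suc n) * max 0 (snd p)\<rfloor>) \<in> ?N \<Otimes>\<^sub>M (borel :: real measure) \<rightarrow>\<^sub>M count_space UNIV"
      by measurable
    ultimately have "(\<lambda>p. X (real (nat \<lfloor>real (Suc n) * max 0 (snd p)\<rfloor>) / real (Suc n)) (fst p)) \<in> borel_measurable (?N \<Otimes>\<^sub>M borel)"
      by (rule measurable_compose_countable)
    then show "(\<lambda>p. X (q n (snd p)) (fst p)) \<in> borel_measurable (?N \<Otimes>\<^sub>M borel)"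
      unfolding q_def .
  qed
  then show ?thesis
    unfolding case_prod_beta by (intro measurable_restrict_space2)
      (auto simp: space_pair_measure space_path_sigma nonneg_X)
qed

text \<open>Independence makes the joint law of path and time a product, so Fubini allows the time
  to be frozen first. The \<open>max 0\<close> keeps the integrands meaningful at negative times and
  does not change \<open>T\<close> on the sample space.\<close>

lemma independent_time:
  assumes x: "0 \<le> x" and T_nonneg: "\<And>\<omega>. \<omega> \<in> space \<Omega> \<Longrightarrow> 0 \<le> T \<omega>" and T: "T \<in> borel_measurable (P x)"
    and indep: "prob_space.indep_set (P x)
      (sets (path_sigma \<Omega> X {0..})) (sets (vimage_algebra (space \<Omega>) T borel))"
  shows "(\<lambda>\<omega>. X (T \<omega>) \<omega>) \<in> borel_measurable (P x)"
    and "g \<in> C0_halfline \<Longrightarrow> (LINT \<omega>|P x. g (X (T \<omega>) \<omega>)) = (LINT \<omega>|P x. expect g (max 0 (T \<omega>)) x)"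
proof -
  let ?N = "path_sigma \<Omega> X {0..}"
  interpret prob_space "P x" using x by (rule prob_space_P)
  \<comment> \<open>The identity, read as a map into the coarser sigma-algebra generated by the
    process, plays the role of the random path.\<close>
  have id: "(\<lambda>\<omega>. \<omega>) \<in> P x \<rightarrow>\<^sub>M ?N"
    using sets_path_sigma_le[of "{0..}"] sets_P[OF x]
    by (intro measurableI) (auto simp: space_P[OF x] space_path_sigma dest: sets.sets_into_space)
  have XT: "(\<lambda>\<omega>. X (max 0 (T \<omega>)) \<omega>) \<in> P x \<rightarrow>\<^sub>M halfline"
    using measurable_compose[OF measurable_Pair[OF id T] measurable_X_pair] by simp
  have XT_eq: "X (max 0 (T \<omega>)) \<omega> = X (T \<omega>) \<omega>" if "\<omega> \<in> space (P x)" for \<omega>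
    using T_nonneg[of \<omega>] that by (simp add: space_P[OF x])
  have "(\<lambda>\<omega>. X (max 0 (T \<omega>)) \<omega>) \<in> borel_measurable (P x)"
    using XT by (simp add: measurable_restrict_space2_iff)
  then show "(\<lambda>\<omega>. X (T \<omega>) \<omega>) \<in> borel_measurable (P x)"
    by (rule measurable_cong[THEN iffD1, rotated]) (rule XT_eq)
  assume g: "g \<in> C0_halfline"
  then have cg: "continuous_on {0..} g" by (simp add: C0_halfline_def)
  note mg = borel_measurable_continuous_on_restrict[OF cg]
  obtain B where B: "\<And>y. 0 \<le> y \<Longrightarrow> \<bar>g y\<bar> \<le> B" using C0_halfline_bounded[OF g] by metis
  let ?Y = "\<lambda>\<omega> t. g (X (max 0 t) \<omega>)"
  have Y: "(\<lambda>p. ?Y (fst p) (snd p)) \<in> borel_measurable (?N \<Otimes>\<^sub>M borel)"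
    using measurable_compose[OF measurable_X_pair mg] by (simp add: case_prod_beta)
  interpret A: prob_space "distr (P x) ?N (\<lambda>\<omega>. \<omega>)" using id by (rule prob_space_distr)
  interpret C: prob_space "distr (P x) borel T" using T by (rule prob_space_distr)
  \<comment> \<open>Rectangles determine a product of sigma-finite measures, and on rectangles the
    claim is the definition of independence.\<close>
  have eq: "distr (P x) ?N (\<lambda>\<omega>. \<omega>) \<Otimes>\<^sub>M distr (P x) borel T = distr (P x) (?N \<Otimes>\<^sub>M borel) (\<lambda>\<omega>. (\<omega>, T \<omega>))"
  proof (rule pair_measure_eqI)
    fix A B assume "A \<in> sets (distr (P x) ?N (\<lambda>\<omega>. \<omega>))" "B \<in> sets (distr (P x) borel T)"
    then have A: "A \<in> sets ?N" and B: "B \<in> sets borel" by simp_all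
    have A_sub: "A \<subseteq> space (P x)" using sets.sets_into_space[OF A] by (simp add: space_P[OF x] space_path_sigma)
    have "T -` B \<inter> space \<Omega> \<in> sets (vimage_algebra (space \<Omega>) T borel)"
      unfolding sets_vimage_algebra using B by (intro sigma_sets.Basic) auto
    from indep_setD[OF indep A this]
    have "prob (A \<inter> (T -` B \<inter> space (P x))) = prob A * prob (T -` B \<inter> space (P x))"
      by (simp add: space_P[OF x])
    moreover have "(\<lambda>\<omega>. (\<omega>, T \<omega>)) -` (A \<times> B) \<inter> space (P x) = A \<inter> (T -` B \<inter> space (P x))" by auto
    moreover have "(\<lambda>\<omega>. \<omega>) -` A \<inter> space (P x) = A" using A_sub by auto
    ultimately show "emeasure (distr (P x) ?N (\<lambda>\<omega>. \<omega>)) A * emeasure (distr (P x) borel T) B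
        = emeasure (distr (P x) (?N \<Otimes>\<^sub>M borel) (\<lambda>\<omega>. (\<omega>, T \<omega>))) (A \<times> B)"
      using A B measurable_Pair[OF id T]
      by (simp add: emeasure_distr id T emeasure_eq_measure ennreal_mult)
  qed (simp_all add: A.sigma_finite_measure_axioms C.sigma_finite_measure_axioms cong: sets_pair_measure_cong)
  interpret AC: pair_prob_space "distr (P x) ?N (\<lambda>\<omega>. \<omega>)" "distr (P x) borel T" ..
  have sets_AC: "sets (distr (P x) ?N (\<lambda>\<omega>. \<omega>) \<Otimes>\<^sub>M distr (P x) borel T) = sets (?N \<Otimes>\<^sub>M borel)"
    by (intro sets_pair_measure_cong) simp_all
  have int: "integrable (distr (P x) ?N (\<lambda>\<omega>. \<omega>) \<Otimes>\<^sub>M distr (P x) borel T) (case_prod ?Y)"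
  proof (rule AC.integrable_const_bound[where B = B])
    show "AE p in distr (P x) ?N (\<lambda>\<omega>. \<omega>) \<Otimes>\<^sub>M distr (P x) borel T. norm (case_prod ?Y p) \<le> B"
      by (intro AE_I2) (auto simp: space_pair_measure space_path_sigma nonneg_X intro!: B)
    show "case_prod ?Y \<in> borel_measurable (distr (P x) ?N (\<lambda>\<omega>. \<omega>) \<Otimes>\<^sub>M distr (P x) borel T)"
      using Y by (simp add: measurable_cong_sets[OF sets_AC refl] case_prod_beta)
  qed
  have "(LINT \<omega>|P x. g (X (T \<omega>) \<omega>)) = (LINT \<omega>|P x. case_prod ?Y (\<omega>, T \<omega>))"
    by (intro Bochner_Integration.integral_cong) (simp_all add: XT_eq)
  also have "\<dots> = integral\<^sup>L (distr (P x) (?N \<Otimes>\<^sub>M borel) (\<lambda>\<omega>. (\<omega>, T \<omega>))) (case_prod ?Y)"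
    using Y by (intro integral_distr[symmetric] measurable_Pair id T) (simp add: case_prod_beta)
  also have "\<dots> = integral\<^sup>L (distr (P x) ?N (\<lambda>\<omega>. \<omega>) \<Otimes>\<^sub>M distr (P x) borel T) (case_prod ?Y)"
    unfolding eq ..
  also have "\<dots> = (LINT \<omega>|distr (P x) ?N (\<lambda>\<omega>. \<omega>). LINT t|distr (P x) borel T. ?Y \<omega> t)"
    using AC.integral_fst[OF int] by simp
  also have "\<dots> = (LINT t|distr (P x) borel T. LINT \<omega>|distr (P x) ?N (\<lambda>\<omega>. \<omega>). ?Y \<omega> t)"
    using AC.Fubini_integral[OF int] by simp
  also have "\<dots> = (LINT t|distr (P x) borel T. expect g (max 0 t) x)"
  proof (intro Bochner_Integration.integral_cong refl)
    fix t :: real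
    have "(\<lambda>\<omega>. ?Y \<omega> t) \<in> borel_measurable ?N"
      using measurable_compose[OF measurable_Pair[OF measurable_ident_sets[OF refl] measurable_const[of t]] Y] by simp
    then show "(LINT \<omega>|distr (P x) ?N (\<lambda>\<omega>. \<omega>). ?Y \<omega> t) = expect g (max 0 t) x"
      unfolding expect_def by (intro integral_distr id)
  qed
  also have "\<dots> = (LINT \<omega>|P x. expect g (max 0 (T \<omega>)) x)"
  proof (rule integral_distr[OF T])
    have "continuous_on UNIV (\<lambda>t. expect g (max 0 t) x)"
      by (rule continuous_on_compose2[OF continuous_on_expect[OF g x]]) (auto intro!: continuous_intros)
    then show "(\<lambda>t. expect g (max 0 t) x) \<in> borel_measurable borel"
      by (rule borel_measurable_continuous_onI)
  qed
  finally show "(LINT \<omega>|P x. g (X (T \<omega>) \<omega>)) = (LINT \<omega>|P x. expect g (max 0 (T \<omega>)) x)" .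
qed

lemma expectation_at_exponential_time:
  assumes x: "0 \<le> x" and \<alpha>: "0 < \<alpha>" and T_nonneg: "\<And>\<omega>. \<omega> \<in> space \<Omega> \<Longrightarrow> 0 \<le> T \<omega>"
    and T: "distributed (P x) lborel T (exponential_density \<alpha>)"
    and indep: "prob_space.indep_set (P x)
      (sets (path_sigma \<Omega> X {0..})) (sets (vimage_algebra (space \<Omega>) T borel))"
    and gen: "infinitesimal_generator P X f (\<lambda>x. \<alpha> * f x - g x)" and g: "g \<in> C0_halfline"
  shows "(LINT \<omega>|P x. g (X (T \<omega>) \<omega>)) = \<alpha> * f x"
proof -
  have mT: "T \<in> borel_measurable (P x)" using distributed_measurable[OF T] by simp
  have "continuous_on UNIV (\<lambda>t. expect g (max 0 t) x)"
    by (rule continuous_on_compose2[OF continuous_on_expect[OF g x]]) (auto intro!: continuous_intros)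
  then have m: "(\<lambda>t. expect g (max 0 t) x) \<in> borel_measurable lborel"
    by (simp add: borel_measurable_continuous_onI)
  have "(LINT \<omega>|P x. g (X (T \<omega>) \<omega>)) = (LINT \<omega>|P x. expect g (max 0 (T \<omega>)) x)"
    using x T_nonneg mT indep g by (rule independent_time(2))
  also have "\<dots> = (LBINT t. exponential_density \<alpha> t * expect g (max 0 t) x)"
    using distributed_integral[OF T m] \<alpha> by (simp add: exponential_density_def)
  also have "\<dots> = (LBINT t. exponential_density \<alpha> t * expect g t x)"
    by (intro Bochner_Integration.integral_cong) (auto simp: exponential_density_def max_def)
  also have "\<dots> = \<alpha> * f x"
    using resolvent_eq_laplace[OF gen g \<alpha> x] by simp
  finally show ?thesis .
qed

end

section \<open>The law at an independent exponential time\<close>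

text \<open>A strictly positive density on a set of nonzero Lebesgue measure has a positive
  integral, so the normalising division is genuine.\<close>

lemma normalized_density_measure:
  assumes S: "S \<in> sets borel" "emeasure lborel S \<noteq> 0"
    and f: "set_integrable lborel S f" and pos: "\<And>y. y \<in> S \<Longrightarrow> 0 < f y"
  shows "A \<in> sets borel \<Longrightarrow> measure (normalized_density S f) A = (LBINT y:A \<inter> S. f y) / (LBINT y:S. f y)"
    and "prob_space (normalized_density S f)" and "0 < (LBINT y:S. f y)"
proof -
  let ?C = "LBINT y:S. f y"
  show C: "0 < ?C" using set_integral_pos[OF f pos] S by simp
  have [measurable]: "(\<lambda>y. indicator S y * f y) \<in> borel_measurable borel"
    using f by (auto simp: set_integrable_def)
  then have [measurable]: "(\<lambda>y. f y * indicator S y) \<in> borel_measurable borel"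
    by (simp add: mult.commute)
  have nn: "emeasure (normalized_density S f) A = ennreal ((LBINT y:A \<inter> S. f y) / ?C)" if A: "A \<in> sets borel" for A
  proof -
    have int: "set_integrable lborel (A \<inter> S) f"
      using f by (rule set_integrable_subset) (use A S in auto)
    have "emeasure (normalized_density S f) A = (\<integral>\<^sup>+y. ennreal (f y * indicator S y / ?C) * indicator A y \<partial>lborel)"
      unfolding normalized_density_def using A by (intro emeasure_density) auto
    also have "\<dots> = (\<integral>\<^sup>+y. ennreal (indicator (A \<inter> S) y *\<^sub>R f y / ?C) \<partial>lborel)"
      by (intro nn_integral_cong) (auto simp: indicator_def)
    also have "\<dots> = ennreal (LBINT y. indicator (A \<inter> S) y *\<^sub>R f y / ?C)"
      using int pos C by (intro nn_integral_eq_integral)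
        (auto simp: set_integrable_def indicator_def intro!: AE_I2 divide_nonneg_pos less_imp_le)
    also have "(LBINT y. indicator (A \<inter> S) y *\<^sub>R f y / ?C) = (LBINT y:A \<inter> S. f y) / ?C"
      by (simp add: set_lebesgue_integral_def)
    finally show ?thesis .
  qed
  have nonneg: "0 \<le> (LBINT y:A \<inter> S. f y)" for A
    unfolding set_lebesgue_integral_def using pos
    by (intro Bochner_Integration.integral_nonneg) (auto simp: indicator_def less_imp_le)
  show "measure (normalized_density S f) A = (LBINT y:A \<inter> S. f y) / ?C" if A: "A \<in> sets borel"
    unfolding measure_def nn[OF A] using nonneg C by simp
  show "prob_space (normalized_density S f)"
  proof
    have "space (normalized_density S f) = UNIV" by (simp add: normalized_density_def)
    then show "emeasure (normalized_density S f) (space (normalized_density S f)) = 1"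
      using nn[of UNIV] C by simp
  qed
qed

text \<open>Continuous approximation from below of the indicator of \<open>{c<..}\<close>. For n > 0
  the first factor rises from 0 at \<open>c\<close> to 1 over a length 1 / n; the second falls from
  1 to 0 between n - 1 and n, so the function vanishes beyond n.\<close>

definition bump :: "real \<Rightarrow> nat \<Rightarrow> real \<Rightarrow> real" where
  "bump c n y = max 0 (min 1 (real n * (y - c))) * max 0 (min 1 (real n - y))"

lemma bump_nonneg: "0 \<le> bump c n y"
  by (simp add: bump_def)

lemma continuous_on_bump: "continuous_on S (bump c n)"
  unfolding bump_def[abs_def] by (intro continuous_intros)

lemma bump_eq_0: "real n \<le> y \<Longrightarrow> bump c n y = 0"
  by (simp add: bump_def)

lemma incseq_bump: "incseq (\<lambda>n y. ennreal (bump c n y))"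
proof (intro incseq_SucI le_funI ennreal_leI)
  fix n y
  show "bump c n y \<le> bump c (Suc n) y"
  proof (cases "c < y")
    case True
    then have "real n * (y - c) \<le> real (Suc n) * (y - c)" by (intro mult_right_mono) auto
    then show ?thesis unfolding bump_def by (intro mult_mono) auto
  next
    case False
    then have "real n * (y - c) \<le> 0" by (intro mult_nonneg_nonpos) auto
    then have "bump c n y = 0" by (simp add: bump_def)
    then show ?thesis using bump_nonneg[of c "Suc n" y] by simp
  qed
qed

lemma bump_LIMSEQ: "(\<lambda>n. ennreal (bump c n y)) \<longlonglongrightarrow> indicator {c<..} y"
proof (cases "c < y")
  case True
  obtain N where N: "1 / (y - c) \<le> real N" "1 + y \<le> real N"
    using real_arch_simple[of "max (1 / (y - c)) (1 + y)"] by auto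
  have "bump c n y = 1" if "N \<le> n" for n
  proof -
    have "1 / (y - c) \<le> real n" "1 + y \<le> real n" using N that by linarith+
    then have "1 \<le> real n * (y - c)" "1 \<le> real n - y" using True by (simp_all add: field_simps)
    then show ?thesis by (simp add: bump_def)
  qed
  then have "\<forall>\<^sub>F n in sequentially. ennreal (bump c n y) = indicator {c<..} y"
    using True by (auto simp: eventually_sequentially)
  then show ?thesis by (rule tendsto_eventually)
next
  case False
  have "bump c n y = 0" for n
  proof -
    have "real n * (y - c) \<le> 0" using False by (intro mult_nonneg_nonpos) auto
    then show ?thesis by (simp add: bump_def)
  qed
  then show ?thesis using False by simp
qed

text \<open>Monotone convergence carries equality from the test functions to all sets
  \<open>{c<..}\<close>. Finiteness is asked of \<open>M\<close> alone: for the resolvent kernel it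
  is not known in advance but comes out of the comparison.\<close>

lemma measure_eqI_bump:
  fixes M N :: "real measure"
  assumes sets: "sets M = sets borel" "sets N = sets borel" and M: "finite_measure M"
    and eq: "\<And>c n. (\<integral>\<^sup>+y. ennreal (bump c n y) \<partial>M) = (\<integral>\<^sup>+y. ennreal (bump c n y) \<partial>N)"
  shows "M = N"
proof (rule measure_eqI_lessThan[OF sets])
  fix c :: real
  show "emeasure M {c<..} < \<infinity>"
    using finite_measure.emeasure_finite[OF M] by (simp add: less_top)
  have "(\<lambda>n. \<integral>\<^sup>+y. ennreal (bump c n y) \<partial>K) \<longlonglongrightarrow> emeasure K {c<..}" if "sets K = sets borel" for K :: "real measure"
  proof -
    have [measurable]: "bump c n \<in> borel_measurable borel" for n
      by (intro borel_measurable_continuous_onI continuous_on_bump)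
    have "(\<lambda>n. \<integral>\<^sup>+y. ennreal (bump c n y) \<partial>K) \<longlonglongrightarrow> (\<integral>\<^sup>+y. indicator {c<..} y \<partial>K)"
      using that by (intro nn_integral_LIMSEQ incseq_bump bump_LIMSEQ) (simp add: measurable_cong_sets[OF that refl])
    then show ?thesis using that by simp
  qed
  from this[OF sets(1)] this[OF sets(2)] show "emeasure M {c<..} = emeasure N {c<..}"
    unfolding eq by (rule LIMSEQ_unique)
qed

section \<open>The resolvent kernel as a probability law\<close>

context cir_parameters
begin

abbreviation "G \<equiv> G_sticky lam \<beta> \<delta> \<mu> \<alpha>"

definition kernel_measure :: "real \<Rightarrow> real measure" where
  "kernel_measure x = density (sticky_speed_measure lam \<beta> \<delta> \<mu>) (\<lambda>y. ennreal (\<alpha> * G x y) * indicator {0..} y)"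

lemma G_left: "y \<le> x \<Longrightarrow> G x y = f0 y * U x / w" and G_right: "x \<le> y \<Longrightarrow> G x y = f0 x * U y / w"
  by (simp_all add: G_sticky_def)

lemma G_pos: "0 \<le> x \<Longrightarrow> 0 \<le> y \<Longrightarrow> 0 < G x y"
  unfolding G_sticky_def by (intro divide_pos_pos mult_pos_pos f0_pos U_pos abs_wronskian_pos) auto

lemma continuous_on_G: "continuous_on S (G x)"
proof -
  have "continuous_on S (\<lambda>y. f0 (min x y) * U (max x y) / w)"
    using abs_wronskian_pos
    by (intro continuous_on_divide continuous_on_mult continuous_on_const
        continuous_on_compose2[OF continuous_f0(1)[of UNIV]] continuous_on_compose2[OF continuous_U(1)[of UNIV]])
      (auto intro!: continuous_intros)
  then show ?thesis by (simp add: G_sticky_def[abs_def])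
qed

lemma measurable_G [measurable]: "G x \<in> borel_measurable borel"
  by (intro borel_measurable_continuous_onI continuous_on_G)

lemma measurable_m' [measurable]: "m' \<in> borel_measurable borel"
  unfolding speed_density_def[abs_def] by measurable

lemma sets_kernel_measure [simp, measurable_cong]: "sets (kernel_measure x) = sets borel"
  by (simp add: kernel_measure_def)

lemma nn_integral_kernel_measure:
  assumes h [measurable]: "h \<in> borel_measurable borel" and x: "0 \<le> x"
  shows "(\<integral>\<^sup>+y. h y \<partial>kernel_measure x) = ennreal (\<alpha> / \<mu> * G x 0) * h 0
    + (\<integral>\<^sup>+y. ennreal (indicator {0<..} y *\<^sub>R (\<alpha> * G x y * m' y)) * h y \<partial>lborel)"
proof -
  have "(\<integral>\<^sup>+y. h y \<partial>kernel_measure x)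
      = (\<integral>\<^sup>+y. (ennreal (\<alpha> * G x y) * h y) * indicator {0..} y \<partial>sticky_speed_measure lam \<beta> \<delta> \<mu>)"
    unfolding kernel_measure_def by (subst nn_integral_density) (auto intro!: nn_integral_cong simp: mult_ac)
  also have "\<dots> = ennreal (\<alpha> * G x 0) * h 0 * ennreal (1 / \<mu>)
      + (\<integral>\<^sup>+y. (ennreal (\<alpha> * G x y) * h y) * ennreal (m' y * indicator {0<..} y) \<partial>lborel)"
    using pos by (intro nn_integral_sticky_speed) auto
  also have "ennreal (\<alpha> * G x 0) * h 0 * ennreal (1 / \<mu>) = ennreal (\<alpha> / \<mu> * G x 0) * h 0"
  proof -
    have "ennreal (\<alpha> * G x 0) * ennreal (1 / \<mu>) = ennreal (\<alpha> / \<mu> * G x 0)"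
      using pos by (subst ennreal_mult''[symmetric]) simp_all
    then show ?thesis by (metis mult.assoc mult.commute)
  qed
  also have "(\<integral>\<^sup>+y. (ennreal (\<alpha> * G x y) * h y) * ennreal (m' y * indicator {0<..} y) \<partial>lborel)
      = (\<integral>\<^sup>+y. ennreal (indicator {0<..} y *\<^sub>R (\<alpha> * G x y * m' y)) * h y \<partial>lborel)"
  proof (intro nn_integral_cong)
    fix y :: real
    have "ennreal (\<alpha> * G x y) * ennreal (m' y * indicator {0<..} y) = ennreal (indicator {0<..} y *\<^sub>R (\<alpha> * G x y * m' y))"
      using m'_nonneg[of y] by (subst ennreal_mult''[symmetric]) (simp_all add: indicator_def)
    then show "(ennreal (\<alpha> * G x y) * h y) * ennreal (m' y * indicator {0<..} y)
        = ennreal (indicator {0<..} y *\<^sub>R (\<alpha> * G x y * m' y)) * h y"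
      by (metis mult.assoc mult.commute)
  qed
  finally show ?thesis .
qed

text \<open>Splitting at y = x separates the two forms of the kernel. The upper limit
  \<open>max x R\<close> lies beyond the split point and beyond the place where \<open>g\<close>
  becomes 0.\<close>

lemma integral_G:
  assumes g: "continuous_on {0..} g" and R: "0 \<le> R" "\<And>y. R \<le> y \<Longrightarrow> g y = 0" and x: "0 \<le> x"
  shows "integral {0..max x R} (\<lambda>y. G x y * g y * m' y)
    = (U x * integral {0..x} (\<lambda>y. f0 y * g y * m' y) + f0 x * resolvent_right g R x) / w"
proof -
  let ?N = "max x R" and ?h = "\<lambda>y. G x y * g y * m' y"
  let ?F = "\<lambda>y. f0 y * g y * m' y" and ?V = "\<lambda>y. U y * g y * m' y"
  have cont: "continuous_on {0..} ?h" "continuous_on {0..} ?V"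
    by (intro continuous_on_mult continuous_on_G continuous_U g continuous_m')+
  have int: "?h integrable_on {0..?N}" "?V integrable_on {0..?N}"
    using cont by (auto intro!: integrable_continuous_interval elim: continuous_on_subset)
  have "integral {0..?N} ?h = integral {0..x} ?h + integral {x..?N} ?h"
    using x int by (intro Henstock_Kurzweil_Integration.integral_combine[symmetric]) auto
  also have "integral {0..x} ?h = integral {0..x} (\<lambda>y. U x / w * ?F y)"
    by (intro Henstock_Kurzweil_Integration.integral_cong) (simp add: G_left)
  also have "\<dots> = U x / w * integral {0..x} ?F"
    by (rule integral_mult_right)
  also have "integral {x..?N} ?h = integral {x..?N} (\<lambda>y. f0 x / w * ?V y)"
    by (intro Henstock_Kurzweil_Integration.integral_cong) (simp add: G_right)
  also have "\<dots> = f0 x / w * integral {x..?N} ?V"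
    by (rule integral_mult_right)
  also have "integral {x..?N} ?V = resolvent_right g R x"
  proof -
    have "integral {0..x} ?V + integral {x..?N} ?V = integral {0..?N} ?V"
      using x int by (intro Henstock_Kurzweil_Integration.integral_combine) auto
    moreover have "integral {0..?N} ?V = integral {0..R} ?V"
      using cont R by (intro integral_eq_of_zero_beyond) auto
    ultimately show ?thesis by (simp add: resolvent_right_def)
  qed
  finally show ?thesis by (simp add: add_divide_distrib)
qed

text \<open>The atom of the kernel supplies the summand with \<open>g 0\<close> in
  \<open>resolvent_left\<close>, the Lebesgue part supplies the two integrals. As \<open>g\<close>
  vanishes beyond \<open>R\<close>, only continuous functions on compact intervals have to be
  integrated.\<close>

lemma nn_integral_kernel_eq_resolvent:
  assumes g: "continuous_on UNIV g" and g0: "\<And>y. 0 \<le> g y" and R: "0 \<le> R" "\<And>y. R \<le> y \<Longrightarrow> g y = 0"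
    and x: "0 \<le> x"
  shows "(\<integral>\<^sup>+y. ennreal (g y) \<partial>kernel_measure x) = ennreal (\<alpha> * resolvent g R x)"
proof -
  let ?N = "max x R" and ?h = "\<lambda>y. G x y * g y * m' y"
  have g': "continuous_on S g" for S using g by (rule continuous_on_subset) simp
  have cont: "continuous_on {0..} ?h"
    by (intro continuous_on_mult continuous_on_G g' continuous_m')
  have h0: "0 \<le> ?h y" if "0 \<le> y" for y
    using G_pos[OF x that] g0 m'_nonneg by (simp add: less_imp_le)
  have [measurable]: "g \<in> borel_measurable borel" using g by (rule borel_measurable_continuous_onI)
  have int: "set_integrable lborel {0..?N} ?h"
    by (intro borel_integrable_atLeastAtMost' continuous_on_subset[OF cont]) auto
  have "(\<integral>\<^sup>+y. ennreal (indicator {0<..} y *\<^sub>R (\<alpha> * G x y * m' y)) * ennreal (g y) \<partial>lborel)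
      = (\<integral>\<^sup>+y. ennreal (\<alpha> * (indicator {0..?N} y *\<^sub>R ?h y)) \<partial>lborel)"
  proof (rule nn_integral_cong_AE)
    have "AE y in lborel. y \<noteq> (0::real)" by (rule AE_lborel_singleton)
    then show "AE y in lborel. ennreal (indicator {0<..} y *\<^sub>R (\<alpha> * G x y * m' y)) * ennreal (g y)
        = ennreal (\<alpha> * (indicator {0..?N} y *\<^sub>R ?h y))"
    proof eventually_elim
      case (elim y)
      have "indicator {0<..} y *\<^sub>R (\<alpha> * G x y * m' y) * g y = \<alpha> * (indicator {0..?N} y *\<^sub>R ?h y)"
        using elim R(2)[of y] by (cases "0 < y"; cases "y \<le> ?N") (simp_all add: mult_ac)
      then show ?case using g0[of y] by (simp only: ennreal_mult''[symmetric])
    qed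
  qed
  also have "\<dots> = ennreal (LBINT y. \<alpha> * (indicator {0..?N} y *\<^sub>R ?h y))"
    using int h0 pos by (intro nn_integral_eq_integral) (auto simp: set_integrable_def indicator_def intro!: AE_I2)
  also have "(LBINT y. \<alpha> * (indicator {0..?N} y *\<^sub>R ?h y)) = \<alpha> * integral {0..?N} ?h"
    using set_borel_integral_eq_integral(2)[OF int] by (simp add: set_lebesgue_integral_def)
  finally have "(\<integral>\<^sup>+y. ennreal (g y) \<partial>kernel_measure x)
      = ennreal (\<alpha> / \<mu> * G x 0) * ennreal (g 0) + ennreal (\<alpha> * integral {0..?N} ?h)"
    using x by (subst nn_integral_kernel_measure) simp_all
  also have "\<dots> = ennreal (\<alpha> / \<mu> * G x 0 * g 0 + \<alpha> * integral {0..?N} ?h)"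
  proof -
    have "0 \<le> integral {0..?N} ?h"
      using h0 by (intro Henstock_Kurzweil_Integration.integral_nonneg integrable_continuous_interval
          continuous_on_subset[OF cont]) auto
    then have "0 \<le> \<alpha> * integral {0..?N} ?h" using pos by simp
    moreover have "0 \<le> \<alpha> / \<mu> * G x 0" using G_pos[OF x order_refl] pos by simp
    ultimately show ?thesis using g0[of 0] by (simp only: ennreal_plus ennreal_mult mult_nonneg_nonneg)
  qed
  also have "\<alpha> / \<mu> * G x 0 * g 0 + \<alpha> * integral {0..?N} ?h = \<alpha> * resolvent g R x"
  proof -
    have "integral {0..?N} ?h = (U x * integral {0..x} (\<lambda>y. f0 y * g y * m' y) + f0 x * resolvent_right g R x) / w"
      using g' R x by (rule integral_G)
    then show ?thesis
      unfolding G_left[OF x] resolvent_def resolvent_left_def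
      by (simp add: add_divide_distrib distrib_left distrib_right)
  qed
  finally show ?thesis .
qed

lemma law_at_exponential_time:
  assumes u: "sticky_CIR lam \<beta> \<delta> \<mu> \<Omega> P u" and x: "0 \<le> x"
    and T_nonneg: "\<And>\<omega>. \<omega> \<in> space \<Omega> \<Longrightarrow> 0 \<le> T \<omega>"
    and T_exp: "distributed (P x) lborel T (exponential_density \<alpha>)"
    and T_indep: "prob_space.indep_set (P x)
      (sets (path_sigma \<Omega> u {0..})) (sets (vimage_algebra (space \<Omega>) T borel))"
  shows "(\<lambda>\<omega>. u (T \<omega>) \<omega>) \<in> borel_measurable (P x)"
    and "distr (P x) borel (\<lambda>\<omega>. u (T \<omega>) \<omega>) = kernel_measure x"
proof -
  interpret D: regular_diffusion \<Omega> P u using u by (simp add: sticky_CIR_def)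
  interpret prob_space "P x" using x by (rule D.prob_space_P)
  have mT: "T \<in> borel_measurable (P x)" using distributed_measurable[OF T_exp] by simp
  show m: "(\<lambda>\<omega>. u (T \<omega>) \<omega>) \<in> borel_measurable (P x)"
    using x T_nonneg mT T_indep by (rule D.independent_time(1))
  show "distr (P x) borel (\<lambda>\<omega>. u (T \<omega>) \<omega>) = kernel_measure x"
  proof (rule measure_eqI_bump)
    show "finite_measure (distr (P x) borel (\<lambda>\<omega>. u (T \<omega>) \<omega>))"
      using m by (rule finite_measure_distr)
    fix c :: real and n :: nat
    let ?g = "bump c n"
    note res = resolvent_solves[of ?g "real n", OF continuous_on_bump _ bump_eq_0]
    have g: "?g \<in> C0_halfline"
    proof -
      have "\<forall>\<^sub>F y in at_top. ?g y = 0"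
        using eventually_ge_at_top[of "real n"] by eventually_elim (rule bump_eq_0)
      then show ?thesis by (simp add: C0_halfline_def continuous_on_bump tendsto_eventually)
    qed
    \<comment> \<open>The direction of the generator characterisation used here leads from the
      differential problem to the domain: a solution in \<open>C0_halfline\<close> belongs to
      it.\<close>
    have gen: "infinitesimal_generator P u (resolvent ?g (real n)) (\<lambda>x. \<alpha> * resolvent ?g (real n) x - ?g x)"
      using u res by (simp add: sticky_CIR_def)
    have E: "(LINT \<omega>|P x. ?g (u (T \<omega>) \<omega>)) = \<alpha> * resolvent ?g (real n) x"
      using x pos(4) T_nonneg T_exp T_indep gen g by (rule D.expectation_at_exponential_time)
    have [measurable]: "?g \<in> borel_measurable borel"
      by (intro borel_measurable_continuous_onI continuous_on_bump)
    have "(\<integral>\<^sup>+y. ennreal (?g y) \<partial>distr (P x) borel (\<lambda>\<omega>. u (T \<omega>) \<omega>)) = (\<integral>\<^sup>+\<omega>. ennreal (?g (u (T \<omega>) \<omega>)) \<partial>P x)"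
      using m by (intro nn_integral_distr) auto
    also have "\<dots> = ennreal (LINT \<omega>|P x. ?g (u (T \<omega>) \<omega>))"
    proof (intro nn_integral_eq_integral integrable_const_bound[where B = 1] AE_I2)
      show "norm (?g (u (T \<omega>) \<omega>)) \<le> 1" for \<omega>
        unfolding bump_def by (auto simp: abs_mult intro!: mult_le_one)
      show "(\<lambda>\<omega>. ?g (u (T \<omega>) \<omega>)) \<in> borel_measurable (P x)"
        using m by measurable
    qed (rule bump_nonneg)
    also have "\<dots> = (\<integral>\<^sup>+y. ennreal (?g y) \<partial>kernel_measure x)"
      unfolding E by (rule nn_integral_kernel_eq_resolvent[symmetric])
        (simp_all add: continuous_on_bump bump_nonneg bump_eq_0 x)
    finally show "(\<integral>\<^sup>+y. ennreal (?g y) \<partial>distr (P x) borel (\<lambda>\<omega>. u (T \<omega>) \<omega>)) = (\<integral>\<^sup>+y. ennreal (?g y) \<partial>kernel_measure x)" .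
  qed simp_all
qed

text \<open>Finite total mass yields the integrability of the Lebesgue part, which allows
  nonnegative integrals to be replaced by Bochner integrals.\<close>

lemma measure_kernel_measure:
  assumes x: "0 \<le> x" and prob: "prob_space (kernel_measure x)"
  shows "set_integrable lborel {0<..} (\<lambda>y. G x y * m' y)"
    and "A \<in> sets borel \<Longrightarrow> measure (kernel_measure x) A
      = \<alpha> / \<mu> * G x 0 * indicator A 0 + \<alpha> * (LBINT y:A \<inter> {0<..}. G x y * m' y)"
proof -
  interpret prob_space "kernel_measure x" by fact
  have nonneg: "0 \<le> indicator S y *\<^sub>R (G x y * m' y)" if "S \<subseteq> {0<..}" for S y
    using G_pos[OF x, of y] m'_nonneg[of y] that by (auto simp: indicator_def less_imp_le)
  have em: "emeasure (kernel_measure x) A = ennreal (\<alpha> / \<mu> * G x 0) * indicator A 0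
      + (\<integral>\<^sup>+y. ennreal (\<alpha> * (indicator (A \<inter> {0<..}) y *\<^sub>R (G x y * m' y))) \<partial>lborel)"
    if [measurable]: "A \<in> sets borel" for A
  proof -
    have "emeasure (kernel_measure x) A = (\<integral>\<^sup>+y. indicator A y \<partial>kernel_measure x)"
      by (intro nn_integral_indicator[symmetric]) simp
    also have "\<dots> = ennreal (\<alpha> / \<mu> * G x 0) * indicator A 0
      + (\<integral>\<^sup>+y. ennreal (indicator {0<..} y *\<^sub>R (\<alpha> * G x y * m' y)) * indicator A y \<partial>lborel)"
      by (intro nn_integral_kernel_measure x) simp
    also have "(\<integral>\<^sup>+y. ennreal (indicator {0<..} y *\<^sub>R (\<alpha> * G x y * m' y)) * indicator A y \<partial>lborel)
      = (\<integral>\<^sup>+y. ennreal (\<alpha> * (indicator (A \<inter> {0<..}) y *\<^sub>R (G x y * m' y))) \<partial>lborel)"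
    proof (intro nn_integral_cong)
      fix y :: real
      show "ennreal (indicator {0<..} y *\<^sub>R (\<alpha> * G x y * m' y)) * indicator A y
          = ennreal (\<alpha> * (indicator (A \<inter> {0<..}) y *\<^sub>R (G x y * m' y)))"
        by (cases "y \<in> A"; cases "0 < y") (simp_all add: mult.assoc)
    qed
    finally show ?thesis .
  qed
  have "integrable lborel (\<lambda>y. \<alpha> * (indicator {0<..} y *\<^sub>R (G x y * m' y)))"
  proof (rule integrableI_nonneg)
    show "AE y in lborel. 0 \<le> \<alpha> * (indicator {0<..} y *\<^sub>R (G x y * m' y))"
      using nonneg[of "{0<..}"] pos by (intro AE_I2 mult_nonneg_nonneg) auto
    have "(\<integral>\<^sup>+y. ennreal (\<alpha> * (indicator {0<..} y *\<^sub>R (G x y * m' y))) \<partial>lborel) \<le> emeasure (kernel_measure x) UNIV"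
      by (subst em) simp_all
    also have "\<dots> < \<infinity>" by (simp add: emeasure_eq_measure)
    finally show "(\<integral>\<^sup>+y. ennreal (\<alpha> * (indicator {0<..} y *\<^sub>R (G x y * m' y))) \<partial>lborel) < \<infinity>" .
  qed simp
  then show int: "set_integrable lborel {0<..} (\<lambda>y. G x y * m' y)"
    using pos unfolding set_integrable_def by simp
  assume A: "A \<in> sets borel"
  have intA: "set_integrable lborel (A \<inter> {0<..}) (\<lambda>y. G x y * m' y)"
    using A by (intro set_integrable_subset[OF int]) auto
  have "(\<integral>\<^sup>+y. ennreal (\<alpha> * (indicator (A \<inter> {0<..}) y *\<^sub>R (G x y * m' y))) \<partial>lborel)
      = ennreal (LBINT y. \<alpha> * (indicator (A \<inter> {0<..}) y *\<^sub>R (G x y * m' y)))"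
    using intA pos nonneg[of "A \<inter> {0<..}"] unfolding set_integrable_def
    by (intro nn_integral_eq_integral AE_I2 mult_nonneg_nonneg) auto
  also have "(LBINT y. \<alpha> * (indicator (A \<inter> {0<..}) y *\<^sub>R (G x y * m' y))) = \<alpha> * (LBINT y:A \<inter> {0<..}. G x y * m' y)"
    by (simp add: set_lebesgue_integral_def)
  finally have "emeasure (kernel_measure x) A
      = ennreal (\<alpha> / \<mu> * G x 0 * indicator A 0) + ennreal (\<alpha> * (LBINT y:A \<inter> {0<..}. G x y * m' y))"
    using em[OF A] by (simp add: indicator_def)
  moreover have "0 \<le> \<alpha> * (LBINT y:A \<inter> {0<..}. G x y * m' y)"
    unfolding set_lebesgue_integral_def using nonneg[of "A \<inter> {0<..}"] pos by (intro mult_nonneg_nonneg Bochner_Integration.integral_nonneg) auto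
  moreover have "0 \<le> \<alpha> / \<mu> * G x 0 * indicator A 0"
    using G_pos[OF x order_refl] pos by (simp add: less_imp_le)
  ultimately show "measure (kernel_measure x) A
      = \<alpha> / \<mu> * G x 0 * indicator A 0 + \<alpha> * (LBINT y:A \<inter> {0<..}. G x y * m' y)"
    by (simp add: measure_def flip: ennreal_plus)
qed

text \<open>For fixed x the kernel is a constant times \<open>f0\<close> to the left of x and a
  constant times \<open>U\<close> to the right. The component densities inherit integrability from
  it, and their normalising integrals cancel against those in the weights.\<close>

lemma mixture:
  assumes x: "0 < x" and int: "set_integrable lborel {0<..} (\<lambda>y. G x y * m' y)"
  shows "A \<in> sets borel \<Longrightarrow> \<alpha> / \<mu> * G x 0 * indicator A 0 + \<alpha> * (LBINT y:A \<inter> {0<..}. G x y * m' y)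
      = w_zero lam \<beta> \<delta> \<mu> \<alpha> x * indicator A 0
        + w_less lam \<beta> \<delta> \<mu> \<alpha> x * measure (nu_less lam \<beta> \<delta> \<mu> \<alpha> x) A
        + w_greater lam \<beta> \<delta> \<mu> \<alpha> x * measure (nu_greater lam \<beta> \<delta> \<alpha> x) A"
    and "prob_space (nu_less lam \<beta> \<delta> \<mu> \<alpha> x)" "prob_space (nu_greater lam \<beta> \<delta> \<alpha> x)"
proof -
  have Ux: "U x \<noteq> 0" "f0 x \<noteq> 0" "w \<noteq> 0" using U_pos[of x] f0_pos[of x] abs_wronskian_pos x by auto
  have intL: "set_integrable lborel {0<..<x} (\<lambda>y. f0 y * m' y)"
  proof -
    have "set_integrable lborel {0<..<x} (\<lambda>y. w / U x * (G x y * m' y))"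
      by (intro set_integrable_mult_right set_integrable_subset[OF int]) auto
    then show ?thesis
      by (rule set_integrable_cong[THEN iffD1, rotated -1]) (use Ux in \<open>auto simp: G_left\<close>)
  qed
  have intR: "set_integrable lborel {x<..} (\<lambda>y. U y * m' y)"
  proof -
    have "set_integrable lborel {x<..} (\<lambda>y. w / f0 x * (G x y * m' y))"
      using x by (intro set_integrable_mult_right set_integrable_subset[OF int]) auto
    then show ?thesis
      by (rule set_integrable_cong[THEN iffD1, rotated -1]) (use Ux in \<open>auto simp: G_right\<close>)
  qed
  have posL: "0 < f0 y * m' y" if "y \<in> {0<..<x}" for y using that by (intro mult_pos_pos f0_pos m'_pos) auto
  have posR: "0 < U y * m' y" if "y \<in> {x<..}" for y using that x by (intro mult_pos_pos U_pos m'_pos) auto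
  have S: "{0<..<x} \<in> sets borel" "emeasure lborel {0<..<x} \<noteq> 0" "{x<..} \<in> sets borel" "emeasure lborel {x<..} \<noteq> 0"
    using x by auto
  have L: "measure (nu_less lam \<beta> \<delta> \<mu> \<alpha> x) A = (LBINT y:A \<inter> {0<..<x}. f0 y * m' y) / (LBINT y:{0<..<x}. f0 y * m' y)"
    if "A \<in> sets borel" for A
    unfolding nu_less_def using S(1,2) intL posL that by (rule normalized_density_measure(1))
  have R: "measure (nu_greater lam \<beta> \<delta> \<alpha> x) A = (LBINT y:A \<inter> {x<..}. U y * m' y) / (LBINT y:{x<..}. U y * m' y)"
    if "A \<in> sets borel" for A
    unfolding nu_greater_def using S(3,4) intR posR that by (rule normalized_density_measure(1))
  have L0: "0 < (LBINT y:{0<..<x}. f0 y * m' y)" and R0: "0 < (LBINT y:{x<..}. U y * m' y)"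
    using normalized_density_measure(3)[OF S(3,4) intR, OF posR] normalized_density_measure(3)[OF S(1,2) intL, OF posL]
    by simp_all
  show "prob_space (nu_less lam \<beta> \<delta> \<mu> \<alpha> x)" "prob_space (nu_greater lam \<beta> \<delta> \<alpha> x)"
    unfolding nu_less_def nu_greater_def
    using normalized_density_measure(2)[OF S(3,4) intR, OF posR] normalized_density_measure(2)[OF S(1,2) intL, OF posL]
    by simp_all
  assume A: "A \<in> sets borel"
  let ?h = "\<lambda>y. G x y * m' y"
  \<comment> \<open>The point y = x belongs to neither piece, but it is a Lebesgue null set.\<close>
  have "(LBINT y:A \<inter> {0<..}. ?h y) = (LBINT y:(A \<inter> {0<..<x}) \<union> (A \<inter> {x<..}). ?h y)"
  proof (rule set_integral_cong_set)
    show "set_borel_measurable lborel (A \<inter> {0<..<x} \<union> A \<inter> {x<..}) ?h" "set_borel_measurable lborel (A \<inter> {0<..}) ?h"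
      unfolding set_borel_measurable_def using A by simp_all
    have "AE y in lborel. y \<noteq> x" by (rule AE_lborel_singleton)
    then show "AE y in lborel. (y \<in> A \<inter> {0<..<x} \<union> A \<inter> {x<..}) = (y \<in> A \<inter> {0<..})"
      by eventually_elim (use x in auto)
  qed
  also have "\<dots> = (LBINT y:A \<inter> {0<..<x}. ?h y) + (LBINT y:A \<inter> {x<..}. ?h y)"
  proof (rule set_integral_Un)
    show "set_integrable lborel (A \<inter> {0<..<x}) ?h" "set_integrable lborel (A \<inter> {x<..}) ?h"
      using A x by (auto intro!: set_integrable_subset[OF int])
  qed auto
  also have "(LBINT y:A \<inter> {0<..<x}. ?h y) = (LBINT y:A \<inter> {0<..<x}. U x / w * (f0 y * m' y))"
    using A by (intro set_lebesgue_integral_cong) (auto simp: G_left)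
  also have "\<dots> = U x / w * (LBINT y:A \<inter> {0<..<x}. f0 y * m' y)"
    by (rule set_integral_mult_right)
  also have "(LBINT y:A \<inter> {x<..}. ?h y) = (LBINT y:A \<inter> {x<..}. f0 x / w * (U y * m' y))"
    using A by (intro set_lebesgue_integral_cong) (auto simp: G_right)
  also have "\<dots> = f0 x / w * (LBINT y:A \<inter> {x<..}. U y * m' y)"
    by (rule set_integral_mult_right)
  finally have eq: "(LBINT y:A \<inter> {0<..}. ?h y) = U x / w * (LBINT y:A \<inter> {0<..<x}. f0 y * m' y)
      + f0 x / w * (LBINT y:A \<inter> {x<..}. U y * m' y)" .
  have "w_less lam \<beta> \<delta> \<mu> \<alpha> x * measure (nu_less lam \<beta> \<delta> \<mu> \<alpha> x) A
      = \<alpha> * U x / w * (LBINT y:A \<inter> {0<..<x}. f0 y * m' y)"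
    unfolding L[OF A] w_less_def using L0 by simp
  moreover have "w_greater lam \<beta> \<delta> \<mu> \<alpha> x * measure (nu_greater lam \<beta> \<delta> \<alpha> x) A
      = \<alpha> * f0 x / w * (LBINT y:A \<inter> {x<..}. U y * m' y)"
    unfolding R[OF A] w_greater_def using R0 by simp
  \<comment> \<open>Here the sticky condition, in the form \<open>c_f0_0\<close>, identifies the two
    expressions for the mass at 0.\<close>
  moreover have "\<alpha> / \<mu> * G x 0 = w_zero lam \<beta> \<delta> \<mu> \<alpha> x"
    using x unfolding w_zero_def c_f0_0 by (simp add: G_left)
  ultimately show "\<alpha> / \<mu> * G x 0 * indicator A 0 + \<alpha> * (LBINT y:A \<inter> {0<..}. G x y * m' y)
      = w_zero lam \<beta> \<delta> \<mu> \<alpha> x * indicator A 0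
        + w_less lam \<beta> \<delta> \<mu> \<alpha> x * measure (nu_less lam \<beta> \<delta> \<mu> \<alpha> x) A
        + w_greater lam \<beta> \<delta> \<mu> \<alpha> x * measure (nu_greater lam \<beta> \<delta> \<alpha> x) A"
    unfolding eq distrib_left by simp
qed

end

theorem theorem4p5:
  fixes lam \<beta> \<mu> \<alpha> \<delta> x :: real
    and \<Omega> :: "'w measure" and P :: "real \<Rightarrow> 'w measure"
    and u :: "real \<Rightarrow> 'w \<Rightarrow> real" and T :: "'w \<Rightarrow> real"
  assumes pos: "lam > 0" "\<beta> > 0" "\<mu> > 0" "\<alpha> > 0"
    and delta: "1 < \<delta>" "\<delta> < 2"
    and u: "sticky_CIR lam \<beta> \<delta> \<mu> \<Omega> P u"
    and x: "x > 0"
    and T_nonneg: "\<And>\<omega>. \<omega> \<in> space \<Omega> \<Longrightarrow> 0 \<le> T \<omega>"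
    and T_exp: "distributed (P x) lborel T (exponential_density \<alpha>)"
    and T_indep: "prob_space.indep_set (P x)
      (sets (path_sigma \<Omega> u {0..})) (sets (vimage_algebra (space \<Omega>) T borel))"
  shows "(\<forall>A. A \<in> sets borel \<and> A \<subseteq> {0..} \<longrightarrow>
        \<P>(\<omega> in P x. u (T \<omega>) \<omega> \<in> A) =
          \<alpha> / \<mu> * G_sticky lam \<beta> \<delta> \<mu> \<alpha> x 0 * indicator A 0
          + \<alpha> * (LBINT y:A \<inter> {0<..}. G_sticky lam \<beta> \<delta> \<mu> \<alpha> x y * speed_density lam \<beta> \<delta> y))
    \<and> (\<forall>A. A \<in> sets borel \<and> A \<subseteq> {0..} \<longrightarrow>
        \<P>(\<omega> in P x. u (T \<omega>) \<omega> \<in> A) =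
          w_zero lam \<beta> \<delta> \<mu> \<alpha> x * indicator A 0
          + w_less lam \<beta> \<delta> \<mu> \<alpha> x * measure (nu_less lam \<beta> \<delta> \<mu> \<alpha> x) A
          + w_greater lam \<beta> \<delta> \<mu> \<alpha> x * measure (nu_greater lam \<beta> \<delta> \<alpha> x) A)
    \<and> prob_space (nu_less lam \<beta> \<delta> \<mu> \<alpha> x)
    \<and> prob_space (nu_greater lam \<beta> \<delta> \<alpha> x)
    \<and> w_zero lam \<beta> \<delta> \<mu> \<alpha> x + w_less lam \<beta> \<delta> \<mu> \<alpha> x + w_greater lam \<beta> \<delta> \<mu> \<alpha> x = 1"
proof -
  interpret cir_parameters lam \<beta> \<mu> \<alpha> \<delta> by unfold_locales fact+
  have x0: "0 \<le> x" using x by simp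
  interpret D: regular_diffusion \<Omega> P u using u by (simp add: sticky_CIR_def)
  interpret prob_space "P x" using x0 by (rule D.prob_space_P)
  have law_measurable: "(\<lambda>\<omega>. u (T \<omega>) \<omega>) \<in> borel_measurable (P x)"
    using u x0 T_nonneg T_exp T_indep by (rule law_at_exponential_time(1))
  have law: "distr (P x) borel (\<lambda>\<omega>. u (T \<omega>) \<omega>) = kernel_measure x"
    using u x0 T_nonneg T_exp T_indep by (rule law_at_exponential_time(2))
  have K: "prob_space (kernel_measure x)"
    unfolding law[symmetric] using law_measurable by (rule prob_space_distr)
  interpret K: prob_space "kernel_measure x" by (rule K)
  have P: "\<P>(\<omega> in P x. u (T \<omega>) \<omega> \<in> A) = measure (kernel_measure x) A" if "A \<in> sets borel" for A
    unfolding law[symmetric] using that law_measurable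
    by (subst measure_distr) (auto intro!: arg_cong[where f = prob])
  note kernel = measure_kernel_measure[OF x0 K]
  note mix = mixture[OF x kernel(1)]
  \<comment> \<open>At \<open>UNIV\<close> the indicator and both component measures equal 1, so the
    mixture formula leaves exactly the sum of the weights.\<close>
  have "w_zero lam \<beta> \<delta> \<mu> \<alpha> x + w_less lam \<beta> \<delta> \<mu> \<alpha> x + w_greater lam \<beta> \<delta> \<mu> \<alpha> x
      = measure (kernel_measure x) UNIV"
  proof -
    interpret L: prob_space "nu_less lam \<beta> \<delta> \<mu> \<alpha> x" by (rule mix(2))
    interpret R: prob_space "nu_greater lam \<beta> \<delta> \<alpha> x" by (rule mix(3))
    have "measure (nu_less lam \<beta> \<delta> \<mu> \<alpha> x) UNIV = 1" "measure (nu_greater lam \<beta> \<delta> \<alpha> x) UNIV = 1"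
      using L.prob_space R.prob_space by (simp_all add: nu_less_def nu_greater_def normalized_density_def)
    then show ?thesis using kernel(2)[of UNIV] mix(1)[of UNIV] by simp
  qed
  also have "\<dots> = 1"
    using K.prob_space sets_eq_imp_space_eq[OF sets_kernel_measure[of x]] by simp
  finally show ?thesis using P kernel(2) mix by simp
qed

end
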